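(* Let $x=(x_1,x_2)\in\Omega_\varepsilon$. If $0\le\varepsilon<\sqrt2\log 2$, then $$\mathbf{B}^{d+}_\varepsilon(x)=B^+_{\delta^+(\varepsilon)}(x),$$ where $\delta=\delta^+(\varepsilon)$ is the unique solution of the equation $$\bigl(1-\sqrt{\delta^2-\varepsilon^2}\bigr)e^{\sqrt{\delta^2-\varepsilon^2}}\bigl(2-e^{\varepsilon/\sqrt2}\bigr)-(1-\delta)e^{\delta-\varepsilon/\sqrt2}=0;$$ if $\varepsilon\ge \sqrt2\log 2$, then $$\mathbf{B}^{d+}_{\varepsilon}(x)=\begin{cases}e^{x_1}&\text{if } x_2=x_1^2,\\ +\infty&\text{if } x_2>x_1^2.\end{cases}$$ In addition, $$\mathbf{B}_\varepsilon^{d-}(x)=B^-_{\delta^-(\varepsilon)}(x),\qquad\forall\,\varepsilon\ge0,$$ where $\delta=\delta^-(\varepsilon)$ is the unique solution of the equation $$\bigl(1+\sqrt{\delta^2-\varepsilon^2}\bigr)e^{-\sqrt{\delta^2-\varepsilon^2}}\bigl(2-e^{-\varepsilon/\sqrt2}\bigr)-(1+\delta)e^{-\delta+\varepsilon/\sqrt2}=0,\qquad \varepsilon\ge0.$$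
   Context: For an interval $J$, $\langle\varphi\rangle_J=\frac1{|J|}\int_J\varphi$. The dyadic lattice rooted in an interval $I$ is the collection of intervals obtained from $I$ by repeatedly splitting intervals into two halves of equal length ($I$ included). $\mathrm{BMO}^d(I)$ is the set of real-valued $\varphi\in L^1(I)$ with $\|\varphi\|_{\mathrm{BMO}^d(I)}=\bigl(\sup_{J}\{\langle\varphi^2\rangle_J-\langle\varphi\rangle_J^2\}\bigr)^{1/2}<\infty$, the supremum being over all $J$ in the dyadic lattice rooted in $I$, and $\mathrm{BMO}^d_\varepsilon(I)=\{\varphi\in\mathrm{BMO}^d(I):\|\varphi\|_{\mathrm{BMO}^d(I)}\le\varepsilon\}$. For $\varepsilon\ge0$ let $$\Omega_\varepsilon=\{x=(x_1,x_2): x_1\in\mathbb{R},\ x_1^2\le x_2\le x_1^2+\varepsilon^2\}.$$ For $x\in\Omega_\varepsilon$ the dyadic Bellman functions (which do not depend on the interval $I$) are $$\mathbf{B}^{d+}_{\varepsilon}(x)=\sup_{\varphi\in \mathrm{BMO}^d_{\varepsilon}(I)}\{\langle e^\varphi\rangle_I:\ \langle\varphi\rangle_I=x_1,\ \langle\varphi^2\rangle_I=x_2\},$$ $$\mathbf{B}^{d-}_{\varepsilon}(x)=\inf_{\varphi\in \mathrm{BMO}^d_{\varepsilon}(I)}\{\langle e^\varphi\rangle_I:\ \langle\varphi\rangle_I=x_1,\ \langle\varphi^2\rangle_I=x_2\}.$$ The explicit functions $B^\pm_\delta$, with domain $\Omega_\delta$ (defined as $\Omega_\varepsilon$ with $\delta$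 in place of $\varepsilon$), are $$B^+_{\delta}(x)=\frac{1-\sqrt{\delta^2+x_1^2-x_2}}{1-\delta}\exp\Bigl(x_1+\sqrt{\delta^2+x_1^2-x_2}-\delta\Bigr),$$ $$B^-_{\delta}(x)=\frac{1+\sqrt{\delta^2+x_1^2-x_2}}{1+\delta}\exp\Bigl(x_1-\sqrt{\delta^2+x_1^2-x_2}+\delta\Bigr).$$
   Formalization: Uniqueness of δ is claimed among δ ≥ ε and only for ε > 0: at ε = 0 every δ ≥ 0 solves both equations, so uniqueness fails. There the formula is proved for every solution δ ≥ 0 (with δ < 1 for the + case). *)

theory Defs
  imports "HOL-Analysis.Analysis"
begin

definition avg :: "real set \<Rightarrow> (real \<Rightarrow> real) \<Rightarrow> real" where
  "avg J f = (LINT t:J|lebesgue. f t) / measure lebesgue J"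

text \<open>The average of a function that may fail to be integrable; \<open>ennreal\<close> truncates
  negative values, so this is only meant for nonnegative functions.\<close>

definition avg_nn :: "real set \<Rightarrow> (real \<Rightarrow> real) \<Rightarrow> ennreal" where
  "avg_nn J f = (\<integral>\<^sup>+t\<in>J. ennreal (f t) \<partial>lebesgue) / emeasure lebesgue J"

text \<open>Intervals are taken closed; the two halves overlap in a null set.\<close>

inductive_set dyadic_lattice :: "real set \<Rightarrow> real set set" for I :: "real set" where
  root: "I \<in> dyadic_lattice I"
| left: "{a..b} \<in> dyadic_lattice I \<Longrightarrow> {a..(a + b) / 2} \<in> dyadic_lattice I"
| right: "{a..b} \<in> dyadic_lattice I \<Longrightarrow> {(a + b) / 2..b} \<in> dyadic_lattice I"

definition avg_variance :: "(real \<Rightarrow> real) \<Rightarrow> real set \<Rightarrow> real" where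
  "avg_variance \<phi> J = avg J (\<lambda>t. (\<phi> t)\<^sup>2) - (avg J \<phi>)\<^sup>2"

text \<open>Finiteness of the supremum of the variances includes the finiteness of the average of
  \<open>\<phi>\<^sup>2\<close> over \<open>I\<close>, as \<open>I\<close> itself belongs to the lattice. It is required explicitly
  because the Lebesgue integral of a non-integrable function is 0 here.\<close>

definition BMOd :: "real set \<Rightarrow> (real \<Rightarrow> real) set" where
  "BMOd I = {\<phi>. set_integrable lebesgue I \<phi> \<and> set_integrable lebesgue I (\<lambda>t. (\<phi> t)\<^sup>2) \<and>
     bdd_above (avg_variance \<phi> ` dyadic_lattice I)}"

definition BMOd_norm :: "real set \<Rightarrow> (real \<Rightarrow> real) \<Rightarrow> real" where
  "BMOd_norm I \<phi> = sqrt (SUP J\<in>dyadic_lattice I. avg_variance \<phi> J)"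

definition BMOd_ball :: "real \<Rightarrow> real set \<Rightarrow> (real \<Rightarrow> real) set" where
  "BMOd_ball \<epsilon> I = {\<phi> \<in> BMOd I. BMOd_norm I \<phi> \<le> \<epsilon>}"

definition Omega :: "real \<Rightarrow> (real \<times> real) set" where
  "Omega \<epsilon> = {(x1, x2). x1\<^sup>2 \<le> x2 \<and> x2 \<le> x1\<^sup>2 + \<epsilon>\<^sup>2}"

definition test_functions :: "real \<Rightarrow> real set \<Rightarrow> real \<times> real \<Rightarrow> (real \<Rightarrow> real) set" where
  "test_functions \<epsilon> I x =
     {\<phi> \<in> BMOd_ball \<epsilon> I. avg I \<phi> = fst x \<and> avg I (\<lambda>t. (\<phi> t)\<^sup>2) = snd x}"

definition bellman_sup :: "real \<Rightarrow> real set \<Rightarrow> real \<times> real \<Rightarrow> ennreal" where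
  "bellman_sup \<epsilon> I x = (SUP \<phi>\<in>test_functions \<epsilon> I x. avg_nn I (\<lambda>t. exp (\<phi> t)))"

definition bellman_inf :: "real \<Rightarrow> real set \<Rightarrow> real \<times> real \<Rightarrow> ennreal" where
  "bellman_inf \<epsilon> I x = (INF \<phi>\<in>test_functions \<epsilon> I x. avg_nn I (\<lambda>t. exp (\<phi> t)))"

fun B_plus :: "real \<Rightarrow> real \<times> real \<Rightarrow> real" where
  "B_plus \<delta> (x1, x2) =
     (1 - sqrt (\<delta>\<^sup>2 + x1\<^sup>2 - x2)) / (1 - \<delta>) * exp (x1 + sqrt (\<delta>\<^sup>2 + x1\<^sup>2 - x2) - \<delta>)"

fun B_minus :: "real \<Rightarrow> real \<times> real \<Rightarrow> real" where
  "B_minus \<delta> (x1, x2) =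
     (1 + sqrt (\<delta>\<^sup>2 + x1\<^sup>2 - x2)) / (1 + \<delta>) * exp (x1 - sqrt (\<delta>\<^sup>2 + x1\<^sup>2 - x2) + \<delta>)"

text \<open>Both equations below are posed for \<open>\<delta> \<ge> \<epsilon>\<close>, so that the square root is real and
  \<open>Omega \<epsilon> \<subseteq> Omega \<delta>\<close>. For \<open>\<epsilon> = 0\<close> they degenerate: every \<open>\<delta> \<ge> 0\<close> is a solution.\<close>

definition delta_plus_eq :: "real \<Rightarrow> real \<Rightarrow> bool" where
  "delta_plus_eq \<epsilon> \<delta> \<longleftrightarrow>
     (1 - sqrt (\<delta>\<^sup>2 - \<epsilon>\<^sup>2)) * exp (sqrt (\<delta>\<^sup>2 - \<epsilon>\<^sup>2)) * (2 - exp (\<epsilon> / sqrt 2))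
       - (1 - \<delta>) * exp (\<delta> - \<epsilon> / sqrt 2) = 0"

definition delta_minus_eq :: "real \<Rightarrow> real \<Rightarrow> bool" where
  "delta_minus_eq \<epsilon> \<delta> \<longleftrightarrow>
     (1 + sqrt (\<delta>\<^sup>2 - \<epsilon>\<^sup>2)) * exp (- sqrt (\<delta>\<^sup>2 - \<epsilon>\<^sup>2)) * (2 - exp (- \<epsilon> / sqrt 2))
       - (1 + \<delta>) * exp (- \<delta> + \<epsilon> / sqrt 2) = 0"

end

theory Submission
  imports Defs
begin

text \<open>
  The candidate \<open>B\<close> is locally concave (convex) on \<open>Omega \<delta>\<close>, but two halves of a dyadic interval may give
  points of \<open>Omega \<epsilon>\<close> whose segment leaves \<open>Omega \<delta>\<close>. The equation for \<open>\<delta>\<close> says that the midpoint inequality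
  is an equality for the extreme splitting of an upper boundary point \<open>(u, u\<^sup>2 + \<epsilon>\<^sup>2)\<close> into
  \<open>(u - c, (u - c)\<^sup>2)\<close> and \<open>(u + c, (u + c)\<^sup>2 + \<epsilon>\<^sup>2)\<close>, \<open>c = \<epsilon> / sqrt 2\<close> (with \<open>-c\<close> for the infimum); all other
  splittings inside \<open>Omega \<epsilon>\<close> can be deformed monotonically to this one or to a tangent segment, along
  which \<open>B\<close> is affine. Iterating the midpoint inequality over dyadic generations, Lebesgue's
  differentiation theorem and Fatou's lemma bound the averages of \<open>exp \<phi>\<close> by \<open>B\<close>.

  Conversely, concatenating test functions shows that the Bellman function is itself midpoint concave
  (convex) on \<open>Omega \<epsilon>\<close>. The extreme splitting and the translation \<open>\<phi> + h\<close> then bound it on the upper boundary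
  by \<open>B\<close> from the other side, or show it to be infinite when \<open>exp c \<ge> 2\<close>, and tangent segments carry the
  bound to the interior.
\<close>

section \<open>The midpoint inequality for the candidates\<close>

text \<open>Origin of \<open>c = \<epsilon> / sqrt 2\<close>: a lower boundary point at
  \<open>u - c\<close> and an upper boundary point at \<open>u + c\<close> have a midpoint with
  \<open>x2 - x1\<^sup>2 = c\<^sup>2 + \<epsilon>\<^sup>2 / 2\<close>, and this is
  \<open>\<epsilon>\<^sup>2\<close> exactly for that \<open>c\<close>. Adding \<open>h\<close> to a
  function multiplies its exponential by \<open>exp h\<close>, so this split is self-similar: the
  value \<open>M\<close> of the supremum at \<open>(0, \<epsilon>\<^sup>2)\<close> satisfies
  \<open>exp (- c) + exp c * M \<le> 2 * M\<close>. Hence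
  \<open>M \<ge> exp (- c) / (2 - exp c)\<close> if \<open>exp c < 2\<close>, and no finite
  \<open>M\<close> exists otherwise; this is the source of \<open>sqrt 2 * ln 2\<close>. The
  equation for \<delta> says that the candidate takes exactly this extreme value there. The factor
  \<open>exp x1\<close> splits off from the candidate, so its midpoint inequality involves only the
  horizontal distance and three square roots, tied by one quadratic relation. The deformations are
  calculus in these variables and may pass through values that belong to no points of
  \<open>Omega \<epsilon>\<close>. Two obstacles are analytic: Fatou's lemma gives bounds from above
  only, and the Bellman functions are not known to be continuous, so concavity along tangents is
  exploited with boundedness alone.\<close>

text \<open>Throughout, \<open>l = 1\<close> treats the supremum and \<open>l = -1\<close> the infimum. With
  \<open>s = sqrt (\<delta>\<^sup>2 + x1\<^sup>2 - x2)\<close> the candidate at \<open>x\<close> is \<open>kern l s / kern l \<delta> * exp x1\<close>.\<close>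

definition kern :: "real \<Rightarrow> real \<Rightarrow> real" where
  "kern l t = (1 - l * t) * exp (l * t)"

text \<open>Because \<open>l * l = 1\<close>, the derivative of \<open>kern l\<close> is
  \<open>- t * exp (l * t)\<close>. Its sign is the same for both values of \<open>l\<close>, which
  allows a common treatment of supremum and infimum.\<close>

lemma kern_has_derivative [derivative_intros]:
  assumes "l * l = 1" "(f has_real_derivative D) (at t)"
  shows "((\<lambda>t. kern l (f t)) has_real_derivative (- (f t) * exp (l * f t) * D)) (at t)"
proof -
  have "l * (l * y) = y" for y using assms(1) by (simp add: mult.assoc [symmetric])
  then show ?thesis
    unfolding kern_def
    by (auto intro!: derivative_eq_intros assms(2) simp: algebra_simps)
qed

lemma continuous_on_kern [continuous_intros]:
  "continuous_on A f \<Longrightarrow> continuous_on A (\<lambda>t. kern l (f t))"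
  unfolding kern_def by (intro continuous_intros)

lemma sign_mult_exp_le:
  assumes "l = 1 \<or> l = - (1::real)" "x \<le> y"
  shows "l * exp (l * x) \<le> l * exp (l * y)"
  using assms by auto

lemma kern_decreasing:
  assumes l: "l = 1 \<or> l = -1" and "0 \<le> x" "x \<le> y"
  shows "kern l y \<le> kern l x"
proof (rule DERIV_nonpos_imp_nonincreasing [OF \<open>x \<le> y\<close>])
  fix t assume "x \<le> t"
  then have "0 \<le> t" using \<open>0 \<le> x\<close> by simp
  have "(kern l has_real_derivative - t * exp (l * t) * 1) (at t)"
    using l by (intro kern_has_derivative) auto
  moreover have "- t * exp (l * t) * 1 \<le> 0"
    using \<open>0 \<le> t\<close> by simp
  ultimately show "\<exists>D. (kern l has_real_derivative D) (at t) \<and> D \<le> 0"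
    by blast
qed

lemma kern_increasing_neg:
  assumes l: "l = 1 \<or> l = -1" and "y \<le> 0" "x \<le> y"
  shows "kern l x \<le> kern l y"
proof (rule DERIV_nonneg_imp_nondecreasing [OF \<open>x \<le> y\<close>])
  fix t assume "t \<le> y"
  then have "t \<le> 0" using \<open>y \<le> 0\<close> by simp
  have "(kern l has_real_derivative - t * exp (l * t) * 1) (at t)"
    using l by (intro kern_has_derivative) auto
  moreover have "0 \<le> - t * exp (l * t) * 1"
    using \<open>t \<le> 0\<close> by (simp add: mult_nonpos_nonneg)
  ultimately show "\<exists>D. (kern l has_real_derivative D) (at t) \<and> 0 \<le> D"
    by blast
qed

text \<open>As a function of \<open>t\<^sup>2\<close>, \<open>kern l t\<close> has derivative \<open>- exp (l * t) / 2\<close>, so \<open>l * kern l t\<close> is concave in \<open>t\<^sup>2\<close>.\<close>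

lemma kern_tangent:
  assumes l: "l = 1 \<or> l = -1" and p: "0 \<le> p" and r: "0 \<le> r"
  shows "l * kern l p \<le> l * kern l r - l * exp (l * r) / 2 * (p\<^sup>2 - r\<^sup>2)"
proof -
  \<comment> \<open>The claim says that \<open>f\<close> is largest at \<open>r\<close>: its
    derivative is \<open>t\<close> times a difference of values of the increasing function
    \<open>l * exp (l * t)\<close>, and it changes sign at \<open>r\<close>.\<close>
  define f where "f t = l * kern l t + l * exp (l * r) / 2 * t\<^sup>2" for t
  have D: "(f has_real_derivative (t * (l * exp (l * r) - l * exp (l * t)))) (at t)" for t
    unfolding f_def using l
    by (auto intro!: derivative_eq_intros simp: algebra_simps)
  have "f p \<le> f r"
  proof (cases "p \<le> r")
    case True
    show ?thesis
    proof (rule DERIV_nonneg_imp_nondecreasing [OF True])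
      fix t assume "p \<le> t" "t \<le> r"
      then have "0 \<le> t * (l * exp (l * r) - l * exp (l * t))"
        using sign_mult_exp_le [OF l, of t r] p by simp
      then show "\<exists>y. (f has_real_derivative y) (at t) \<and> 0 \<le> y" using D by blast
    qed
  next
    case False
    then have "r \<le> p" by simp
    show ?thesis
    proof (rule DERIV_nonpos_imp_nonincreasing [OF \<open>r \<le> p\<close>])
      fix t assume "r \<le> t" "t \<le> p"
      then have "t * (l * exp (l * r) - l * exp (l * t)) \<le> 0"
        using sign_mult_exp_le [OF l, of r t] r by (simp add: mult_nonneg_nonpos)
      then show "\<exists>y. (f has_real_derivative y) (at t) \<and> y \<le> 0" using D by blast
    qed
  qed
  then show ?thesis by (simp add: f_def algebra_simps)
qed

text \<open>Up to the factor \<open>exp z1 / kern l \<delta>\<close> this is \<open>l\<close> times the midpoint defect of the candidate at a point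
  \<open>z\<close> with square root \<open>s\<close>, the end points having first coordinates \<open>z1 + l * d\<close>, \<open>z1 - l * d\<close> and square
  roots \<open>p\<close>, \<open>q\<close>. The point \<open>z\<close> is the midpoint iff \<open>2 * s\<^sup>2 + 2 * d\<^sup>2 = p\<^sup>2 + q\<^sup>2\<close>.\<close>

definition defect :: "real \<Rightarrow> real \<Rightarrow> real \<Rightarrow> real \<Rightarrow> real \<Rightarrow> real" where
  "defect l d s p q = l * (2 * kern l s - exp (l * d) * kern l p - exp (- l * d) * kern l q)"

lemma defect_swap: "defect l d s p q = defect l (- d) s q p"
  by (simp add: defect_def)

text \<open>The candidate is affine along the tangents to the upper boundary of \<open>Omega \<delta>\<close>.\<close>

lemma defect_degenerate: "defect l d s (s - d) (s + d) = 0"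
proof -
  have "exp (l * d) * exp (l * (s - d)) = exp (l * s)" "exp (- l * d) * exp (l * (s + d)) = exp (l * s)"
    by (simp_all add: exp_add [symmetric] algebra_simps)
  then have "exp (l * d) * kern l (s - d) = (1 - l * (s - d)) * exp (l * s)"
    "exp (- l * d) * kern l (s + d) = (1 - l * (s + d)) * exp (l * s)"
    by (simp_all add: kern_def)
  then have "defect l d s (s - d) (s + d) =
      l * (2 * kern l s - (1 - l * (s - d)) * exp (l * s) - (1 - l * (s + d)) * exp (l * s))"
    unfolding defect_def by simp
  then show ?thesis by (simp add: kern_def algebra_simps)
qed

text \<open>Comparison with the degenerate configuration \<open>(s - d, s + d)\<close>, which obeys
  the same quadratic relation and has defect 0. The tangent bounds for \<open>kern\<close> at these
  two values acquire, after weighting by \<open>exp (l * d)\<close> and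
  \<open>exp (- l * d)\<close>, the same slope \<open>l * exp (l * s) / 2\<close>, so the linear
  terms cancel. The tangent bounds need nonnegative base points, hence
  \<open>\<bar>d\<bar> \<le> s\<close>.\<close>

lemma defect_nonneg_small:
  assumes l: "l = 1 \<or> l = -1" and d: "\<bar>d\<bar> \<le> s" and p: "0 \<le> p" and q: "0 \<le> q"
    and s: "2 * s\<^sup>2 + 2 * d\<^sup>2 = p\<^sup>2 + q\<^sup>2"
  shows "0 \<le> defect l d s p q"
proof -
  have e: "exp (l * d) * exp (l * (s - d)) = exp (l * s)" "exp (- l * d) * exp (l * (s + d)) = exp (l * s)"
    by (simp_all add: exp_add [symmetric] algebra_simps)
  have "exp (l * d) * (l * kern l p) \<le> exp (l * d) * (l * kern l (s - d) - l * exp (l * (s - d)) / 2 * (p\<^sup>2 - (s - d)\<^sup>2))"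
    using kern_tangent [OF l p, of "s - d"] d by simp
  also have "\<dots> = exp (l * d) * (l * kern l (s - d)) - l * (exp (l * d) * exp (l * (s - d))) / 2 * (p\<^sup>2 - (s - d)\<^sup>2)"
    by (simp add: algebra_simps)
  finally have 1: "exp (l * d) * (l * kern l p) \<le> exp (l * d) * (l * kern l (s - d)) - l * exp (l * s) / 2 * (p\<^sup>2 - (s - d)\<^sup>2)"
    unfolding e .
  have "exp (- l * d) * (l * kern l q) \<le> exp (- l * d) * (l * kern l (s + d) - l * exp (l * (s + d)) / 2 * (q\<^sup>2 - (s + d)\<^sup>2))"
    using kern_tangent [OF l q, of "s + d"] d by simp
  also have "\<dots> = exp (- l * d) * (l * kern l (s + d)) - l * (exp (- l * d) * exp (l * (s + d))) / 2 * (q\<^sup>2 - (s + d)\<^sup>2)"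
    by (simp add: algebra_simps)
  finally have 2: "exp (- l * d) * (l * kern l q) \<le> exp (- l * d) * (l * kern l (s + d)) - l * exp (l * s) / 2 * (q\<^sup>2 - (s + d)\<^sup>2)"
    unfolding e .
  have "p\<^sup>2 - (s - d)\<^sup>2 + (q\<^sup>2 - (s + d)\<^sup>2) = 0"
    using s by (simp add: power2_eq_square algebra_simps)
  then have 3: "l * exp (l * s) / 2 * (p\<^sup>2 - (s - d)\<^sup>2) + l * exp (l * s) / 2 * (q\<^sup>2 - (s + d)\<^sup>2) = 0"
    by (metis distrib_left mult_zero_right)
  have 4: "l * (2 * kern l s) = exp (l * d) * (l * kern l (s - d)) + exp (- l * d) * (l * kern l (s + d))"
    using defect_degenerate [of l d s] by (simp add: defect_def algebra_simps)
  show ?thesis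
    using 1 2 3 4 by (simp add: defect_def algebra_simps)
qed

text \<open>With \<open>s\<close> and \<open>q\<close> fixed, \<open>p\<close> is a function
  \<open>P\<close> of the distance \<open>u\<close>, and the derivative of the defect is
  \<open>exp (- l * u) * (kern l q - kern l (2 * u + P u))\<close>. For \<open>u \<ge> s\<close> it
  is nonnegative, since \<open>kern\<close> decreases and
  \<open>q \<le> 2 * u + P u\<close>.\<close>

lemma defect_lower_distance:
  assumes l: "l = 1 \<or> l = -1" and d: "s \<le> d'" "d' \<le> d" and s: "0 \<le> s" and q: "0 \<le> q"
    and p: "0 \<le> p" and p': "0 \<le> p'"
    and eq: "2 * s\<^sup>2 + 2 * d\<^sup>2 = p\<^sup>2 + q\<^sup>2" and eq': "2 * s\<^sup>2 + 2 * d'\<^sup>2 = p'\<^sup>2 + q\<^sup>2"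
  shows "defect l d' s p' q \<le> defect l d s p q"
proof -
  define P where "P u = sqrt (2 * s\<^sup>2 + 2 * u\<^sup>2 - q\<^sup>2)" for u
  have P: "P d = p" "P d' = p'" using eq eq' p p' by (auto simp: P_def intro!: real_sqrt_unique)
  have "defect l d' s (P d') q \<le> defect l d s (P d) q"
  \<comment> \<open>Only interior derivatives are required: at \<open>d'\<close> the square root
    \<open>P\<close> may vanish and fail to be differentiable.\<close>
  proof (rule DERIV_nonneg_imp_increasing_open [where f = "\<lambda>u. defect l u s (P u) q", OF \<open>d' \<le> d\<close>])
    show "continuous_on {d'..d} (\<lambda>u. defect l u s (P u) q)"
      unfolding defect_def P_def by (intro continuous_intros)
    fix u assume u: "d' < u" "u < d"
    have u0: "0 \<le> d'" "0 < u" using d s u by auto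
    have "d'\<^sup>2 < u\<^sup>2" using u u0 by (intro power_strict_mono) auto
    then have pos: "0 < 2 * s\<^sup>2 + 2 * u\<^sup>2 - q\<^sup>2" using eq' zero_le_power2 [of p'] by linarith
    then have Ppos: "0 < P u" "(P u)\<^sup>2 = 2 * s\<^sup>2 + 2 * u\<^sup>2 - q\<^sup>2" by (auto simp: P_def)
    have DP: "(P has_real_derivative (2 * u / P u)) (at u)"
      unfolding P_def using pos by (auto intro!: derivative_eq_intros simp: field_simps)
    have ll: "l * l = 1" using l by auto
    have "((\<lambda>u. defect l u s (P u) q) has_real_derivative
        l * (- (l * exp (l * u) * kern l (P u) + (- (P u) * exp (l * P u) * (2 * u / P u)) * exp (l * u))
           + l * exp (- l * u) * kern l q)) (at u)"
      unfolding defect_def by (auto intro!: derivative_eq_intros DP ll simp: algebra_simps)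
    moreover have "l * (- (l * exp (l * u) * kern l (P u) + (- (P u) * exp (l * P u) * (2 * u / P u)) * exp (l * u))
           + l * exp (- l * u) * kern l q) = exp (- l * u) * (kern l q - kern l (2 * u + P u))"
    proof -
      have "exp (- l * u) * kern l (2 * u + P u) = (1 - l * (2 * u + P u)) * (exp (l * u) * exp (l * P u))"
        by (simp add: kern_def exp_add [symmetric] algebra_simps)
      also have "\<dots> = exp (l * u) * kern l (P u) - l * (2 * u) * exp (l * P u) * exp (l * u)"
        by (simp add: kern_def algebra_simps)
      finally show ?thesis using Ppos(1) l by (auto simp: algebra_simps)
    qed
    moreover have "kern l (2 * u + P u) \<le> kern l q"
    proof (rule kern_decreasing [OF l q], rule power2_le_imp_le)
      have "s\<^sup>2 \<le> u\<^sup>2" using d s u by (intro power_mono) auto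
      moreover have "0 \<le> u * P u" using u0 Ppos by simp
      ultimately show "q\<^sup>2 \<le> (2 * u + P u)\<^sup>2"
        using Ppos(2) zero_le_power2 [of "P u"] zero_le_power2 [of u]
        by (simp add: power2_sum power_mult_distrib)
      show "0 \<le> 2 * u + P u" using u0 Ppos by simp
    qed
    ultimately show "\<exists>y. ((\<lambda>u. defect l u s (P u) q) has_real_derivative y) (at u) \<and> 0 \<le> y"
      by force
  qed
  then show ?thesis unfolding P .
qed

text \<open>Here the midpoint moves while \<open>d\<close> and \<open>p\<close> stay, and
  \<open>q\<close> adjusts. Since \<open>l * exp (l * x)\<close> increases, the sign depends only on
  whether \<open>q\<close> exceeds \<open>\<sigma> + d\<close>, that is, whether
  \<open>\<bar>\<sigma> - d\<bar>\<close> exceeds \<open>p\<close>.\<close>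

lemma defect_fixed_distance_derivative:
  assumes l: "l = 1 \<or> l = -1" and pos: "0 < 2 * \<sigma>\<^sup>2 + 2 * d\<^sup>2 - p\<^sup>2"
  shows "((\<lambda>\<sigma>. defect l d \<sigma> p (sqrt (2 * \<sigma>\<^sup>2 + 2 * d\<^sup>2 - p\<^sup>2))) has_real_derivative
      2 * \<sigma> * (l * exp (l * (sqrt (2 * \<sigma>\<^sup>2 + 2 * d\<^sup>2 - p\<^sup>2) - d)) - l * exp (l * \<sigma>))) (at \<sigma>)"
proof -
  define Q where "Q \<sigma> = sqrt (2 * \<sigma>\<^sup>2 + 2 * d\<^sup>2 - p\<^sup>2)" for \<sigma>
  have Qpos: "0 < Q \<sigma>" using pos by (simp add: Q_def)
  have DQ: "(Q has_real_derivative (2 * \<sigma> / Q \<sigma>)) (at \<sigma>)"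
    unfolding Q_def using pos by (auto intro!: derivative_eq_intros simp: field_simps)
  have ll: "l * l = 1" using l by auto
  have "((\<lambda>\<sigma>. defect l d \<sigma> p (Q \<sigma>)) has_real_derivative
      l * (2 * (- \<sigma> * exp (l * \<sigma>) * 1) - exp (- l * d) * (- (Q \<sigma>) * exp (l * Q \<sigma>) * (2 * \<sigma> / Q \<sigma>)))) (at \<sigma>)"
    unfolding defect_def by (auto intro!: derivative_eq_intros DQ ll simp: algebra_simps)
  moreover have "exp (l * (Q \<sigma> - d)) = exp (- l * d) * exp (l * Q \<sigma>)"
    by (simp add: exp_add [symmetric] algebra_simps)
  ultimately show ?thesis using Qpos unfolding Q_def [symmetric] by (simp add: algebra_simps)
qed

text \<open>As long as \<open>\<bar>\<sigma> - d\<bar> \<le> p\<close>, raising the midpoint root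
  lowers the defect. It can be raised to \<open>d + p\<close>, where \<open>q\<close> becomes
  \<open>2 * d + p\<close> and the configuration is a tangent one with defect 0.\<close>

lemma defect_nonneg_strip:
  assumes l: "l = 1 \<or> l = -1" and s: "0 \<le> p" "p \<le> s" and d: "s \<le> d" "d \<le> s + p"
    and q: "0 \<le> q" and eq: "2 * s\<^sup>2 + 2 * d\<^sup>2 = p\<^sup>2 + q\<^sup>2"
  shows "0 \<le> defect l d s p q"
proof -
  define Q where "Q \<sigma> = sqrt (2 * \<sigma>\<^sup>2 + 2 * d\<^sup>2 - p\<^sup>2)" for \<sigma>
  have Qs: "Q s = q" using eq q by (auto simp: Q_def intro!: real_sqrt_unique)
  have Qe: "Q (d + p) = d + p + d"
    unfolding Q_def using s d by (intro real_sqrt_unique) (auto simp: power2_eq_square algebra_simps)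
  have "defect l d (d + p) p (Q (d + p)) \<le> defect l d s p (Q s)"
  proof (rule DERIV_nonpos_imp_decreasing_open [where f = "\<lambda>\<sigma>. defect l d \<sigma> p (Q \<sigma>)"])
    show "s \<le> d + p" using s d by simp
    show "continuous_on {s..d + p} (\<lambda>\<sigma>. defect l d \<sigma> p (Q \<sigma>))"
      unfolding defect_def Q_def by (intro continuous_intros)
    fix \<sigma> assume u: "s < \<sigma>" "\<sigma> < d + p"
    have "p\<^sup>2 < \<sigma>\<^sup>2" using u s by (intro power_strict_mono) auto
    then have pos: "0 < 2 * \<sigma>\<^sup>2 + 2 * d\<^sup>2 - p\<^sup>2" using zero_le_power2 [of d] zero_le_power2 [of p] by linarith
    have "(\<sigma> - d)\<^sup>2 \<le> p\<^sup>2" using u d by (intro power2_le_iff_abs_le [THEN iffD2]) (auto simp: abs_if s)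
    then have "Q \<sigma> \<le> \<sigma> + d"
      unfolding Q_def using u s d by (intro real_le_lsqrt) (auto simp: power2_eq_square algebra_simps)
    then have "l * exp (l * (Q \<sigma> - d)) \<le> l * exp (l * \<sigma>)"
      by (intro sign_mult_exp_le l) auto
    then have "2 * \<sigma> * (l * exp (l * (Q \<sigma> - d)) - l * exp (l * \<sigma>)) \<le> 0"
      using u s by (intro mult_nonneg_nonpos) auto
    then show "\<exists>y. ((\<lambda>\<sigma>. defect l d \<sigma> p (Q \<sigma>)) has_real_derivative y) (at \<sigma>) \<and> y \<le> 0"
      using defect_fixed_distance_derivative [OF l pos] unfolding Q_def by blast
  qed
  moreover have "defect l d (d + p) p (d + p + d) = 0"
    using defect_degenerate [of l d "d + p"] by simp
  ultimately show ?thesis unfolding Qs Qe by simp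
qed

text \<open>In the complementary range \<open>d - \<sigma> \<ge> p\<close> the derivative has the
  opposite sign, so the midpoint root is lowered, down to \<open>p\<close>. This leaves the
  one-parameter family in which one end point and the midpoint have equal roots.\<close>

lemma defect_lower_midpoint:
  assumes l: "l = 1 \<or> l = -1" and s: "0 \<le> p" "p \<le> s" and d: "s + p \<le> d"
    and q: "0 \<le> q" and eq: "2 * s\<^sup>2 + 2 * d\<^sup>2 = p\<^sup>2 + q\<^sup>2"
  shows "defect l d p p (sqrt (p\<^sup>2 + 2 * d\<^sup>2)) \<le> defect l d s p q"
proof -
  define Q where "Q \<sigma> = sqrt (2 * \<sigma>\<^sup>2 + 2 * d\<^sup>2 - p\<^sup>2)" for \<sigma>
  have Qs: "Q s = q" using eq q by (auto simp: Q_def intro!: real_sqrt_unique)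
  have Qp: "Q p = sqrt (p\<^sup>2 + 2 * d\<^sup>2)" by (simp add: Q_def)
  have "defect l d p p (Q p) \<le> defect l d s p (Q s)"
  proof (rule DERIV_nonneg_imp_increasing_open [where f = "\<lambda>\<sigma>. defect l d \<sigma> p (Q \<sigma>)"])
    show "p \<le> s" by fact
    show "continuous_on {p..s} (\<lambda>\<sigma>. defect l d \<sigma> p (Q \<sigma>))"
      unfolding defect_def Q_def by (intro continuous_intros)
    fix \<sigma> assume u: "p < \<sigma>" "\<sigma> < s"
    have "p\<^sup>2 < \<sigma>\<^sup>2" using u s by (intro power_strict_mono) auto
    then have pos: "0 < 2 * \<sigma>\<^sup>2 + 2 * d\<^sup>2 - p\<^sup>2" using zero_le_power2 [of d] zero_le_power2 [of p] by linarith
    have "p\<^sup>2 \<le> (d - \<sigma>)\<^sup>2" using u d s by (intro power_mono) auto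
    then have "\<sigma> + d \<le> Q \<sigma>"
      unfolding Q_def by (intro real_le_rsqrt) (auto simp: power2_eq_square algebra_simps)
    then have "l * exp (l * \<sigma>) \<le> l * exp (l * (Q \<sigma> - d))"
      by (intro sign_mult_exp_le l) auto
    then have "0 \<le> 2 * \<sigma> * (l * exp (l * (Q \<sigma> - d)) - l * exp (l * \<sigma>))"
      using u s by (intro mult_nonneg_nonneg) auto
    then show "\<exists>y. ((\<lambda>\<sigma>. defect l d \<sigma> p (Q \<sigma>)) has_real_derivative y) (at \<sigma>) \<and> 0 \<le> y"
      using defect_fixed_distance_derivative [OF l pos] unfolding Q_def by blast
  qed
  then show ?thesis unfolding Qs Qp .
qed

text \<open>On the boundary edge the defect vanishes at both ends and is unimodal in between.\<close>

lemma defect_nonneg_edge: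
  assumes l: "l = 1 \<or> l = -1" and p: "0 \<le> p" and d: "0 \<le> d" "d \<le> c"
    and end0: "defect l c p p (sqrt (p\<^sup>2 + 2 * c\<^sup>2)) = 0"
  shows "0 \<le> defect l d p p (sqrt (p\<^sup>2 + 2 * d\<^sup>2))"
proof (rule ccontr)
  define Q where "Q u = sqrt (p\<^sup>2 + 2 * u\<^sup>2)" for u
  define \<psi> where "\<psi> u = defect l u p p (Q u)" for u
  assume "\<not> ?thesis"
  then have neg: "\<psi> d < 0" by (simp add: \<psi>_def Q_def)
  have \<psi>0: "\<psi> 0 = 0" "\<psi> c = 0" using p end0 by (auto simp: \<psi>_def Q_def defect_def)
  have dc: "0 < d" "d < c" using neg \<psi>0 d by (metis less_irrefl order_le_imp_less_or_eq)+
  have cont: "continuous_on A \<psi>" for A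
    unfolding \<psi>_def defect_def Q_def by (intro continuous_intros)
  have D: "(\<psi> has_real_derivative exp (l * u) * (kern l (Q u - 2 * u) - kern l p)) (at u)" if "0 < u" for u
  proof -
    have pos: "0 < p\<^sup>2 + 2 * u\<^sup>2" using that by (simp add: add_nonneg_pos)
    then have Qpos: "0 < Q u" by (simp add: Q_def)
    have DQ: "(Q has_real_derivative (2 * u / Q u)) (at u)"
      unfolding Q_def using pos by (auto intro!: derivative_eq_intros simp: field_simps)
    have ll: "l * l = 1" using l by auto
    have "(\<psi> has_real_derivative
      l * (- (l * exp (l * u) * kern l p)
          - (- l * exp (- l * u) * kern l (Q u) + exp (- l * u) * (- (Q u) * exp (l * Q u) * (2 * u / Q u))))) (at u)"
      unfolding defect_def \<psi>_def by (auto intro!: derivative_eq_intros DQ ll simp: algebra_simps)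
    moreover have "l * (- (l * exp (l * u) * kern l p)
          - (- l * exp (- l * u) * kern l (Q u) + exp (- l * u) * (- (Q u) * exp (l * Q u) * (2 * u / Q u))))
        = exp (l * u) * (kern l (Q u - 2 * u) - kern l p)"
    proof -
      have "exp (l * u) * kern l (Q u - 2 * u) = (1 - l * (Q u - 2 * u)) * (exp (- l * u) * exp (l * Q u))"
        by (simp add: kern_def exp_add [symmetric] algebra_simps)
      also have "\<dots> = exp (- l * u) * kern l (Q u) + l * exp (- l * u) * exp (l * Q u) * (2 * u)"
        by (simp add: kern_def algebra_simps)
      finally show ?thesis using Qpos l by (auto simp: algebra_simps)
    qed
    ultimately show ?thesis by simp
  qed
  \<comment> \<open>The argument \<open>Q u - 2 * u\<close> starts at \<open>p\<close> and
    decreases, while \<open>kern\<close> rises on negative and falls on positive arguments. Hence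
    the derivative of \<open>\<psi>\<close> is nonnegative first and, once negative, stays
    nonpositive.\<close>
  have w: "Q v - 2 * v \<le> Q u - 2 * u" if "0 \<le> u" "u \<le> v" for u v
  proof -
    have Qu: "u \<le> Q u" unfolding Q_def using that by (intro real_le_rsqrt) simp
    have "(v - u) * (v + u) \<le> (v - u) * (2 * Q u + 2 * (v - u))"
      using that Qu by (intro mult_left_mono) auto
    moreover have "(Q u)\<^sup>2 = p\<^sup>2 + 2 * u\<^sup>2" by (simp add: Q_def)
    ultimately have "p\<^sup>2 + 2 * v\<^sup>2 \<le> (Q u + 2 * (v - u))\<^sup>2"
      by (simp add: power2_eq_square algebra_simps)
    then have "Q v \<le> Q u + 2 * (v - u)"
      unfolding Q_def [of v] using that Qu by (intro real_le_lsqrt) auto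
    then show ?thesis by simp
  qed
  \<comment> \<open>A negative value at \<open>d\<close> forces a negative derivative before
    \<open>d\<close>; there the argument is already below 0, so \<open>\<psi>\<close> does not
    increase from \<open>d\<close> to \<open>c\<close>, against \<open>\<psi> c = 0\<close>.\<close>
  have "\<not> (\<forall>u. 0 < u \<and> u < d \<longrightarrow> kern l p \<le> kern l (Q u - 2 * u))"
  proof
    assume a: "\<forall>u. 0 < u \<and> u < d \<longrightarrow> kern l p \<le> kern l (Q u - 2 * u)"
    have "\<psi> 0 \<le> \<psi> d"
      using dc a D by (intro DERIV_nonneg_imp_increasing_open [OF _ _ cont]) (auto intro!: exI)
    then show False using neg \<psi>0 by simp
  qed
  then obtain u where u: "0 < u" "u < d" "kern l (Q u - 2 * u) < kern l p" by force
  have "Q u - 2 * u \<le> p" using w [of 0 u] u p by (simp add: Q_def)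
  then have w0: "Q u - 2 * u \<le> 0" using u(3) kern_decreasing [OF l, of "Q u - 2 * u" p] by force
  have "\<psi> c \<le> \<psi> d"
  proof (rule DERIV_nonpos_imp_decreasing_open [OF _ _ cont])
    show "d \<le> c" by fact
    fix v assume v: "d < v" "v < c"
    have "kern l (Q v - 2 * v) \<le> kern l (Q u - 2 * u)"
      using kern_increasing_neg [OF l w0] w [of u v] u v by simp
    then have "exp (l * v) * (kern l (Q v - 2 * v) - kern l p) \<le> 0"
      using u by (intro mult_nonneg_nonpos) auto
    then show "\<exists>y. (\<psi> has_real_derivative y) (at v) \<and> y \<le> 0" using D [of v] v dc by auto
  qed
  then show False using neg \<psi>0 by simp
qed

text \<open>The distance is lowered with \<open>s\<close> and \<open>q\<close> fixed, which also
  lowers \<open>p\<close>, until either \<open>d = s\<close> or \<open>p = s0\<close>. The first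
  case is covered by the small distances; in the second the end point has reached the upper boundary
  of \<open>Omega \<epsilon>\<close> and either the strip or the boundary edge applies.\<close>

lemma defect_nonneg_far:
  assumes l: "l = 1 \<or> l = -1" and s0: "0 \<le> s0" and c: "0 \<le> c" "\<delta>\<^sup>2 = s0\<^sup>2 + 2 * c\<^sup>2" "0 \<le> \<delta>"
    and eq0: "defect l c s0 s0 \<delta> = 0"
    and s: "s0 \<le> s" and p: "s0 \<le> p" and q: "0 \<le> q" "q \<le> \<delta>" and d: "s < d"
    and eq: "2 * s\<^sup>2 + 2 * d\<^sup>2 = p\<^sup>2 + q\<^sup>2"
  shows "0 \<le> defect l d s p q"
proof -
  \<comment> \<open>\<open>r\<close> is the square of the distance at which \<open>p\<close> becomes
    \<open>s0\<close>; comparing it with \<open>s\<^sup>2\<close> decides which of the two stopping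
    conditions comes first.\<close>
  define r where "r = (s0\<^sup>2 + q\<^sup>2) / 2 - s\<^sup>2"
  have s0': "0 \<le> s" "0 \<le> p" using s0 s p by auto
  have sp: "s0\<^sup>2 \<le> p\<^sup>2" using s0 p by (intro power_mono) auto
  show ?thesis
  proof (cases "r \<le> s\<^sup>2")
    case True
    define p' where "p' = sqrt (4 * s\<^sup>2 - q\<^sup>2)"
    have "s0\<^sup>2 \<le> 4 * s\<^sup>2 - q\<^sup>2" using True by (simp add: r_def field_simps)
    then have "0 \<le> 4 * s\<^sup>2 - q\<^sup>2" using zero_le_power2 [of s0] by linarith
    then have p': "0 \<le> p'" "p'\<^sup>2 = 4 * s\<^sup>2 - q\<^sup>2" by (auto simp: p'_def)
    have "0 \<le> defect l s s p' q"
      using l s0' p' q by (intro defect_nonneg_small) auto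
    also have "\<dots> \<le> defect l d s p q"
      using l s0' p' q eq d by (intro defect_lower_distance) auto
    finally show ?thesis .
  next
    case False
    define d' where "d' = sqrt r"
    have "0 \<le> r" using False zero_le_power2 [of s] by linarith
    then have d': "0 \<le> d'" "d'\<^sup>2 = r" by (auto simp: d'_def)
    have "s \<le> d'" by (rule power2_le_imp_le) (use False d' in auto)
    have "r \<le> d\<^sup>2" using sp eq by (simp add: r_def field_simps)
    have "d' \<le> d" by (rule power2_le_imp_le) (use d' \<open>r \<le> d\<^sup>2\<close> s0' d in auto)
    have eq': "2 * s\<^sup>2 + 2 * d'\<^sup>2 = s0\<^sup>2 + q\<^sup>2" by (simp add: d' r_def)
    have "0 \<le> defect l d' s s0 q"
    proof (cases "d' \<le> s + s0")
      case True
      then show ?thesis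
        using l s0 s \<open>s \<le> d'\<close> q eq' by (intro defect_nonneg_strip)
    next
      case False
      have "q\<^sup>2 \<le> \<delta>\<^sup>2" using q by (intro power_mono) auto
      moreover have "s0\<^sup>2 \<le> s\<^sup>2" using s0 s by (intro power_mono) auto
      \<comment> \<open>This is where the extreme splitting appears: \<open>q \<le> \<delta>\<close>
        and \<open>s0 \<le> s\<close> bound the distance by \<open>c\<close>, the far end of the
        edge, at which the defect is 0 by \<open>eq0\<close>.\<close>
      ultimately have "d'\<^sup>2 \<le> c\<^sup>2" using eq' c by auto
      then have "d' \<le> c" by (rule power2_le_imp_le) (use c in auto)
      moreover have "sqrt (s0\<^sup>2 + 2 * c\<^sup>2) = \<delta>" using c by (intro real_sqrt_unique) auto
      ultimately have "0 \<le> defect l d' s0 s0 (sqrt (s0\<^sup>2 + 2 * d'\<^sup>2))"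
        using l s0 d' eq0 by (intro defect_nonneg_edge [of l s0 d' c]) auto
      also have "\<dots> \<le> defect l d' s s0 q"
        using l s0 s False q eq' by (intro defect_lower_midpoint) auto
      finally show ?thesis .
    qed
    also have "\<dots> \<le> defect l d s p q"
      using l \<open>s \<le> d'\<close> \<open>d' \<le> d\<close> s0' s0 q eq eq' by (intro defect_lower_distance) auto
    finally show ?thesis .
  qed
qed

text \<open>In the application \<open>s0\<close> and \<delta> are the square roots on the upper and
  lower boundary of \<open>Omega \<epsilon>\<close>, so the bounds on \<open>s\<close>,
  \<open>p\<close>, \<open>q\<close> express membership there. Exchanging the end points settles
  negative distances.\<close>

lemma defect_nonneg:
  assumes l: "l = 1 \<or> l = -1" and s0: "0 \<le> s0" and c: "0 \<le> c" "\<delta>\<^sup>2 = s0\<^sup>2 + 2 * c\<^sup>2" "0 \<le> \<delta>"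
    and eq0: "defect l c s0 s0 \<delta> = 0"
    and s: "s0 \<le> s" and p: "s0 \<le> p" "p \<le> \<delta>" and q: "s0 \<le> q" "q \<le> \<delta>"
    and eq: "2 * s\<^sup>2 + 2 * d\<^sup>2 = p\<^sup>2 + q\<^sup>2"
  shows "0 \<le> defect l d s p q"
proof -
  consider "\<bar>d\<bar> \<le> s" | "s < d" | "s < - d" by linarith
  then show ?thesis
  proof cases
    case 1
    then show ?thesis using l s0 p q eq by (intro defect_nonneg_small) auto
  next
    case 2
    then show ?thesis
      using s0 p q by (intro defect_nonneg_far [OF l s0 c eq0 s]) (auto simp: eq)
  next
    case 3
    have "0 \<le> defect l (- d) s q p"
      using 3 s0 p q by (intro defect_nonneg_far [OF l s0 c eq0 s]) (auto simp: eq)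
    then show ?thesis using defect_swap [of l d s p q] by simp
  qed
qed

section \<open>The equations for the parameter\<close>

definition balance :: "real \<Rightarrow> real \<Rightarrow> real \<Rightarrow> real" where
  "balance l \<epsilon> \<delta> = kern l (sqrt (\<delta>\<^sup>2 - \<epsilon>\<^sup>2)) * (2 - exp (l * (\<epsilon> / sqrt 2)))
     - kern l \<delta> * exp (- l * (\<epsilon> / sqrt 2))"

lemma delta_plus_eq_iff: "delta_plus_eq \<epsilon> \<delta> \<longleftrightarrow> balance 1 \<epsilon> \<delta> = 0"
proof -
  have "exp (\<delta> - \<epsilon> / sqrt 2) = exp \<delta> * exp (- (\<epsilon> / sqrt 2))"
    by (simp add: exp_add [symmetric])
  then show ?thesis
    by (simp add: delta_plus_eq_def balance_def kern_def mult.assoc)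
qed

lemma delta_minus_eq_iff: "delta_minus_eq \<epsilon> \<delta> \<longleftrightarrow> balance (-1) \<epsilon> \<delta> = 0"
proof -
  have "exp (- \<delta> + \<epsilon> / sqrt 2) = exp (- \<delta>) * exp (\<epsilon> / sqrt 2)"
    by (simp add: exp_add [symmetric])
  then show ?thesis
    by (simp add: delta_minus_eq_def balance_def kern_def mult.assoc)
qed

text \<open>The parameter equation is thus precisely the vanishing at the end of the edge that
  \<open>defect_nonneg\<close> requires.\<close>

lemma defect_balance:
  "defect l (\<epsilon> / sqrt 2) (sqrt (\<delta>\<^sup>2 - \<epsilon>\<^sup>2)) (sqrt (\<delta>\<^sup>2 - \<epsilon>\<^sup>2)) \<delta> = l * balance l \<epsilon> \<delta>"
  by (simp add: defect_def balance_def algebra_simps)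

text \<open>Strictness comes from squaring the weak inequality at \<open>y / 2\<close>, which leaves
  the surplus \<open>(y / 2)\<^sup>2\<close>.\<close>

lemma exp_gt_add_one:
  fixes y :: real
  assumes "y \<noteq> 0"
  shows "1 + y < exp y"
proof -
  have "1 + y / 2 \<le> exp (y / 2)" by (rule exp_ge_add_one_self)
  show ?thesis
  proof (cases "0 \<le> 1 + y / 2")
    case True
    then have "(1 + y / 2)\<^sup>2 \<le> (exp (y / 2))\<^sup>2"
      using exp_ge_add_one_self [of "y / 2"] by (intro power_mono) auto
    moreover have "(exp (y / 2))\<^sup>2 = exp y" by (simp flip: exp_double)
    moreover have "(1 + y / 2)\<^sup>2 = 1 + y + (y / 2)\<^sup>2" by (simp add: power2_eq_square algebra_simps)
    moreover have "0 < (y / 2)\<^sup>2" using assms by simp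
    ultimately show ?thesis by linarith
  next
    case False
    then have "1 + y < 0" by simp
    then show ?thesis using exp_gt_zero [of y] by linarith
  qed
qed

text \<open>\<open>balance l \<epsilon> \<epsilon> = exp (l * c) * gap (- l * c)\<close> where \<open>c = \<epsilon> / sqrt 2\<close>.\<close>

definition gap :: "real \<Rightarrow> real" where
  "gap c = 2 * exp c - 1 - (1 + sqrt 2 * c) * exp ((2 - sqrt 2) * c)"

text \<open>The derivative factors as \<open>2 * exp ((2 - sqrt 2) * c) * (exp x - (1 + x))\<close>
  with \<open>x = (sqrt 2 - 1) * c\<close>, so it vanishes only at 0.\<close>

lemma gap_strict_mono:
  assumes "a < b" "0 \<notin> {a<..<b}"
  shows "gap a < gap b"
proof (rule DERIV_pos_imp_increasing_open [OF \<open>a < b\<close>])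
  show "continuous_on {a..b} gap"
    unfolding gap_def by (intro continuous_intros)
  fix c assume c: "a < c" "c < b"
  then have "c \<noteq> 0" using assms by auto
  have "(gap has_real_derivative
      2 * exp c - (sqrt 2 * exp ((2 - sqrt 2) * c) + (2 - sqrt 2) * exp ((2 - sqrt 2) * c) * (1 + sqrt 2 * c))) (at c)"
    unfolding gap_def by (auto intro!: derivative_eq_intros simp: algebra_simps)
  moreover have "exp c = exp ((2 - sqrt 2) * c) * exp ((sqrt 2 - 1) * c)"
    by (simp add: exp_add [symmetric] algebra_simps)
  moreover have "(2 - sqrt 2) * (1 + sqrt 2 * c) = 2 - sqrt 2 + 2 * ((sqrt 2 - 1) * c)"
    by (simp add: algebra_simps)
  moreover have "sqrt 2 * (sqrt 2 * y) = 2 * y" for y :: real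
    by (simp flip: mult.assoc)
  ultimately have "(gap has_real_derivative
      2 * exp ((2 - sqrt 2) * c) * (exp ((sqrt 2 - 1) * c) - (1 + (sqrt 2 - 1) * c))) (at c)"
    by (simp add: algebra_simps)
  moreover have "1 + (sqrt 2 - 1) * c < exp ((sqrt 2 - 1) * c)"
    using \<open>c \<noteq> 0\<close> by (intro exp_gt_add_one) auto
  then have "0 < 2 * exp ((2 - sqrt 2) * c) * (exp ((sqrt 2 - 1) * c) - (1 + (sqrt 2 - 1) * c))"
    by simp
  ultimately show "\<exists>y. (gap has_real_derivative y) (at c) \<and> 0 < y"
    by blast
qed

text \<open>The sign at the left end \<open>\<delta> = \<epsilon>\<close> of the range, where the
  square root vanishes; one half of each intermediate value argument.\<close>

lemma balance_at_radius:
  assumes l: "l = 1 \<or> l = -1" and "0 < \<epsilon>"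
  shows "l * balance l \<epsilon> \<epsilon> < 0"
proof -
  define c where "c = \<epsilon> / sqrt 2"
  have c: "0 < c" "\<epsilon> = sqrt 2 * c" using assms by (auto simp: c_def)
  have [simp]: "\<epsilon> / sqrt 2 = c" by (simp add: c_def)
  have e: "exp (l * c) * exp (- l * c) = 1" "exp (l * c) * exp ((2 - sqrt 2) * (- l * c)) = exp (l * \<epsilon>) * exp (- l * c)"
    by (simp_all add: exp_add [symmetric] c algebra_simps)
  have "exp (l * c) * gap (- l * c) = 2 * (exp (l * c) * exp (- l * c)) - exp (l * c)
      - (1 - l * \<epsilon>) * (exp (l * c) * exp ((2 - sqrt 2) * (- l * c)))"
    by (simp add: gap_def c algebra_simps)
  also have "\<dots> = balance l \<epsilon> \<epsilon>"
    unfolding e by (simp add: balance_def kern_def algebra_simps)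
  finally have "balance l \<epsilon> \<epsilon> = exp (l * c) * gap (- l * c)" ..
  moreover have "gap 0 = 0" by (simp add: gap_def)
  ultimately show ?thesis
    using l gap_strict_mono [of 0 c] gap_strict_mono [of "- c" 0] c by (auto simp: mult_pos_neg)
qed

lemma continuous_on_balance: "continuous_on A (balance l \<epsilon>)"
  unfolding balance_def by (intro continuous_intros)

lemma kern_pos: "l * t < 1 \<Longrightarrow> 0 < kern l t"
  by (simp add: kern_def)

text \<open>Taking logarithms separates the variables: the equation says that \<open>f\<close> has a
  value independent of \<delta>. With \<open>r = sqrt (t\<^sup>2 - \<epsilon>\<^sup>2)\<close>, the
  derivative of \<open>f\<close> is \<open>t * (r - t) / ((1 - l * t) * (1 - l * r))\<close>, which
  is negative because \<open>r < t\<close>.\<close>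

lemma balance_unique:
  assumes l: "l = 1 \<or> l = -1" and "0 < \<epsilon>" and \<delta>: "\<epsilon> \<le> x" "x < y" and y: "l * y < 1"
    and bal: "balance l \<epsilon> x = 0" "balance l \<epsilon> y = 0"
  shows False
proof -
  define f where "f \<delta> = l * (ln (kern l \<delta>) - ln (kern l (sqrt (\<delta>\<^sup>2 - \<epsilon>\<^sup>2))))" for \<delta>
  have ll: "l * l = 1" using l by auto
  have s: "0 \<le> sqrt (t\<^sup>2 - \<epsilon>\<^sup>2)" "sqrt (t\<^sup>2 - \<epsilon>\<^sup>2) < t" "l * t < 1" "l * sqrt (t\<^sup>2 - \<epsilon>\<^sup>2) < 1"
    if "x \<le> t" "t \<le> y" for t
  proof -
    have t: "0 < \<epsilon>" "\<epsilon> \<le> t" using assms that by auto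
    then show "0 \<le> sqrt (t\<^sup>2 - \<epsilon>\<^sup>2)" by (auto intro!: power_mono)
    show "sqrt (t\<^sup>2 - \<epsilon>\<^sup>2) < t" using t by (intro real_less_lsqrt) auto
    then have "0 \<le> sqrt (t\<^sup>2 - \<epsilon>\<^sup>2) \<and> sqrt (t\<^sup>2 - \<epsilon>\<^sup>2) < t"
      using \<open>0 \<le> sqrt (t\<^sup>2 - \<epsilon>\<^sup>2)\<close> by blast
    then show "l * t < 1" "l * sqrt (t\<^sup>2 - \<epsilon>\<^sup>2) < 1"
      using l y that by (auto simp del: real_sqrt_ge_0_iff real_sqrt_lt_1_iff)
  qed
  have "f y < f x"
  proof (rule DERIV_neg_imp_decreasing_open [OF \<open>x < y\<close>])
    show "continuous_on {x..y} f"
      unfolding f_def using s by (intro continuous_intros) (auto dest!: kern_pos simp: less_imp_neq [symmetric] kern_def)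
    fix t assume t: "x < t" "t < y"
    define r where "r = sqrt (t\<^sup>2 - \<epsilon>\<^sup>2)"
    have st: "0 \<le> r" "r < t" "l * t < 1" "l * r < 1"
      using s [of t] t by (auto simp: r_def)
    have "\<epsilon>\<^sup>2 < t\<^sup>2" using t \<delta> \<open>0 < \<epsilon>\<close> by (intro power_strict_mono) auto
    then have pos: "0 < t\<^sup>2 - \<epsilon>\<^sup>2" by simp
    then have r: "0 < r" by (simp add: r_def)
    have DR: "((\<lambda>t. sqrt (t\<^sup>2 - \<epsilon>\<^sup>2)) has_real_derivative (t / r)) (at t)"
      unfolding r_def using pos by (auto intro!: derivative_eq_intros simp: field_simps)
    have k: "0 < kern l t" "0 < kern l r" using st by (auto intro: kern_pos)
    have "((\<lambda>t. ln (kern l t)) has_real_derivative (inverse (kern l t) * (- t * exp (l * t) * 1))) (at t)"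
      using k by (intro DERIV_chain2 [OF DERIV_ln] kern_has_derivative ll DERIV_ident)
    moreover have "((\<lambda>t. ln (kern l (sqrt (t\<^sup>2 - \<epsilon>\<^sup>2)))) has_real_derivative (inverse (kern l r) * (- r * exp (l * r) * (t / r)))) (at t)"
      using k unfolding r_def by (intro DERIV_chain2 [OF DERIV_ln] kern_has_derivative ll DR [unfolded r_def]) 
    ultimately have "(f has_real_derivative l * (inverse (kern l t) * (- t * exp (l * t) * 1) - inverse (kern l r) * (- r * exp (l * r) * (t / r)))) (at t)"
      unfolding f_def by (intro DERIV_cmult DERIV_diff)
    moreover have "inverse (kern l t) * (- t * exp (l * t) * 1) = - t / (1 - l * t)"
      using st by (simp add: kern_def divide_simps)
    moreover have "inverse (kern l r) * (- r * exp (l * r) * (t / r)) = - t / (1 - l * r)"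
      using r st by (simp add: kern_def divide_simps)
    moreover have "l * (- t / (1 - l * t) - - t / (1 - l * r)) = t * (r - t) * (l * l) / ((1 - l * t) * (1 - l * r))"
      using st by (simp add: field_simps)
    moreover have "\<dots> < 0"
      using st r ll by (intro divide_neg_pos mult_pos_pos) (auto simp: mult_pos_neg)
    ultimately show "\<exists>z. (f has_real_derivative z) (at t) \<and> z < 0" by metis
  qed
  moreover have "f t = l * ln ((2 - exp (l * (\<epsilon> / sqrt 2))) * exp (l * (\<epsilon> / sqrt 2)))"
    if "x \<le> t" "t \<le> y" "balance l \<epsilon> t = 0" for t
  proof -
    let ?r = "sqrt (t\<^sup>2 - \<epsilon>\<^sup>2)"
    have k: "0 < kern l t" "0 < kern l ?r" using s that by (auto intro: kern_pos)
    have "kern l ?r * (2 - exp (l * (\<epsilon> / sqrt 2))) = kern l t * exp (- l * (\<epsilon> / sqrt 2))"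
      using that by (simp add: balance_def)
    then have "kern l t / kern l ?r = (2 - exp (l * (\<epsilon> / sqrt 2))) * exp (l * (\<epsilon> / sqrt 2))"
      using k by (simp add: field_simps exp_minus)
    moreover have "ln (kern l t / kern l ?r) = ln (kern l t) - ln (kern l ?r)"
      using k by (intro ln_divide_pos)
    ultimately show ?thesis by (simp add: f_def)
  qed
  ultimately show False using bal \<delta> by force
qed

text \<open>With \<open>k = (2 - exp c) * exp c\<close> in \<open>(0, 1)\<close> the equation reads
  \<open>kern 1 r * k = kern 1 \<delta>\<close>. If \<open>\<delta> \<ge> 1\<close>, the right side
  is nonpositive, so \<open>r \<ge> 1\<close>; but beyond 1 \<open>kern 1\<close> is nonpositive and
  strictly decreasing, so \<open>kern 1 \<delta> < kern 1 r \<le> kern 1 r * k\<close>.\<close>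

lemma plus_root_less_one:
  assumes \<epsilon>: "0 < \<epsilon>" "\<epsilon> < sqrt 2 * ln 2" and \<delta>: "\<epsilon> \<le> \<delta>" and bal: "balance 1 \<epsilon> \<delta> = 0"
  shows "\<delta> < 1"
proof (rule ccontr)
  define c where "c = \<epsilon> / sqrt 2"
  define r where "r = sqrt (\<delta>\<^sup>2 - \<epsilon>\<^sup>2)"
  assume "\<not> \<delta> < 1"
  have c: "0 < c" "c < ln 2" using \<epsilon> by (auto simp: c_def field_simps)
  have e: "1 < exp c" "exp c < 2"
    using c exp_less_mono [of c "ln 2"] by auto
  have r: "0 \<le> r" "r < \<delta>" using \<epsilon> \<delta> by (auto simp: r_def intro!: power_mono real_less_lsqrt)
  have eq: "kern 1 r * ((2 - exp c) * exp c) = kern 1 \<delta>"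
    using bal by (simp add: balance_def r_def [symmetric] c_def [symmetric] exp_minus field_simps)
  have p: "0 < (2 - exp c) * exp c" using e by simp
  have "0 < (exp c - 1)\<^sup>2" using e by simp
  then have q: "(2 - exp c) * exp c < 1" by (simp add: power2_eq_square algebra_simps)
  have k: "kern 1 \<delta> \<le> 0" using \<open>\<not> \<delta> < 1\<close> by (simp add: kern_def mult_nonpos_nonneg)
  show False
  proof (cases "r < 1")
    case True
    then have "0 < kern 1 r" by (simp add: kern_pos)
    then show False using eq p k by (metis mult_pos_pos not_less)
  next
    case False
    have "kern 1 \<delta> < kern 1 r"
    proof -
      have "(\<delta> - 1) * exp \<delta> > (r - 1) * exp r"
        using False r by (intro mult_less_le_imp_less) auto
      then show ?thesis by (simp add: kern_def algebra_simps)
    qed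
    moreover have "kern 1 r \<le> 0" using False by (simp add: kern_def mult_nonpos_nonneg)
    then have "kern 1 r * 1 \<le> kern 1 r * ((2 - exp c) * exp c)"
      using q by (intro mult_left_mono_neg) auto
    ultimately show False using eq by simp
  qed
qed

lemma plus_root_exists:
  assumes \<epsilon>: "0 < \<epsilon>" "\<epsilon> < sqrt 2 * ln 2"
  shows "\<exists>\<delta>. \<epsilon> \<le> \<delta> \<and> \<delta> < 1 \<and> balance 1 \<epsilon> \<delta> = 0"
proof -
  define c where "c = \<epsilon> / sqrt 2"
  have c: "0 < c" "c < ln 2" using \<epsilon> by (auto simp: c_def field_simps)
  have e: "exp c < 2"
    using c exp_less_mono [of c "ln 2"] by auto
  \<comment> \<open>The numerical bound on \<open>ln 2\<close> serves to show that
    \<open>[\<epsilon>, 1]\<close> is a genuine interval.\<close>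
  have "\<epsilon>\<^sup>2 < (sqrt 2 * ln 2)\<^sup>2" using \<epsilon> by (intro power_strict_mono) auto
  also have "(sqrt 2 * ln 2)\<^sup>2 \<le> 2 * (25 / 36 :: real)\<^sup>2"
    using ln2_le_25_over_36 by (simp add: power_mult_distrib)
  also have "\<dots> < 1\<^sup>2" by (simp add: power2_eq_square)
  finally have e2: "\<epsilon>\<^sup>2 < 1\<^sup>2" .
  then have \<epsilon>1: "\<epsilon> < 1" by (rule power_less_imp_less_base) simp
  have "balance 1 \<epsilon> \<epsilon> \<le> 0" using balance_at_radius [of 1 \<epsilon>] \<epsilon> by simp
  \<comment> \<open>At \<open>\<delta> = 1\<close> the factor \<open>1 - \<delta>\<close> removes
    the subtracted term.\<close>
  moreover have "0 \<le> balance 1 \<epsilon> 1"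
    using e e2 \<epsilon> by (simp add: balance_def kern_def c_def [symmetric])
  ultimately obtain \<delta> where \<delta>: "\<epsilon> \<le> \<delta>" "\<delta> \<le> 1" "balance 1 \<epsilon> \<delta> = 0"
    using IVT' [of "balance 1 \<epsilon>" \<epsilon> 0 1] \<epsilon>1 continuous_on_balance by force
  then show ?thesis using plus_root_less_one [OF \<epsilon>] by blast
qed

lemma minus_root_exists:
  assumes \<epsilon>: "0 < \<epsilon>"
  shows "\<exists>\<delta>. \<epsilon> \<le> \<delta> \<and> balance (-1) \<epsilon> \<delta> = 0"
proof -
  define c where "c = \<epsilon> / sqrt 2"
  \<comment> \<open>Multiplied by \<open>exp (- c)\<close>, the equation becomes
    \<open>kern (-1) r * k = kern (-1) \<delta>\<close>.\<close>
  define k where "k = (2 - exp (- c)) * exp (- c)"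
  have c: "0 < c" using \<epsilon> by (simp add: c_def)
  have e: "0 < exp (- c)" "exp (- c) < 1" using c by auto
  have k0: "0 < k" using e unfolding k_def by (intro mult_pos_pos) linarith+
  have "0 < (exp (- c) - 1)\<^sup>2" using e by simp
  then have k1: "k < 1" by (simp add: k_def power2_eq_square algebra_simps)
  \<comment> \<open>Chosen so that \<open>\<epsilon>\<^sup>2 = (\<delta>1 - \<epsilon>) * (- ln k)
    \<le> \<delta>1 * (- ln k)\<close>. Since
    \<open>(\<delta>1 - r) * (\<delta>1 + r) = \<epsilon>\<^sup>2\<close>, this gives
    \<open>\<delta>1 - r \<le> - ln k\<close>, that is, \<open>k \<le> exp (r - \<delta>1)\<close>,
    and the balance is nonpositive at \<open>\<delta>1\<close>.\<close>
  define \<delta>1 where "\<delta>1 = \<epsilon> + \<epsilon>\<^sup>2 / (- ln k)"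
  have lnk: "ln k < 0" using k0 k1 by simp
  have d1: "\<epsilon> \<le> \<delta>1" using lnk \<epsilon> by (simp add: \<delta>1_def divide_nonneg_neg)
  define r where "r = sqrt (\<delta>1\<^sup>2 - \<epsilon>\<^sup>2)"
  have r: "0 \<le> r" "r \<le> \<delta>1" "r\<^sup>2 = \<delta>1\<^sup>2 - \<epsilon>\<^sup>2"
    using \<epsilon> d1 by (auto simp: r_def intro!: power_mono real_le_lsqrt)
  have "(\<delta>1 - r) * \<delta>1 \<le> (\<delta>1 - r) * (\<delta>1 + r)" using r by (intro mult_left_mono) auto
  also have "\<dots> = \<epsilon>\<^sup>2" using r(3) by (simp add: power2_eq_square algebra_simps)
  also have "\<epsilon>\<^sup>2 = (\<delta>1 - \<epsilon>) * (- ln k)" using lnk by (simp add: \<delta>1_def)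
  also have "\<dots> \<le> (- ln k) * \<delta>1" using lnk \<epsilon> d1 by (simp add: algebra_simps mult_nonneg_nonpos)
  finally have "\<delta>1 - r \<le> - ln k" using \<epsilon> d1 by (intro mult_right_le_imp_le [of "\<delta>1 - r" \<delta>1]) auto
  then have "exp (ln k) \<le> exp (r - \<delta>1)" by simp
  then have kk: "k \<le> exp (r - \<delta>1)" using k0 by simp
  have "kern (-1) r * k \<le> (1 + r) * exp (- r) * exp (r - \<delta>1)"
    using kk r by (simp add: kern_def)
  also have "\<dots> = (1 + r) * exp (- \<delta>1)" by (simp add: exp_add [symmetric] mult.assoc)
  also have "\<dots> \<le> kern (-1) \<delta>1" using r by (simp add: kern_def)
  finally have "kern (-1) r * k * exp c \<le> kern (-1) \<delta>1 * exp c" by simp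
  moreover have "k * exp c = 2 - exp (- c)" by (simp add: k_def mult.assoc exp_add [symmetric])
  ultimately have "balance (-1) \<epsilon> \<delta>1 \<le> 0"
    by (simp add: balance_def r_def [symmetric] c_def [symmetric] mult.assoc)
  moreover have "0 \<le> balance (-1) \<epsilon> \<epsilon>" using balance_at_radius [of "-1" \<epsilon>] \<epsilon> by simp
  ultimately show ?thesis
    using IVT2' [of "balance (-1) \<epsilon>" \<delta>1 0 \<epsilon>] d1 continuous_on_balance by force
qed

section \<open>Superadditive functions on the dyadic lattice\<close>

lemma set_integrable_subinterval:
  fixes f :: "real \<Rightarrow> real"
  assumes "set_integrable lebesgue {a..b} f" "a \<le> c" "d \<le> b"
  shows "set_integrable lebesgue {c..d} f"
  using assms by (intro set_integrable_subset [OF assms(1)]) auto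

lemma avg_eq_integral:
  assumes "set_integrable lebesgue {c..d} f" "c \<le> d"
  shows "avg {c..d} f = integral {c..d} f / (d - c)"
  using assms by (simp add: avg_def set_lebesgue_integral_eq_integral(2))

lemma avg_halves:
  assumes "set_integrable lebesgue {a..b} f" "a < b"
  shows "avg {a..b} f = (avg {a..(a + b) / 2} f + avg {(a + b) / 2..b} f) / 2"
proof -
  have "set_integrable lebesgue {a..(a + b) / 2} f" "set_integrable lebesgue {(a + b) / 2..b} f"
    using assms by (auto intro: set_integrable_subinterval)
  moreover have "integral {a..b} f = integral {a..(a + b) / 2} f + integral {(a + b) / 2..b} f"
    using assms set_lebesgue_integral_eq_integral(1) [OF assms(1)]
    by (intro Henstock_Kurzweil_Integration.integral_combine [symmetric]) auto
  moreover have "(a + b) / 2 - a = (b - a) / 2" "b - (a + b) / 2 = (b - a) / 2" by (auto simp: field_simps)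
  ultimately show ?thesis using assms by (simp add: avg_eq_integral add_divide_distrib)
qed

text \<open>The estimate is multiplied by \<open>h\<close> so that it includes \<open>h = 0\<close>,
  the case in which \<open>t\<close> is an end point of the interval considered later.\<close>

lemma right_average_tendsto:
  fixes f :: "real \<Rightarrow> real"
  assumes "\<And>a b. f integrable_on {a..b}"
  obtains N where "negligible N"
    "\<And>t e. \<lbrakk>t \<notin> N; 0 < e\<rbrakk> \<Longrightarrow> \<exists>r>0. \<forall>h. 0 \<le> h \<and> h < r \<longrightarrow> \<bar>integral {t..t + h} f - h * f t\<bar> \<le> e * h"
proof -
  obtain N where N: "negligible N"
    "\<And>t e. \<lbrakk>t \<notin> N; 0 < e\<rbrakk> \<Longrightarrow> \<exists>d>0. \<forall>h. 0 < h \<and> h < d \<longrightarrow>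
       norm (integral (cbox t (t + h *\<^sub>R One)) f /\<^sub>R h ^ DIM(real) - f t) < e"
    using integrable_ccontinuous_explicit [of f] assms by auto
  show thesis
  proof
    fix t e :: real assume t: "t \<notin> N" "0 < e"
    obtain r where r: "0 < r"
      "\<And>h. 0 < h \<Longrightarrow> h < r \<Longrightarrow> norm (integral (cbox t (t + h *\<^sub>R One)) f /\<^sub>R h ^ DIM(real) - f t) < e"
      using N(2) [OF t] by blast
    have "\<bar>integral {t..t + h} f - h * f t\<bar> \<le> e * h" if h: "0 \<le> h" "h < r" for h
    proof (cases "h = 0")
      case False
      then have "0 < h" using h by simp
      have "\<bar>integral {t..t + h} f / h - f t\<bar> < e"
        using r(2) [OF \<open>0 < h\<close> h(2)] by (simp add: divide_inverse mult.commute)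
      then have "h * \<bar>integral {t..t + h} f / h - f t\<bar> \<le> h * e"
        using \<open>0 < h\<close> by simp
      moreover have "h * \<bar>integral {t..t + h} f / h - f t\<bar> = \<bar>h * (integral {t..t + h} f / h - f t)\<bar>"
        using \<open>0 < h\<close> by (simp add: abs_mult)
      moreover have "h * (integral {t..t + h} f / h - f t) = integral {t..t + h} f - h * f t"
        using \<open>0 < h\<close> by (simp add: field_simps)
      ultimately show ?thesis by (simp add: mult.commute)
    qed auto
    then show "\<exists>r>0. \<forall>h. 0 \<le> h \<and> h < r \<longrightarrow> \<bar>integral {t..t + h} f - h * f t\<bar> \<le> e * h"
      using r(1) by blast
  qed (rule N(1))
qed

text \<open>The reflected function \<open>f (- t)\<close> supplies the left averages, and its
  exceptional set is reflected back. The two one-sided errors \<open>e * (t - c)\<close> and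
  \<open>e * (d - t)\<close> add up to \<open>e * (d - c)\<close>.\<close>

lemma two_sided_average_tendsto:
  fixes f :: "real \<Rightarrow> real"
  assumes int: "\<And>a b. f integrable_on {a..b}"
  obtains N where "negligible N"
    "\<And>t e. \<lbrakk>t \<notin> N; 0 < e\<rbrakk> \<Longrightarrow> \<exists>r>0. \<forall>c d. c \<le> t \<and> t \<le> d \<and> c < d \<and> d - c < r \<longrightarrow>
       \<bar>integral {c..d} f / (d - c) - f t\<bar> \<le> e"
proof -
  obtain N1 where N1: "negligible N1"
    "\<And>t e. \<lbrakk>t \<notin> N1; 0 < e\<rbrakk> \<Longrightarrow> \<exists>r>0. \<forall>h. 0 \<le> h \<and> h < r \<longrightarrow> \<bar>integral {t..t + h} f - h * f t\<bar> \<le> e * h"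
    using right_average_tendsto [OF int] by blast
  have int': "(\<lambda>t. f (- t)) integrable_on {a..b}" for a b
    using int [of "- b" "- a"] Henstock_Kurzweil_Integration.integrable_reflect_real [where f = f and a = "- b" and b = "- a"]
    by simp
  obtain N2 where N2: "negligible N2"
    "\<And>t e. \<lbrakk>t \<notin> N2; 0 < e\<rbrakk> \<Longrightarrow> \<exists>r>0. \<forall>h. 0 \<le> h \<and> h < r \<longrightarrow>
       \<bar>integral {t..t + h} (\<lambda>t. f (- t)) - h * f (- t)\<bar> \<le> e * h"
    using right_average_tendsto [OF int'] by blast
  have N2': "negligible (uminus ` N2)"
    using N2(1)
    by (intro negligible_differentiable_image_negligible)
       (auto intro!: derivative_intros differentiable_on_minus differentiable_on_ident)
  show thesis
  proof
    show "negligible (N1 \<union> uminus ` N2)" using N1(1) N2' by (rule negligible_Un)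
    fix t e :: real assume t: "t \<notin> N1 \<union> uminus ` N2" "0 < e"
    then have "t \<notin> N1" "- t \<notin> N2" by (auto simp: image_iff)
    obtain r1 where r1: "r1 > 0" "\<And>h. 0 \<le> h \<Longrightarrow> h < r1 \<Longrightarrow> \<bar>integral {t..t + h} f - h * f t\<bar> \<le> e * h"
      using N1(2) [OF \<open>t \<notin> N1\<close> \<open>0 < e\<close>] by blast
    obtain r2 where r2: "r2 > 0" "\<And>h. 0 \<le> h \<Longrightarrow> h < r2 \<Longrightarrow>
        \<bar>integral {- t..- t + h} (\<lambda>t. f (- t)) - h * f t\<bar> \<le> e * h"
      using N2(2) [OF \<open>- t \<notin> N2\<close> \<open>0 < e\<close>] by auto
    have "\<bar>integral {c..d} f / (d - c) - f t\<bar> \<le> e"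
      if cd: "c \<le> t" "t \<le> d" "c < d" "d - c < min r1 r2" for c d
    proof -
      have "\<bar>integral {t..d} f - (d - t) * f t\<bar> \<le> e * (d - t)"
        using r1(2) [of "d - t"] cd by simp
      moreover have "integral {- t..- c} (\<lambda>t. f (- t)) = integral {c..t} f"
        by (rule Henstock_Kurzweil_Integration.integral_reflect_real)
      then have "\<bar>integral {c..t} f - (t - c) * f t\<bar> \<le> e * (t - c)"
        using r2(2) [of "t - c"] cd by simp
      moreover have "integral {c..d} f = integral {c..t} f + integral {t..d} f"
        using cd int by (intro Henstock_Kurzweil_Integration.integral_combine [symmetric]) auto
      ultimately have "\<bar>integral {c..d} f - (d - c) * f t\<bar> \<le> e * (d - c)"
        by (simp add: algebra_simps)
      then have "\<bar>(integral {c..d} f - (d - c) * f t) / (d - c)\<bar> \<le> e"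
        using cd by (simp add: abs_divide divide_le_eq)
      then show ?thesis using cd by (simp add: diff_divide_distrib)
    qed
    then show "\<exists>r>0. \<forall>c d. c \<le> t \<and> t \<le> d \<and> c < d \<and> d - c < r \<longrightarrow> \<bar>integral {c..d} f / (d - c) - f t\<bar> \<le> e"
      using r1(1) r2(1) by (intro exI [of _ "min r1 r2"]) auto
  qed
qed

text \<open>The point \<open>t\<close> may lie anywhere in the intervals, even at an end, as it does
  in the dyadic cells containing it.\<close>

definition shrinks :: "real \<Rightarrow> real \<Rightarrow> real \<Rightarrow> (nat \<Rightarrow> real) \<Rightarrow> (nat \<Rightarrow> real) \<Rightarrow> bool" where
  "shrinks a b t c d \<longleftrightarrow>
     (\<forall>n. a \<le> c n \<and> c n \<le> t \<and> t \<le> d n \<and> d n \<le> b \<and> c n < d n) \<and> (\<lambda>n. d n - c n) \<longlonglongrightarrow> 0"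

text \<open>One null set serves all sequences of intervals, so that each \<open>t\<close> may later
  use its own dyadic cells.\<close>

lemma lebesgue_differentiation:
  fixes f :: "real \<Rightarrow> real"
  assumes f: "set_integrable lebesgue {a..b} f"
  shows "AE t in lebesgue. \<forall>c d. shrinks a b t c d \<longrightarrow> (\<lambda>n. avg {c n..d n} f) \<longlonglongrightarrow> f t"
proof -
  define g where "g t = (if t \<in> {a..b} then f t else 0)" for t
  have "g integrable_on UNIV"
    unfolding g_def integrable_restrict_UNIV using f by (rule set_lebesgue_integral_eq_integral(1))
  then have "g integrable_on {c..d}" for c d
    using integrable_on_subcbox [of g UNIV c d] by simp
  then obtain N where N: "negligible N"
    "\<And>t e. \<lbrakk>t \<notin> N; 0 < e\<rbrakk> \<Longrightarrow> \<exists>r>0. \<forall>c d. c \<le> t \<and> t \<le> d \<and> c < d \<and> d - c < r \<longrightarrow>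
       \<bar>integral {c..d} g / (d - c) - g t\<bar> \<le> e"
    using two_sided_average_tendsto [of g] by blast
  have "(\<lambda>n. avg {c n..d n} f) \<longlonglongrightarrow> f t" if t: "t \<notin> N" and sh: "shrinks a b t c d" for t c d
  proof (rule LIMSEQ_I)
    fix e :: real assume "0 < e"
    then obtain r where r: "r > 0" "\<And>c d. c \<le> t \<Longrightarrow> t \<le> d \<Longrightarrow> c < d \<Longrightarrow> d - c < r \<Longrightarrow>
       \<bar>integral {c..d} g / (d - c) - g t\<bar> \<le> e / 2"
      using N(2) [OF t, of "e / 2"] by auto
    obtain n0 where n0: "\<And>n. n \<ge> n0 \<Longrightarrow> \<bar>d n - c n\<bar> < r"
      using sh r(1) unfolding shrinks_def by (metis LIMSEQ_D diff_zero real_norm_def)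
    have "norm (avg {c n..d n} f - f t) < e" if "n \<ge> n0" for n
    proof -
      have cd: "a \<le> c n" "c n \<le> t" "t \<le> d n" "d n \<le> b" "c n < d n"
        using sh by (auto simp: shrinks_def)
      have "avg {c n..d n} f = integral {c n..d n} f / (d n - c n)"
        using cd f by (intro avg_eq_integral set_integrable_subinterval [OF f]) auto
      also have "integral {c n..d n} f = integral {c n..d n} g"
        using cd by (intro integral_cong) (auto simp: g_def)
      finally have "avg {c n..d n} f = integral {c n..d n} g / (d n - c n)" .
      moreover have "f t = g t" using cd by (simp add: g_def)
      moreover have "\<bar>integral {c n..d n} g / (d n - c n) - g t\<bar> \<le> e / 2"
        using cd n0 [OF that] by (intro r) auto
      ultimately show ?thesis using \<open>0 < e\<close> by simp
    qed
    then show "\<exists>n0. \<forall>n\<ge>n0. norm (avg {c n..d n} f - f t) < e" by blast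
  qed
  then have "{t. \<not> (\<forall>c d. shrinks a b t c d \<longrightarrow> (\<lambda>n. avg {c n..d n} f) \<longlonglongrightarrow> f t)} \<subseteq> N" by blast
  moreover have "N \<in> null_sets lebesgue" using N(1) by (simp add: negligible_iff_null_sets)
  ultimately show ?thesis by (intro AE_I' [of N]) auto
qed

section \<open>Structure of the dyadic lattice\<close>

lemma dyadic_lattice_interval:
  assumes "J \<in> dyadic_lattice {a..b}" "a < b"
  shows "\<exists>c d. J = {c..d} \<and> a \<le> c \<and> c < d \<and> d \<le> b"
  using assms
proof (induction rule: dyadic_lattice.induct)
  case root
  then show ?case by blast
next
  case (left c d)
  then obtain c' d' where "{c..d} = {c'..d'}" "a \<le> c'" "c' < d'" "d' \<le> b" by blast
  then have "c = c'" "d = d'" by (auto simp: Icc_eq_Icc)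
  then show ?case using \<open>a \<le> c'\<close> \<open>c' < d'\<close> \<open>d' \<le> b\<close> by (intro exI [of _ c] exI [of _ "(c + d) / 2"]) auto
next
  case (right c d)
  then obtain c' d' where "{c..d} = {c'..d'}" "a \<le> c'" "c' < d'" "d' \<le> b" by blast
  then have "c = c'" "d = d'" by (auto simp: Icc_eq_Icc)
  then show ?case using \<open>a \<le> c'\<close> \<open>c' < d'\<close> \<open>d' \<le> b\<close> by (intro exI [of _ "(c + d) / 2"] exI [of _ d]) auto
qed

lemma dyadic_lattice_bounds:
  assumes "{c..d} \<in> dyadic_lattice {a..b}" "a < b"
  shows "a \<le> c" "c < d" "d \<le> b"
  using dyadic_lattice_interval [OF assms] by (auto simp: Icc_eq_Icc)

lemma dyadic_lattice_trans:
  assumes "J \<in> dyadic_lattice K" "K \<in> dyadic_lattice I"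
  shows "J \<in> dyadic_lattice I"
  using assms by (induction rule: dyadic_lattice.induct) (auto intro: dyadic_lattice.intros)

lemma dyadic_lattice_split:
  assumes "J \<in> dyadic_lattice {a..b}" "a < b"
  shows "J = {a..b} \<or> J \<in> dyadic_lattice {a..(a + b) / 2} \<or> J \<in> dyadic_lattice {(a + b) / 2..b}"
  using assms
proof (induction rule: dyadic_lattice.induct)
  case (left c d)
  then show ?case
    using dyadic_lattice_bounds [OF left(1)]
    by (auto simp: Icc_eq_Icc intro: dyadic_lattice.intros)
next
  case (right c d)
  then show ?case
    using dyadic_lattice_bounds [OF right(1)]
    by (auto simp: Icc_eq_Icc intro: dyadic_lattice.intros)
qed auto

text \<open>The step function of generation \<open>n\<close> with value \<open>T c d\<close> on the
  dyadic cell \<open>{c..d}\<close>; if \<open>T\<close> is an average, it is the dyadic martingale.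
  A midpoint is assigned to the left cell.\<close>

primrec refine :: "(real \<Rightarrow> real \<Rightarrow> real) \<Rightarrow> nat \<Rightarrow> real \<Rightarrow> real \<Rightarrow> real \<Rightarrow> real" where
  "refine T 0 a b t = T a b"
| "refine T (Suc n) a b t =
     (if t \<le> (a + b) / 2 then refine T n a ((a + b) / 2) t else refine T n ((a + b) / 2) b t)"

lemma borel_measurable_refine: "refine T n a b \<in> borel_measurable borel"
proof (induction n arbitrary: a b)
  case (Suc n)
  have "refine T (Suc n) a b =
      (\<lambda>t. if t \<le> (a + b) / 2 then refine T n a ((a + b) / 2) t else refine T n ((a + b) / 2) b t)"
    by auto
  then show ?case using Suc.IH by simp
next
  case 0
  have "refine T 0 a b = (\<lambda>t. T a b)" by auto
  then show ?case by simp
qed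

lemma borel_measurable_refine_indicator:
  "(\<lambda>t. ennreal (refine T n a b t) * indicator {c..d} t) \<in> borel_measurable lebesgue"
proof -
  have [measurable]: "refine T n a b \<in> borel_measurable lborel"
    using borel_measurable_refine by simp
  have "(\<lambda>t. ennreal (refine T n a b t) * indicator {c..d} t) \<in> borel_measurable lborel"
    by measurable
  then show ?thesis by (rule measurable_completion)
qed

lemma refine_cell:
  assumes "a < b" "a \<le> t" "t \<le> b"
  shows "\<exists>c d. {c..d} \<in> dyadic_lattice {a..b} \<and> c \<le> t \<and> t \<le> d \<and> d - c = (b - a) / 2 ^ n
    \<and> refine T n a b t = T c d"
  using assms
proof (induction n arbitrary: a b)
  case 0
  then show ?case by (intro exI [of _ a] exI [of _ b]) (auto intro: dyadic_lattice.root)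
next
  case (Suc n)
  let ?m = "(a + b) / 2"
  have halves: "{a..?m} \<in> dyadic_lattice {a..b}" "{?m..b} \<in> dyadic_lattice {a..b}"
    by (auto intro: dyadic_lattice.intros)
  have len: "(?m - a) / 2 ^ n = (b - a) / 2 ^ Suc n" "(b - ?m) / 2 ^ n = (b - a) / 2 ^ Suc n"
    by (auto simp: field_simps)
  show ?case
  proof (cases "t \<le> ?m")
    case True
    then obtain c d where "{c..d} \<in> dyadic_lattice {a..?m}" "c \<le> t" "t \<le> d" "d - c = (?m - a) / 2 ^ n"
      "refine T n a ?m t = T c d"
      using Suc.IH [of a ?m] Suc.prems by auto
    then show ?thesis using True halves len dyadic_lattice_trans [of "{c..d}" "{a..?m}"]
      by (intro exI [of _ c] exI [of _ d]) simp
  next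
    case False
    then obtain c d where "{c..d} \<in> dyadic_lattice {?m..b}" "c \<le> t" "t \<le> d" "d - c = (b - ?m) / 2 ^ n"
      "refine T n ?m b t = T c d"
      using Suc.IH [of ?m b] Suc.prems by auto
    then show ?thesis using False halves len dyadic_lattice_trans [of "{c..d}" "{?m..b}"]
      by (intro exI [of _ c] exI [of _ d]) simp
  qed
qed

text \<open>The induction splits off the coarsest generation: both halves satisfy the bound one
  generation lower, and \<open>super\<close> at the whole interval combines them.\<close>

lemma nn_integral_refine_le:
  assumes "a < b"
    and nonneg: "\<And>c d. {c..d} \<in> dyadic_lattice {a..b} \<Longrightarrow> 0 \<le> T c d"
    and super: "\<And>c d. {c..d} \<in> dyadic_lattice {a..b} \<Longrightarrow> T c ((c + d) / 2) + T ((c + d) / 2) d \<le> 2 * T c d"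
  shows "(\<integral>\<^sup>+t\<in>{a..b}. ennreal (refine T n a b t) \<partial>lebesgue) \<le> ennreal ((b - a) * T a b)"
  using assms
proof (induction n arbitrary: a b)
  case 0
  have "0 \<le> T a b" using 0 by (auto intro: dyadic_lattice.root)
  then show ?case using 0 by (simp add: nn_integral_cmult_indicator ennreal_mult' mult.commute)
next
  case (Suc n)
  let ?m = "(a + b) / 2"
  have halves: "{a..?m} \<in> dyadic_lattice {a..b}" "{?m..b} \<in> dyadic_lattice {a..b}"
    by (auto intro: dyadic_lattice.intros)
  have sub: "{c..d} \<in> dyadic_lattice {a..?m} \<Longrightarrow> {c..d} \<in> dyadic_lattice {a..b}"
    "{c..d} \<in> dyadic_lattice {?m..b} \<Longrightarrow> {c..d} \<in> dyadic_lattice {a..b}" for c d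
    using halves dyadic_lattice_trans by blast+
  have meas: "(\<lambda>t. ennreal (refine T n c d t) * indicator {c..d} t) \<in> borel_measurable lebesgue" for c d
    by (rule borel_measurable_refine_indicator)
  have 1: "(\<integral>\<^sup>+t\<in>{a..?m}. ennreal (refine T n a ?m t) \<partial>lebesgue) \<le> ennreal ((?m - a) * T a ?m)"
    using Suc.prems sub by (intro Suc.IH) auto
  have 2: "(\<integral>\<^sup>+t\<in>{?m..b}. ennreal (refine T n ?m b t) \<partial>lebesgue) \<le> ennreal ((b - ?m) * T ?m b)"
    using Suc.prems sub by (intro Suc.IH) auto
  \<comment> \<open>The closed halves share the midpoint, which is counted twice on the right; an
    upper bound tolerates this.\<close>
  have "(\<integral>\<^sup>+t\<in>{a..b}. ennreal (refine T (Suc n) a b t) \<partial>lebesgue)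
      \<le> (\<integral>\<^sup>+t. ennreal (refine T n a ?m t) * indicator {a..?m} t + ennreal (refine T n ?m b t) * indicator {?m..b} t \<partial>lebesgue)"
    by (intro nn_integral_mono) (auto simp: indicator_def)
  also have "\<dots> = (\<integral>\<^sup>+t\<in>{a..?m}. ennreal (refine T n a ?m t) \<partial>lebesgue) + (\<integral>\<^sup>+t\<in>{?m..b}. ennreal (refine T n ?m b t) \<partial>lebesgue)"
    by (intro nn_integral_add meas)
  also have "\<dots> \<le> ennreal ((?m - a) * T a ?m) + ennreal ((b - ?m) * T ?m b)"
    using 1 2 by (rule add_mono)
  also have "\<dots> = ennreal ((?m - a) * T a ?m + (b - ?m) * T ?m b)"
    using Suc.prems halves by (intro ennreal_plus [symmetric] mult_nonneg_nonneg) auto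
  also have "\<dots> \<le> ennreal ((b - a) * T a b)"
  proof (rule ennreal_leI)
    have "(b - a) / 2 * (T a ?m + T ?m b) \<le> (b - a) / 2 * (2 * T a b)"
      using Suc.prems by (intro mult_left_mono Suc.prems(3)) (auto intro: dyadic_lattice.root)
    moreover have "?m - a = (b - a) / 2" "b - ?m = (b - a) / 2" by (auto simp: field_simps)
    then have "(?m - a) * T a ?m + (b - ?m) * T ?m b = (b - a) / 2 * (T a ?m + T ?m b)"
      by (simp add: distrib_left)
    ultimately show "(?m - a) * T a ?m + (b - ?m) * T ?m b \<le> (b - a) * T a b"
      by simp
  qed
  finally show ?case .
qed

text \<open>The step functions converge almost everywhere to \<open>f\<close> while their integrals
  stay below the same bound. Nonnegativity of \<open>T\<close> lets Fatou's lemma pass to the limit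
  without a dominating function.\<close>

lemma nn_integral_le_of_superadditive:
  assumes "a < b"
    and nonneg: "\<And>c d. {c..d} \<in> dyadic_lattice {a..b} \<Longrightarrow> 0 \<le> T c d"
    and super: "\<And>c d. {c..d} \<in> dyadic_lattice {a..b} \<Longrightarrow> T c ((c + d) / 2) + T ((c + d) / 2) d \<le> 2 * T c d"
    and lim: "AE t in lebesgue. \<forall>c d. shrinks a b t c d \<longrightarrow> (\<forall>n. {c n..d n} \<in> dyadic_lattice {a..b}) \<longrightarrow>
        (\<lambda>n. T (c n) (d n)) \<longlonglongrightarrow> f t"
  shows "(\<integral>\<^sup>+t\<in>{a..b}. ennreal (f t) \<partial>lebesgue) \<le> ennreal ((b - a) * T a b)"
proof -
  define u where "u n t = ennreal (refine T n a b t) * indicator {a..b} t" for n t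
  have meas: "u n \<in> borel_measurable lebesgue" for n
    unfolding u_def by (rule borel_measurable_refine_indicator)
  have "AE t in lebesgue. ennreal (f t) * indicator {a..b} t = liminf (\<lambda>n. u n t)"
    using lim
  proof eventually_elim
    case (elim t)
    show ?case
    proof (cases "t \<in> {a..b}")
      case True
      then have t: "a \<le> t" "t \<le> b" by auto
      obtain c d where cd: "\<And>n. {c n..d n} \<in> dyadic_lattice {a..b} \<and> c n \<le> t \<and> t \<le> d n
          \<and> d n - c n = (b - a) / 2 ^ n \<and> refine T n a b t = T (c n) (d n)"
        using refine_cell [OF \<open>a < b\<close> t, where T = T] by metis
      have "(\<lambda>n. (b - a) * (1 / 2) ^ n) \<longlonglongrightarrow> (b - a) * 0"
        by (intro tendsto_mult tendsto_const LIMSEQ_realpow_zero) auto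
      then have "(\<lambda>n. d n - c n) \<longlonglongrightarrow> 0"
        using cd by (simp add: power_divide)
      then have "shrinks a b t c d"
        unfolding shrinks_def using cd dyadic_lattice_bounds [OF _ \<open>a < b\<close>] by blast
      then have "(\<lambda>n. T (c n) (d n)) \<longlonglongrightarrow> f t" using elim cd by blast
      then have "(\<lambda>n. u n t) \<longlonglongrightarrow> ennreal (f t)"
        using True cd by (auto simp: u_def intro!: tendsto_ennrealI)
      then have "liminf (\<lambda>n. u n t) = ennreal (f t)" by (intro lim_imp_Liminf) auto
      then show ?thesis using True by simp
    next
      case False
      then show ?thesis by (simp add: u_def Liminf_const)
    qed
  qed
  then have "(\<integral>\<^sup>+t\<in>{a..b}. ennreal (f t) \<partial>lebesgue) = (\<integral>\<^sup>+t. liminf (\<lambda>n. u n t) \<partial>lebesgue)"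
    by (rule nn_integral_cong_AE)
  also have "\<dots> \<le> liminf (\<lambda>n. \<integral>\<^sup>+t. u n t \<partial>lebesgue)"
    by (rule nn_integral_liminf) (rule meas)
  also have "\<dots> \<le> liminf (\<lambda>n. ennreal ((b - a) * T a b))"
    unfolding u_def by (intro Liminf_mono always_eventually allI nn_integral_refine_le assms)
  also have "\<dots> = ennreal ((b - a) * T a b)" by (simp add: Liminf_const)
  finally show ?thesis .
qed

section \<open>Bounds for all test functions\<close>

lemma test_functionsD:
  assumes "\<phi> \<in> test_functions \<epsilon> {a..b} x"
  shows "set_integrable lebesgue {a..b} \<phi>" "set_integrable lebesgue {a..b} (\<lambda>t. (\<phi> t)\<^sup>2)"
    "avg {a..b} \<phi> = fst x" "avg {a..b} (\<lambda>t. (\<phi> t)\<^sup>2) = snd x"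
    "J \<in> dyadic_lattice {a..b} \<Longrightarrow> avg_variance \<phi> J \<le> \<epsilon>\<^sup>2"
proof -
  have bdd: "bdd_above (avg_variance \<phi> ` dyadic_lattice {a..b})"
    and norm: "sqrt (SUP J\<in>dyadic_lattice {a..b}. avg_variance \<phi> J) \<le> \<epsilon>"
    using assms by (auto simp: test_functions_def BMOd_ball_def BMOd_def BMOd_norm_def)
  show "avg_variance \<phi> J \<le> \<epsilon>\<^sup>2" if "J \<in> dyadic_lattice {a..b}"
  proof -
    have "avg_variance \<phi> J \<le> (SUP J\<in>dyadic_lattice {a..b}. avg_variance \<phi> J)"
      using that bdd by (rule cSUP_upper)
    also have "\<dots> \<le> \<epsilon>\<^sup>2" using norm by (rule sqrt_le_D)
    finally show ?thesis .
  qed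
qed (use assms in \<open>auto simp: test_functions_def BMOd_ball_def BMOd_def\<close>)

lemma test_functionsI:
  assumes "set_integrable lebesgue {a..b} \<phi>" "set_integrable lebesgue {a..b} (\<lambda>t. (\<phi> t)\<^sup>2)"
    "avg {a..b} \<phi> = fst x" "avg {a..b} (\<lambda>t. (\<phi> t)\<^sup>2) = snd x"
    "\<And>J. J \<in> dyadic_lattice {a..b} \<Longrightarrow> avg_variance \<phi> J \<le> \<epsilon>\<^sup>2" and "0 \<le> \<epsilon>"
  shows "\<phi> \<in> test_functions \<epsilon> {a..b} x"
proof -
  have "bdd_above (avg_variance \<phi> ` dyadic_lattice {a..b})"
    using assms(5) by (intro bdd_aboveI2)
  moreover have "(SUP J\<in>dyadic_lattice {a..b}. avg_variance \<phi> J) \<le> \<epsilon>\<^sup>2"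
    using assms(5) by (intro cSUP_least) (auto intro: dyadic_lattice.root)
  then have "sqrt (SUP J\<in>dyadic_lattice {a..b}. avg_variance \<phi> J) \<le> \<epsilon>"
    using \<open>0 \<le> \<epsilon>\<close> by (intro real_le_lsqrt) auto
  ultimately show ?thesis
    using assms by (simp add: test_functions_def BMOd_ball_def BMOd_def BMOd_norm_def)
qed

lemma set_integrable_const_Icc: "set_integrable lebesgue {c..d} (\<lambda>t. h::real)" for c d :: real
  by (intro absolutely_integrable_continuous_real continuous_intros)

lemma avg_affine:
  assumes "set_integrable lebesgue {c..d} f" "set_integrable lebesgue {c..d} g" "c < d"
  shows "avg {c..d} (\<lambda>t. f t + k * g t + h) = avg {c..d} f + k * avg {c..d} g + h"
proof -
  have "set_integrable lebesgue {c..d} (\<lambda>t. k * g t)"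
    using assms by (intro set_integrable_mult_right) auto
  moreover have "set_integrable lebesgue {c..d} (\<lambda>t. h)"
    by (rule set_integrable_const_Icc)
  moreover have "avg {c..d} (\<lambda>t. h) = h"
    using \<open>c < d\<close> by (simp add: avg_def set_integral_const)
  ultimately show ?thesis
    using assms by (simp add: avg_def set_integral_add set_integral_mult_right add_divide_distrib)
qed

lemma avg_mono:
  assumes "set_integrable lebesgue {c..d} f" "set_integrable lebesgue {c..d} g" "c < d" "\<And>t. f t \<le> g t"
  shows "avg {c..d} f \<le> avg {c..d} g"
  using assms unfolding avg_def by (intro divide_right_mono set_integral_mono) auto

lemma avg_nonneg: "(\<And>t. 0 \<le> f t) \<Longrightarrow> 0 \<le> avg J f"
  unfolding avg_def set_lebesgue_integral_def
  by (intro divide_nonneg_nonneg Bochner_Integration.integral_nonneg) auto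

lemma avg_variance_nonneg:
  assumes f: "set_integrable lebesgue {c..d} f" "set_integrable lebesgue {c..d} (\<lambda>t. (f t)\<^sup>2)" and "c < d"
  shows "0 \<le> avg_variance f {c..d}"
proof -
  let ?m = "avg {c..d} f"
  have "avg {c..d} (\<lambda>t. (f t)\<^sup>2 + (- 2 * ?m) * f t + ?m\<^sup>2) = avg_variance f {c..d}"
    using avg_affine [OF f(2) f(1) \<open>c < d\<close>, of "- 2 * ?m" "?m\<^sup>2"]
    by (simp add: avg_variance_def power2_eq_square)
  moreover have "(f t)\<^sup>2 + (- 2 * ?m) * f t + ?m\<^sup>2 = (f t - ?m)\<^sup>2" for t
    by (simp add: power2_eq_square algebra_simps)
  moreover have "0 \<le> avg {c..d} (\<lambda>t. (f t - ?m)\<^sup>2)"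
    by (rule avg_nonneg) simp
  ultimately show ?thesis by simp
qed

text \<open>Jensen's inequality, by averaging the tangent line of \<open>exp\<close> at the
  mean.\<close>

lemma exp_avg_le:
  assumes f: "set_integrable lebesgue {c..d} f" "set_integrable lebesgue {c..d} (\<lambda>t. exp (f t))" and "c < d"
  shows "exp (avg {c..d} f) \<le> avg {c..d} (\<lambda>t. exp (f t))"
proof -
  let ?m = "avg {c..d} f"
  have z: "set_integrable lebesgue {c..d} (\<lambda>t. 0::real)" by (rule set_integrable_const_Icc)
  have m: "set_integrable lebesgue {c..d} (\<lambda>t. 0 + exp ?m * f t + exp ?m * (1 - ?m))"
    using f by (intro set_integral_add set_integrable_mult_right z set_integrable_const_Icc)
  have "avg {c..d} (\<lambda>t. 0 + exp ?m * f t + exp ?m * (1 - ?m)) = exp ?m"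
    using avg_affine [OF z f(1) \<open>c < d\<close>, of "exp ?m" "exp ?m * (1 - ?m)"]
    by (simp add: avg_def set_lebesgue_integral_def algebra_simps)
  moreover have "0 + exp ?m * f t + exp ?m * (1 - ?m) \<le> exp (f t)" for t
  proof -
    have "exp ?m * (1 + (f t - ?m)) \<le> exp ?m * exp (f t - ?m)"
      by (intro mult_left_mono exp_ge_add_one_self) auto
    then show ?thesis by (simp add: exp_diff algebra_simps)
  qed
  ultimately show ?thesis using avg_mono [OF m f(2) \<open>c < d\<close>] by simp
qed

definition bpoint :: "(real \<Rightarrow> real) \<Rightarrow> real \<Rightarrow> real \<Rightarrow> real \<times> real" where
  "bpoint \<phi> c d = (avg {c..d} \<phi>, avg {c..d} (\<lambda>t. (\<phi> t)\<^sup>2))"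

lemma bpoint_in_Omega:
  assumes "\<phi> \<in> test_functions \<epsilon> {a..b} x" "a < b" "{c..d} \<in> dyadic_lattice {a..b}"
  shows "bpoint \<phi> c d \<in> Omega \<epsilon>"
proof -
  note cd = dyadic_lattice_bounds [OF assms(3) assms(2)]
  have "0 \<le> avg_variance \<phi> {c..d}"
    using test_functionsD(1,2) [OF assms(1)] cd
    by (intro avg_variance_nonneg) (auto intro: set_integrable_subinterval)
  moreover have "avg_variance \<phi> {c..d} \<le> \<epsilon>\<^sup>2" by (rule test_functionsD(5) [OF assms(1,3)])
  ultimately show ?thesis by (simp add: bpoint_def Omega_def avg_variance_def)
qed

lemma bpoint_halves:
  assumes "\<phi> \<in> test_functions \<epsilon> {a..b} x" "a < b" "{c..d} \<in> dyadic_lattice {a..b}"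
  shows "bpoint \<phi> c ((c + d) / 2) + bpoint \<phi> ((c + d) / 2) d = 2 *\<^sub>R bpoint \<phi> c d"
proof -
  note cd = dyadic_lattice_bounds [OF assms(3) assms(2)]
  have "set_integrable lebesgue {c..d} \<phi>" "set_integrable lebesgue {c..d} (\<lambda>t. (\<phi> t)\<^sup>2)"
    using test_functionsD(1,2) [OF assms(1)] cd by (auto intro: set_integrable_subinterval)
  then show ?thesis using cd avg_halves [of c d \<phi>] avg_halves [of c d "\<lambda>t. (\<phi> t)\<^sup>2"]
    by (simp add: bpoint_def)
qed

lemma bpoint_tendsto:
  assumes "\<phi> \<in> test_functions \<epsilon> {a..b} x" and cont: "continuous_on UNIV F"
  shows "AE t in lebesgue. \<forall>c d. shrinks a b t c d \<longrightarrow> (\<lambda>n. F (bpoint \<phi> (c n) (d n))) \<longlonglongrightarrow> F (\<phi> t, (\<phi> t)\<^sup>2)"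
  using lebesgue_differentiation [OF test_functionsD(1) [OF assms(1)]]
    lebesgue_differentiation [OF test_functionsD(2) [OF assms(1)]]
proof eventually_elim
  case (elim t)
  show ?case
  proof (intro allI impI)
    fix c d assume "shrinks a b t c d"
    then have "(\<lambda>n. bpoint \<phi> (c n) (d n)) \<longlonglongrightarrow> (\<phi> t, (\<phi> t)\<^sup>2)"
      using elim unfolding bpoint_def by (intro tendsto_Pair) auto
    moreover have "isCont F (\<phi> t, (\<phi> t)\<^sup>2)"
      using cont by (simp add: continuous_on_eq_continuous_at)
    ultimately show "(\<lambda>n. F (bpoint \<phi> (c n) (d n))) \<longlonglongrightarrow> F (\<phi> t, (\<phi> t)\<^sup>2)"
      by (rule isCont_tendsto_compose [rotated])
  qed
qed

lemma avg_nn_eq: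
  assumes "c < d"
  shows "avg_nn {c..d} f = ennreal (1 / (d - c)) * (\<integral>\<^sup>+t\<in>{c..d}. ennreal (f t) \<partial>lebesgue)"
  using assms by (simp add: avg_nn_def divide_ennreal_def inverse_ennreal inverse_eq_divide mult.commute)

lemma avg_nn_le_iff:
  assumes "c < d" "0 \<le> B"
  shows "avg_nn {c..d} f \<le> ennreal B \<longleftrightarrow> (\<integral>\<^sup>+t\<in>{c..d}. ennreal (f t) \<partial>lebesgue) \<le> ennreal ((d - c) * B)"
    (is "_ \<longleftrightarrow> ?I \<le> _")
proof
  assume "avg_nn {c..d} f \<le> ennreal B"
  then have "ennreal (d - c) * (ennreal (1 / (d - c)) * ?I) \<le> ennreal (d - c) * ennreal B"
    unfolding avg_nn_eq [OF \<open>c < d\<close>] by (rule mult_left_mono) simp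
  moreover have "ennreal (d - c) * (ennreal (1 / (d - c)) * ?I) = ?I"
    using assms by (simp flip: mult.assoc ennreal_mult)
  ultimately show "?I \<le> ennreal ((d - c) * B)" using assms by (simp flip: ennreal_mult)
next
  assume "?I \<le> ennreal ((d - c) * B)"
  then have "ennreal (1 / (d - c)) * ?I \<le> ennreal (1 / (d - c)) * ennreal ((d - c) * B)"
    by (rule mult_left_mono) simp
  moreover have "ennreal (1 / (d - c)) * ennreal ((d - c) * B) = ennreal B"
    using assms by (simp flip: ennreal_mult)
  ultimately show "avg_nn {c..d} f \<le> ennreal B" unfolding avg_nn_eq [OF \<open>c < d\<close>] by simp
qed

lemma borel_measurable_exp_indicator:
  fixes a b :: real
  assumes "set_integrable lebesgue {a..b} \<phi>"
  shows "(\<lambda>t. ennreal (exp (\<phi> t)) * indicator {a..b} t) \<in> borel_measurable lebesgue"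
proof -
  define g where "g t = indicator {a..b} t *\<^sub>R \<phi> t" for t
  have [measurable]: "g \<in> borel_measurable lebesgue"
    using assms unfolding set_integrable_def g_def by (rule borel_measurable_integrable)
  have [measurable]: "{a..b} \<in> sets lebesgue" by simp
  have "(\<lambda>t. ennreal (exp (g t)) * indicator {a..b} t) \<in> borel_measurable lebesgue"
    by measurable
  moreover have "(\<lambda>t. ennreal (exp (g t)) * indicator {a..b} t) =
      (\<lambda>t. ennreal (exp (\<phi> t)) * indicator {a..b} t)"
    by (auto simp: indicator_def g_def)
  ultimately show ?thesis by simp
qed

definition midpoint_concave :: "real \<Rightarrow> (real \<times> real \<Rightarrow> real) \<Rightarrow> bool" where
  "midpoint_concave \<epsilon> F \<longleftrightarrow>
     (\<forall>x\<in>Omega \<epsilon>. \<forall>y\<in>Omega \<epsilon>. \<forall>z\<in>Omega \<epsilon>. x + y = 2 *\<^sub>R z \<longrightarrow> F x + F y \<le> 2 * F z)"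

text \<open>Along the cells shrinking to \<open>t\<close> the points \<open>bpoint\<close> tend to
  \<open>(\<phi> t, (\<phi> t)\<^sup>2)\<close>, where \<open>F\<close> equals
  \<open>exp (\<phi> t)\<close>; midpoint concavity makes \<open>F\<close> of these points
  superadditive.\<close>

theorem avg_nn_exp_le_majorant:
  assumes \<phi>: "\<phi> \<in> test_functions \<epsilon> {a..b} x" and "a < b"
    and conc: "midpoint_concave \<epsilon> F" and cont: "continuous_on UNIV F"
    and nonneg: "\<And>y. y \<in> Omega \<epsilon> \<Longrightarrow> 0 \<le> F y" and bd: "\<And>u. F (u, u\<^sup>2) = exp u"
  shows "avg_nn {a..b} (\<lambda>t. exp (\<phi> t)) \<le> ennreal (F x)"
proof -
  have x: "bpoint \<phi> a b = x"
    using test_functionsD(3,4) [OF \<phi>] by (simp add: bpoint_def)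
  define T where "T c d = F (bpoint \<phi> c d)" for c d
  have "(\<integral>\<^sup>+t\<in>{a..b}. ennreal (exp (\<phi> t)) \<partial>lebesgue) \<le> ennreal ((b - a) * T a b)"
  proof (rule nn_integral_le_of_superadditive [OF \<open>a < b\<close>])
    fix c d assume J: "{c..d} \<in> dyadic_lattice {a..b}"
    then show "0 \<le> T c d"
      unfolding T_def using bpoint_in_Omega [OF \<phi> \<open>a < b\<close>] by (intro nonneg)
    show "T c ((c + d) / 2) + T ((c + d) / 2) d \<le> 2 * T c d"
      using conc bpoint_halves [OF \<phi> \<open>a < b\<close> J] bpoint_in_Omega [OF \<phi> \<open>a < b\<close>] J
      unfolding T_def midpoint_concave_def by (meson dyadic_lattice.intros)
  next
    show "AE t in lebesgue. \<forall>c d. shrinks a b t c d \<longrightarrow> (\<forall>n. {c n..d n} \<in> dyadic_lattice {a..b}) \<longrightarrow>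
        (\<lambda>n. T (c n) (d n)) \<longlonglongrightarrow> exp (\<phi> t)"
      using bpoint_tendsto [OF \<phi> cont] by eventually_elim (auto simp: T_def bd)
  qed
  moreover have "0 \<le> F x"
    unfolding x [symmetric] using bpoint_in_Omega [OF \<phi> \<open>a < b\<close> dyadic_lattice.root] by (rule nonneg)
  ultimately show ?thesis
    using \<open>a < b\<close> by (simp add: avg_nn_le_iff T_def x)
qed

text \<open>Applying the superadditive bound to \<open>C \<langle>e\<^sup>\<phi>\<rangle> - F\<close> turns a bound from above into one from below.\<close>

theorem avg_nn_exp_ge_minorant:
  assumes \<phi>: "\<phi> \<in> test_functions \<epsilon> {a..b} x" and "a < b"
    and conv: "midpoint_concave \<epsilon> (\<lambda>y. - F y)" and cont: "continuous_on UNIV F"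
    and le: "\<And>y. y \<in> Omega \<epsilon> \<Longrightarrow> F y \<le> C * exp (fst y)" and bd: "\<And>u. F (u, u\<^sup>2) = exp u"
  shows "ennreal (F x) \<le> avg_nn {a..b} (\<lambda>t. exp (\<phi> t))"
proof (cases "set_integrable lebesgue {a..b} (\<lambda>t. exp (\<phi> t))")
  case True
  have x: "bpoint \<phi> a b = x"
    using test_functionsD(3,4) [OF \<phi>] by (simp add: bpoint_def)
  define E where "E c d = avg {c..d} (\<lambda>t. exp (\<phi> t))" for c d
  \<comment> \<open>Jensen's inequality and \<open>le\<close> make \<open>T\<close> nonnegative.
    \<open>E\<close> is exactly additive under halving, so \<open>T\<close> inherits superadditivity
    from \<open>- F\<close>. Its limit is \<open>(C - 1) * exp (\<phi> t)\<close>, and the resulting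
    \<open>(C - 1) * E a b \<le> C * E a b - F x\<close> is the claim.\<close>
  define T where "T c d = C * E c d - F (bpoint \<phi> c d)" for c d
  have "(0, 0\<^sup>2) \<in> Omega \<epsilon>" by (simp add: Omega_def)
  then have C: "1 \<le> C" using le [of "(0, 0\<^sup>2)"] bd [of 0] by simp
  have T: "0 \<le> T c d" if J: "{c..d} \<in> dyadic_lattice {a..b}" for c d
  proof -
    note cd = dyadic_lattice_bounds [OF J \<open>a < b\<close>]
    have "F (bpoint \<phi> c d) \<le> C * exp (avg {c..d} \<phi>)"
      using le [OF bpoint_in_Omega [OF \<phi> \<open>a < b\<close> J]] by (simp add: bpoint_def)
    also have "\<dots> \<le> C * E c d"
      using C cd True test_functionsD(1) [OF \<phi>] unfolding E_def
      by (intro mult_left_mono exp_avg_le) (auto intro: set_integrable_subinterval)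
    finally show ?thesis by (simp add: T_def)
  qed
  have I: "(\<integral>\<^sup>+t\<in>{a..b}. ennreal ((C - 1) * exp (\<phi> t)) \<partial>lebesgue) \<le> ennreal ((b - a) * T a b)"
  proof (rule nn_integral_le_of_superadditive [OF \<open>a < b\<close> T])
    fix c d assume J: "{c..d} \<in> dyadic_lattice {a..b}"
    note cd = dyadic_lattice_bounds [OF J \<open>a < b\<close>]
    have "2 * E c d = E c ((c + d) / 2) + E ((c + d) / 2) d"
      unfolding E_def using cd True avg_halves [of c d "\<lambda>t. exp (\<phi> t)"]
      by (simp add: set_integrable_subinterval)
    moreover have "- F (bpoint \<phi> c ((c + d) / 2)) + - F (bpoint \<phi> ((c + d) / 2) d) \<le> 2 * - F (bpoint \<phi> c d)"
      using conv bpoint_halves [OF \<phi> \<open>a < b\<close> J] bpoint_in_Omega [OF \<phi> \<open>a < b\<close>] J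
      unfolding midpoint_concave_def by (meson dyadic_lattice.intros)
    moreover have "2 * (C * E c d) = C * (2 * E c d)" by simp
    then have "2 * (C * E c d) = C * E c ((c + d) / 2) + C * E ((c + d) / 2) d"
      unfolding \<open>2 * E c d = _\<close> by (simp only: distrib_left)
    ultimately show "T c ((c + d) / 2) + T ((c + d) / 2) d \<le> 2 * T c d"
      by (simp add: T_def)
  next
    show "AE t in lebesgue. \<forall>c d. shrinks a b t c d \<longrightarrow> (\<forall>n. {c n..d n} \<in> dyadic_lattice {a..b}) \<longrightarrow>
        (\<lambda>n. T (c n) (d n)) \<longlonglongrightarrow> (C - 1) * exp (\<phi> t)"
      using bpoint_tendsto [OF \<phi> cont] lebesgue_differentiation [OF True]
    proof eventually_elim
      case (elim t)
      show ?case
      proof (intro allI impI)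
        fix c d assume "shrinks a b t c d"
        then have "(\<lambda>n. T (c n) (d n)) \<longlonglongrightarrow> C * exp (\<phi> t) - exp (\<phi> t)"
          unfolding T_def E_def bd [symmetric] using elim by (intro tendsto_intros) (auto simp: bd)
        then show "(\<lambda>n. T (c n) (d n)) \<longlonglongrightarrow> (C - 1) * exp (\<phi> t)" by (simp add: algebra_simps)
      qed
    qed
  qed
  have nn: "(\<integral>\<^sup>+t\<in>{a..b}. ennreal (k * exp (\<phi> t)) \<partial>lebesgue) = ennreal ((b - a) * (k * E a b))" if "0 \<le> k" for k
  proof -
    have int: "set_integrable lebesgue {a..b} (\<lambda>t. k * exp (\<phi> t))"
      using True by (intro set_integrable_mult_right) auto
    have "(\<integral>\<^sup>+t\<in>{a..b}. ennreal (k * exp (\<phi> t)) \<partial>lebesgue) =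
        (\<integral>\<^sup>+t. ennreal (indicator {a..b} t *\<^sub>R (k * exp (\<phi> t))) \<partial>lebesgue)"
      by (intro nn_integral_cong) (simp add: indicator_def)
    also have "\<dots> = ennreal (LINT t:{a..b}|lebesgue. k * exp (\<phi> t))"
      using int that unfolding set_lebesgue_integral_def set_integrable_def
      by (intro nn_integral_eq_integral) auto
    also have "(LINT t:{a..b}|lebesgue. k * exp (\<phi> t)) = (b - a) * (k * E a b)"
      using \<open>a < b\<close> by (simp add: E_def avg_def)
    finally show ?thesis .
  qed
  have "0 \<le> E a b" unfolding E_def by (rule avg_nonneg) simp
  have "(b - a) * ((C - 1) * E a b) \<le> (b - a) * T a b"
    using I nn [of "C - 1"] C T [OF dyadic_lattice.root] \<open>a < b\<close> by (simp add: ennreal_le_iff)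
  then have "(C - 1) * E a b \<le> T a b" using \<open>a < b\<close> by simp
  then have "F x \<le> E a b" by (simp add: T_def x algebra_simps)
  moreover have "avg_nn {a..b} (\<lambda>t. exp (\<phi> t)) = ennreal (E a b)"
    using nn [of 1] \<open>a < b\<close> \<open>0 \<le> E a b\<close> by (simp add: avg_nn_eq flip: ennreal_mult)
  ultimately show ?thesis by (simp add: ennreal_leI)
next
  case False
  \<comment> \<open>Without integrability the right side is infinite: measurability comes from
    \<phi>, so only an infinite integral can prevent integrability.\<close>
  have "(\<lambda>t. enn2real (ennreal (exp (\<phi> t)) * indicator {a..b} t)) \<in> borel_measurable lebesgue"
    using borel_measurable_exp_indicator [OF test_functionsD(1) [OF \<phi>]] by measurable
  moreover have "(\<lambda>t. enn2real (ennreal (exp (\<phi> t)) * indicator {a..b} t)) = (\<lambda>t. indicator {a..b} t *\<^sub>R exp (\<phi> t))"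
    by (auto simp: indicator_def)
  ultimately have meas: "(\<lambda>t. indicator {a..b} t *\<^sub>R exp (\<phi> t)) \<in> borel_measurable lebesgue" by simp
  have "(\<integral>\<^sup>+t\<in>{a..b}. ennreal (exp (\<phi> t)) \<partial>lebesgue) = \<infinity>"
  proof (rule ccontr)
    assume "\<not> ?thesis"
    moreover have "(\<integral>\<^sup>+t\<in>{a..b}. ennreal (exp (\<phi> t)) \<partial>lebesgue) =
        (\<integral>\<^sup>+t. ennreal (norm (indicator {a..b} t *\<^sub>R exp (\<phi> t))) \<partial>lebesgue)"
      by (intro nn_integral_cong) (simp add: indicator_def)
    ultimately have "set_integrable lebesgue {a..b} (\<lambda>t. exp (\<phi> t))"
      using meas unfolding set_integrable_def by (intro integrableI_bounded) (auto simp: top.not_eq_extremum)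
    then show False using False by simp
  qed
  then show ?thesis using \<open>a < b\<close> by (simp add: avg_nn_eq ennreal_mult_top)
qed

section \<open>Concatenation and translation of test functions\<close>

lemma avg_cong_spike:
  assumes "set_integrable lebesgue {c..d} f" "c \<le> d" "\<And>t. t \<in> {c..d} - {p} \<Longrightarrow> g t = f t"
  shows "set_integrable lebesgue {c..d} g" "avg {c..d} g = avg {c..d} f"
proof -
  show g: "set_integrable lebesgue {c..d} g"
    using assms by (intro absolutely_integrable_spike [OF assms(1) negligible_sing]) auto
  show "avg {c..d} g = avg {c..d} f"
    using assms g integral_spike [OF negligible_sing, of "{c..d}" p f g]
    by (simp add: avg_eq_integral)
qed

definition join :: "real \<Rightarrow> (real \<Rightarrow> real) \<Rightarrow> (real \<Rightarrow> real) \<Rightarrow> real \<Rightarrow> real" where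
  "join m \<phi> \<psi> t = (if t \<le> m then \<phi> t else \<psi> t)"

text \<open>A dyadic subinterval other than the root lies in one half, where the variance bound is
  inherited; at the root it is the condition \<open>z \<in> Omega \<epsilon>\<close>.\<close>

lemma join_in_test_functions:
  assumes "a < b" "0 \<le> \<epsilon>" and z: "z \<in> Omega \<epsilon>" "x + y = 2 *\<^sub>R z"
    and \<phi>: "\<phi> \<in> test_functions \<epsilon> {a..(a + b) / 2} x"
    and \<psi>: "\<psi> \<in> test_functions \<epsilon> {(a + b) / 2..b} y"
  shows "join ((a + b) / 2) \<phi> \<psi> \<in> test_functions \<epsilon> {a..b} z"
proof -
  define m where "m = (a + b) / 2"
  define \<eta> where "\<eta> = join m \<phi> \<psi>"
  have m: "a < m" "m < b" using \<open>a < b\<close> by (auto simp: m_def)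
  note \<phi> = test_functionsD [OF \<phi>, folded m_def] and \<psi> = test_functionsD [OF \<psi>, folded m_def]
  have L: "set_integrable lebesgue {c..d} \<eta>" "avg {c..d} \<eta> = avg {c..d} \<phi>"
    "set_integrable lebesgue {c..d} (\<lambda>t. (\<eta> t)\<^sup>2)" "avg {c..d} (\<lambda>t. (\<eta> t)\<^sup>2) = avg {c..d} (\<lambda>t. (\<phi> t)\<^sup>2)"
    if "a \<le> c" "c \<le> d" "d \<le> m" for c d
    using that \<phi>(1,2) avg_cong_spike [of c d \<phi> m \<eta>] avg_cong_spike [of c d "\<lambda>t. (\<phi> t)\<^sup>2" m "\<lambda>t. (\<eta> t)\<^sup>2"]
    by (auto simp: \<eta>_def join_def intro: set_integrable_subinterval)
  have R: "set_integrable lebesgue {c..d} \<eta>" "avg {c..d} \<eta> = avg {c..d} \<psi>"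
    "set_integrable lebesgue {c..d} (\<lambda>t. (\<eta> t)\<^sup>2)" "avg {c..d} (\<lambda>t. (\<eta> t)\<^sup>2) = avg {c..d} (\<lambda>t. (\<psi> t)\<^sup>2)"
    if "m \<le> c" "c \<le> d" "d \<le> b" for c d
    using that \<psi>(1,2) avg_cong_spike [of c d \<psi> m \<eta>] avg_cong_spike [of c d "\<lambda>t. (\<psi> t)\<^sup>2" m "\<lambda>t. (\<eta> t)\<^sup>2"]
    by (auto simp: \<eta>_def join_def intro: set_integrable_subinterval)
  have ab: "{a..b} = {a..m} \<union> {m..b}" using m by auto
  have int: "set_integrable lebesgue {a..b} \<eta>" "set_integrable lebesgue {a..b} (\<lambda>t. (\<eta> t)\<^sup>2)"
    unfolding ab using L [of a m] R [of m b] m by (auto intro: set_integrable_Un)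
  have "2 * avg {a..b} \<eta> = 2 * fst z" "2 * avg {a..b} (\<lambda>t. (\<eta> t)\<^sup>2) = 2 * snd z"
    using avg_halves [OF int(1) \<open>a < b\<close>] avg_halves [OF int(2) \<open>a < b\<close>] L [of a m] R [of m b] m \<phi>(3,4) \<psi>(3,4)
      arg_cong [OF z(2), of fst] arg_cong [OF z(2), of snd]
    by (simp_all flip: m_def)
  then have avgs: "avg {a..b} \<eta> = fst z" "avg {a..b} (\<lambda>t. (\<eta> t)\<^sup>2) = snd z" by simp_all
  have "\<eta> \<in> test_functions \<epsilon> {a..b} z"
  proof (rule test_functionsI [OF int avgs _ \<open>0 \<le> \<epsilon>\<close>])
    fix J assume J: "J \<in> dyadic_lattice {a..b}"
    consider "J = {a..b}" | "J \<in> dyadic_lattice {a..m}" | "J \<in> dyadic_lattice {m..b}"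
      using dyadic_lattice_split [OF J \<open>a < b\<close>] by (auto simp: m_def)
    then show "avg_variance \<eta> J \<le> \<epsilon>\<^sup>2"
    proof cases
      case 1
      then show ?thesis using z(1) avgs by (auto simp: avg_variance_def Omega_def)
    next
      case 2
      then obtain c d where cd: "J = {c..d}" "a \<le> c" "c < d" "d \<le> m"
        using dyadic_lattice_interval [OF _ m(1)] by blast
      then have "avg_variance \<eta> J = avg_variance \<phi> J"
        using L [of c d] by (simp add: avg_variance_def)
      then show ?thesis using \<phi>(5) [OF 2] by simp
    next
      case 3
      then obtain c d where cd: "J = {c..d}" "m \<le> c" "c < d" "d \<le> b"
        using dyadic_lattice_interval [OF _ m(2)] by blast
      then have "avg_variance \<eta> J = avg_variance \<psi> J"
        using R [of c d] by (simp add: avg_variance_def)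
      then show ?thesis using \<psi>(5) [OF 3] by simp
    qed
  qed
  then show ?thesis by (simp add: \<eta>_def m_def)
qed

lemma avg_nn_join:
  assumes "a < b" and int: "set_integrable lebesgue {a..(a + b) / 2} \<phi>" "set_integrable lebesgue {(a + b) / 2..b} \<psi>"
  shows "2 * avg_nn {a..b} (\<lambda>t. exp (join ((a + b) / 2) \<phi> \<psi> t)) =
    avg_nn {a..(a + b) / 2} (\<lambda>t. exp (\<phi> t)) + avg_nn {(a + b) / 2..b} (\<lambda>t. exp (\<psi> t))"
proof -
  define m where "m = (a + b) / 2"
  have m: "a < m" "m < b" using \<open>a < b\<close> by (auto simp: m_def)
  have len: "1 / (m - a) = 2 * (1 / (b - a))" "1 / (b - m) = 2 * (1 / (b - a))"
    using \<open>a < b\<close> by (auto simp: m_def field_simps)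
  have two: "ennreal (2 * (1 / (b - a))) = 2 * ennreal (1 / (b - a))"
    using ennreal_mult' [of 2 "1 / (b - a)"] by simp
  have "AE t in lebesgue. t \<noteq> m"
    by (rule AE_I' [of "{m}"]) (auto simp: negligible_iff_null_sets [symmetric])
  then have "AE t in lebesgue. ennreal (exp (join m \<phi> \<psi> t)) * indicator {a..b} t =
      ennreal (exp (\<phi> t)) * indicator {a..m} t + ennreal (exp (\<psi> t)) * indicator {m..b} t"
    by eventually_elim (use m in \<open>auto simp: join_def indicator_def\<close>)
  then have "(\<integral>\<^sup>+t\<in>{a..b}. ennreal (exp (join m \<phi> \<psi> t)) \<partial>lebesgue) =
      (\<integral>\<^sup>+t. ennreal (exp (\<phi> t)) * indicator {a..m} t + ennreal (exp (\<psi> t)) * indicator {m..b} t \<partial>lebesgue)"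
    by (rule nn_integral_cong_AE)
  also have "\<dots> = (\<integral>\<^sup>+t\<in>{a..m}. ennreal (exp (\<phi> t)) \<partial>lebesgue) + (\<integral>\<^sup>+t\<in>{m..b}. ennreal (exp (\<psi> t)) \<partial>lebesgue)"
    using int by (intro nn_integral_add borel_measurable_exp_indicator) (auto simp: m_def)
  finally have I: "(\<integral>\<^sup>+t\<in>{a..b}. ennreal (exp (join m \<phi> \<psi> t)) \<partial>lebesgue) =
    (\<integral>\<^sup>+t\<in>{a..m}. ennreal (exp (\<phi> t)) \<partial>lebesgue) + (\<integral>\<^sup>+t\<in>{m..b}. ennreal (exp (\<psi> t)) \<partial>lebesgue)" .
  show ?thesis
    unfolding m_def [symmetric] avg_nn_eq [OF \<open>a < b\<close>] avg_nn_eq [OF m(1)] avg_nn_eq [OF m(2)] len two I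
    by (simp add: distrib_left mult.assoc)
qed

lemma avg_const: "c < d \<Longrightarrow> avg {c..d} (\<lambda>t. h) = h"
  by (simp add: avg_def set_integral_const)

lemma const_in_test_functions:
  assumes "a < b" "0 \<le> \<epsilon>"
  shows "(\<lambda>t. u) \<in> test_functions \<epsilon> {a..b} (u, u\<^sup>2)"
proof (rule test_functionsI)
  fix J assume "J \<in> dyadic_lattice {a..b}"
  then obtain c d where "J = {c..d}" "c < d" using dyadic_lattice_interval \<open>a < b\<close> by blast
  then show "avg_variance (\<lambda>t. u) J \<le> \<epsilon>\<^sup>2" by (simp add: avg_variance_def avg_const)
qed (use assms in \<open>auto intro: set_integrable_const_Icc avg_const\<close>)

lemma avg_nn_const:
  assumes "a < b" "0 \<le> h"
  shows "avg_nn {a..b} (\<lambda>t. h) = ennreal h"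
proof -
  have "avg_nn {a..b} (\<lambda>t. h) = ennreal (1 / (b - a)) * (ennreal h * ennreal (b - a))"
    using assms by (simp add: avg_nn_eq nn_integral_cmult_indicator)
  also have "\<dots> = ennreal h" using assms by (simp flip: ennreal_mult)
  finally show ?thesis .
qed

text \<open>The effect of replacing \<phi> by \<open>\<phi> + h\<close> on its two averages;
  \<open>x2 - x1\<^sup>2\<close> is preserved.\<close>

definition translate :: "real \<Rightarrow> real \<times> real \<Rightarrow> real \<times> real" where
  "translate h x = (fst x + h, snd x + 2 * h * fst x + h\<^sup>2)"

lemma translate_in_test_functions:
  assumes "a < b" "0 \<le> \<epsilon>" and \<phi>: "\<phi> \<in> test_functions \<epsilon> {a..b} x"
  shows "(\<lambda>t. \<phi> t + h) \<in> test_functions \<epsilon> {a..b} (translate h x)"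
proof -
  note \<phi> = test_functionsD [OF \<phi>]
  have sq: "(\<phi> t + h)\<^sup>2 = (\<phi> t)\<^sup>2 + 2 * h * \<phi> t + h\<^sup>2" for t
    by (simp add: power2_eq_square algebra_simps)
  have "set_integrable lebesgue {a..b} (\<lambda>t. (\<phi> t)\<^sup>2 + 2 * h * \<phi> t + h\<^sup>2)"
    using \<phi> by (intro set_integral_add set_integrable_mult_right set_integrable_const_Icc) auto
  then have int: "set_integrable lebesgue {a..b} (\<lambda>t. \<phi> t + h)" "set_integrable lebesgue {a..b} (\<lambda>t. (\<phi> t + h)\<^sup>2)"
    using \<phi> unfolding sq by (auto intro!: set_integral_add set_integrable_const_Icc)
  have avgs: "avg {c..d} (\<lambda>t. \<phi> t + h) = avg {c..d} \<phi> + h"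
    "avg {c..d} (\<lambda>t. (\<phi> t + h)\<^sup>2) = avg {c..d} (\<lambda>t. (\<phi> t)\<^sup>2) + 2 * h * avg {c..d} \<phi> + h\<^sup>2"
    if "a \<le> c" "c < d" "d \<le> b" for c d
    using that avg_affine [of c d \<phi> \<phi> 0 h] avg_affine [of c d "\<lambda>t. (\<phi> t)\<^sup>2" \<phi> "2 * h" "h\<^sup>2"] \<phi>
    unfolding sq by (auto simp: set_integrable_subinterval)
  show ?thesis
  proof (rule test_functionsI [OF int _ _ _ \<open>0 \<le> \<epsilon>\<close>])
    fix J assume J: "J \<in> dyadic_lattice {a..b}"
    then obtain c d where cd: "J = {c..d}" "a \<le> c" "c < d" "d \<le> b"
      using dyadic_lattice_interval \<open>a < b\<close> by blast
    then have "avg_variance (\<lambda>t. \<phi> t + h) J = avg_variance \<phi> J"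
      using avgs [of c d] by (simp add: avg_variance_def power2_eq_square algebra_simps)
    then show "avg_variance (\<lambda>t. \<phi> t + h) J \<le> \<epsilon>\<^sup>2" using \<phi>(5) [OF J] by simp
  qed (use avgs [of a b] \<phi>(3,4) \<open>a < b\<close> in \<open>auto simp: translate_def\<close>)
qed

lemma avg_nn_translate:
  assumes "a < b" "set_integrable lebesgue {a..b} \<phi>"
  shows "avg_nn {a..b} (\<lambda>t. exp (\<phi> t + h)) = ennreal (exp h) * avg_nn {a..b} (\<lambda>t. exp (\<phi> t))"
proof -
  have "(\<integral>\<^sup>+t\<in>{a..b}. ennreal (exp (\<phi> t + h)) \<partial>lebesgue) =
      (\<integral>\<^sup>+t. ennreal (exp h) * (ennreal (exp (\<phi> t)) * indicator {a..b} t) \<partial>lebesgue)"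
    by (intro nn_integral_cong) (simp add: exp_add ennreal_mult' mult_ac)
  also have "\<dots> = ennreal (exp h) * (\<integral>\<^sup>+t\<in>{a..b}. ennreal (exp (\<phi> t)) \<partial>lebesgue)"
    using assms by (intro nn_integral_cmult borel_measurable_exp_indicator)
  finally show ?thesis using \<open>a < b\<close> by (simp add: avg_nn_eq mult_ac)
qed

text \<open>\<open>d\<close> is the standard deviation \<open>sqrt (x2 - x1\<^sup>2)\<close>. This
  writes each point as the midpoint of two values of constant functions, which yields both
  nonemptiness and a finite bound for the infimum.\<close>

lemma Omega_two_valued:
  assumes "z \<in> Omega \<epsilon>"
  obtains d where "(fst z - d, (fst z - d)\<^sup>2) + (fst z + d, (fst z + d)\<^sup>2) = 2 *\<^sub>R z" "\<bar>d\<bar> \<le> \<bar>\<epsilon>\<bar>"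
proof
  let ?d = "sqrt (snd z - (fst z)\<^sup>2)"
  have "?d\<^sup>2 = snd z - (fst z)\<^sup>2" using assms by (auto simp: Omega_def)
  then show "(fst z - ?d, (fst z - ?d)\<^sup>2) + (fst z + ?d, (fst z + ?d)\<^sup>2) = 2 *\<^sub>R z"
    by (intro prod_eqI) (auto simp: power2_eq_square algebra_simps)
  have "?d \<le> \<bar>\<epsilon>\<bar>" using assms by (intro real_le_lsqrt) (auto simp: Omega_def)
  then show "\<bar>?d\<bar> \<le> \<bar>\<epsilon>\<bar>" using assms by (auto simp: Omega_def)
qed

lemma test_functions_nonempty:
  assumes "a < b" "0 \<le> \<epsilon>" "z \<in> Omega \<epsilon>"
  shows "test_functions \<epsilon> {a..b} z \<noteq> {}"
proof -
  obtain d where d: "(fst z - d, (fst z - d)\<^sup>2) + (fst z + d, (fst z + d)\<^sup>2) = 2 *\<^sub>R z"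
    using Omega_two_valued assms(3) by blast
  have "join ((a + b) / 2) (\<lambda>t. fst z - d) (\<lambda>t. fst z + d) \<in> test_functions \<epsilon> {a..b} z"
    using assms by (intro join_in_test_functions [OF _ _ _ d] const_in_test_functions) auto
  then show ?thesis by blast
qed

section \<open>Midpoint and translation inequalities for the Bellman functions\<close>

lemma bellman_sup_halves:
  assumes "a < b" "0 \<le> \<epsilon>" and xyz: "x \<in> Omega \<epsilon>" "y \<in> Omega \<epsilon>" "z \<in> Omega \<epsilon>" "x + y = 2 *\<^sub>R z"
  shows "bellman_sup \<epsilon> {a..(a + b) / 2} x + bellman_sup \<epsilon> {(a + b) / 2..b} y \<le> 2 * bellman_sup \<epsilon> {a..b} z"
proof -
  let ?m = "(a + b) / 2"
  have m: "a < ?m" "?m < b" using \<open>a < b\<close> by auto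
  \<comment> \<open>Adding a constant commutes with a supremum only over a nonempty family.\<close>
  note ne = test_functions_nonempty [OF m(1) \<open>0 \<le> \<epsilon>\<close> xyz(1)] test_functions_nonempty [OF m(2) \<open>0 \<le> \<epsilon>\<close> xyz(2)]
  have le: "avg_nn {a..?m} (\<lambda>t. exp (\<phi> t)) + avg_nn {?m..b} (\<lambda>t. exp (\<psi> t)) \<le> 2 * bellman_sup \<epsilon> {a..b} z"
    if "\<phi> \<in> test_functions \<epsilon> {a..?m} x" "\<psi> \<in> test_functions \<epsilon> {?m..b} y" for \<phi> \<psi>
  proof -
    have "avg_nn {a..b} (\<lambda>t. exp (join ?m \<phi> \<psi> t)) \<le> bellman_sup \<epsilon> {a..b} z"
      unfolding bellman_sup_def using join_in_test_functions [OF assms(1,2) xyz(3,4) that] by (rule SUP_upper)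
    then have "2 * avg_nn {a..b} (\<lambda>t. exp (join ?m \<phi> \<psi> t)) \<le> 2 * bellman_sup \<epsilon> {a..b} z"
      by (rule mult_left_mono) simp
    then show ?thesis
      using avg_nn_join [OF \<open>a < b\<close> test_functionsD(1) [OF that(1)] test_functionsD(1) [OF that(2)]] by simp
  qed
  have "avg_nn {a..?m} (\<lambda>t. exp (\<phi> t)) + bellman_sup \<epsilon> {?m..b} y \<le> 2 * bellman_sup \<epsilon> {a..b} z"
    if "\<phi> \<in> test_functions \<epsilon> {a..?m} x" for \<phi>
    unfolding bellman_sup_def [of \<epsilon> "{?m..b}"] add.commute [of "avg_nn {a..?m} _"]
      ennreal_SUP_add_left [OF ne(2), symmetric]
    using le [OF that] by (intro SUP_least) (simp add: add.commute)
  then show ?thesis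
    unfolding bellman_sup_def [of \<epsilon> "{a..?m}"] ennreal_SUP_add_left [OF ne(1), symmetric]
    by (rule SUP_least)
qed

lemma bellman_inf_halves:
  assumes "a < b" "0 \<le> \<epsilon>" and xyz: "x \<in> Omega \<epsilon>" "y \<in> Omega \<epsilon>" "z \<in> Omega \<epsilon>" "x + y = 2 *\<^sub>R z"
  shows "2 * bellman_inf \<epsilon> {a..b} z \<le> bellman_inf \<epsilon> {a..(a + b) / 2} x + bellman_inf \<epsilon> {(a + b) / 2..b} y"
proof (rule ennreal_le_epsilon)
  let ?m = "(a + b) / 2"
  have m: "a < ?m" "?m < b" using \<open>a < b\<close> by auto
  note ne = test_functions_nonempty [OF m(1) \<open>0 \<le> \<epsilon>\<close> xyz(1)] test_functions_nonempty [OF m(2) \<open>0 \<le> \<epsilon>\<close> xyz(2)]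
  fix e :: real
  assume fin: "bellman_inf \<epsilon> {a..?m} x + bellman_inf \<epsilon> {?m..b} y < top" and "0 < e"
  then have e: "0 < ennreal (e / 2)" by simp
  \<comment> \<open>Finiteness makes these inequalities strict, so that near-minimizers exist on
    both halves.\<close>
  have "bellman_inf \<epsilon> {a..?m} x < bellman_inf \<epsilon> {a..?m} x + ennreal (e / 2)"
    "bellman_inf \<epsilon> {?m..b} y < bellman_inf \<epsilon> {?m..b} y + ennreal (e / 2)"
    using fin e by (auto simp: ennreal_add_left_cancel_less less_top [symmetric] intro!: ennreal_lessI)
  then obtain \<phi> \<psi> where \<phi>: "\<phi> \<in> test_functions \<epsilon> {a..?m} x"
      "avg_nn {a..?m} (\<lambda>t. exp (\<phi> t)) < bellman_inf \<epsilon> {a..?m} x + ennreal (e / 2)"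
    and \<psi>: "\<psi> \<in> test_functions \<epsilon> {?m..b} y"
      "avg_nn {?m..b} (\<lambda>t. exp (\<psi> t)) < bellman_inf \<epsilon> {?m..b} y + ennreal (e / 2)"
    unfolding bellman_inf_def INF_less_iff by blast
  have "bellman_inf \<epsilon> {a..b} z \<le> avg_nn {a..b} (\<lambda>t. exp (join ?m \<phi> \<psi> t))"
    unfolding bellman_inf_def using join_in_test_functions [OF assms(1,2) xyz(3,4) \<phi>(1) \<psi>(1)] by (rule INF_lower)
  then have "2 * bellman_inf \<epsilon> {a..b} z \<le> 2 * avg_nn {a..b} (\<lambda>t. exp (join ?m \<phi> \<psi> t))"
    by (rule mult_left_mono) simp
  also have "\<dots> = avg_nn {a..?m} (\<lambda>t. exp (\<phi> t)) + avg_nn {?m..b} (\<lambda>t. exp (\<psi> t))"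
    by (rule avg_nn_join [OF \<open>a < b\<close> test_functionsD(1) [OF \<phi>(1)] test_functionsD(1) [OF \<psi>(1)]])
  also have "\<dots> \<le> (bellman_inf \<epsilon> {a..?m} x + ennreal (e / 2)) + (bellman_inf \<epsilon> {?m..b} y + ennreal (e / 2))"
    using \<phi>(2) \<psi>(2) by (intro add_mono) auto
  also have "\<dots> = bellman_inf \<epsilon> {a..?m} x + bellman_inf \<epsilon> {?m..b} y + (ennreal (e / 2) + ennreal (e / 2))"
    by (simp add: ac_simps)
  also have "ennreal (e / 2) + ennreal (e / 2) = ennreal e"
    using \<open>0 < e\<close> by (simp flip: ennreal_plus)
  finally show "2 * bellman_inf \<epsilon> {a..b} z \<le> bellman_inf \<epsilon> {a..?m} x + bellman_inf \<epsilon> {?m..b} y + ennreal e" .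
qed

lemma bellman_sup_translate:
  assumes "a < b" "0 \<le> \<epsilon>"
  shows "ennreal (exp h) * bellman_sup \<epsilon> {a..b} x \<le> bellman_sup \<epsilon> {a..b} (translate h x)"
  unfolding bellman_sup_def [of \<epsilon> _ x] SUP_mult_left_ennreal
proof (rule SUP_least)
  fix \<phi> assume \<phi>: "\<phi> \<in> test_functions \<epsilon> {a..b} x"
  have "avg_nn {a..b} (\<lambda>t. exp (\<phi> t + h)) \<le> bellman_sup \<epsilon> {a..b} (translate h x)"
    unfolding bellman_sup_def using translate_in_test_functions [OF assms \<phi>] by (rule SUP_upper)
  then show "ennreal (exp h) * avg_nn {a..b} (\<lambda>t. exp (\<phi> t)) \<le> bellman_sup \<epsilon> {a..b} (translate h x)"
    using avg_nn_translate [OF \<open>a < b\<close> test_functionsD(1) [OF \<phi>]] by simp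
qed

lemma bellman_inf_translate:
  assumes "a < b" "0 \<le> \<epsilon>"
  shows "bellman_inf \<epsilon> {a..b} (translate h x) \<le> ennreal (exp h) * bellman_inf \<epsilon> {a..b} x"
proof -
  have "ennreal (exp (- h)) * bellman_inf \<epsilon> {a..b} (translate h x) \<le> bellman_inf \<epsilon> {a..b} x"
    unfolding bellman_inf_def [of \<epsilon> _ x]
  proof (rule INF_greatest)
    fix \<phi> assume \<phi>: "\<phi> \<in> test_functions \<epsilon> {a..b} x"
    have "bellman_inf \<epsilon> {a..b} (translate h x) \<le> avg_nn {a..b} (\<lambda>t. exp (\<phi> t + h))"
      unfolding bellman_inf_def using translate_in_test_functions [OF assms \<phi>] by (rule INF_lower)
    also have "\<dots> = ennreal (exp h) * avg_nn {a..b} (\<lambda>t. exp (\<phi> t))"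
      using avg_nn_translate [OF \<open>a < b\<close> test_functionsD(1) [OF \<phi>]] by simp
    finally have "ennreal (exp (- h)) * bellman_inf \<epsilon> {a..b} (translate h x) \<le>
        ennreal (exp (- h)) * (ennreal (exp h) * avg_nn {a..b} (\<lambda>t. exp (\<phi> t)))"
      by (rule mult_left_mono) simp
    then show "ennreal (exp (- h)) * bellman_inf \<epsilon> {a..b} (translate h x) \<le> avg_nn {a..b} (\<lambda>t. exp (\<phi> t))"
      by (simp add: exp_minus flip: mult.assoc ennreal_mult)
  qed
  then have "ennreal (exp h) * (ennreal (exp (- h)) * bellman_inf \<epsilon> {a..b} (translate h x)) \<le>
      ennreal (exp h) * bellman_inf \<epsilon> {a..b} x"
    by (rule mult_left_mono) simp
  then show ?thesis by (simp add: exp_minus flip: mult.assoc ennreal_mult)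
qed

section \<open>The candidates on tangent segments\<close>

definition candidate :: "real \<Rightarrow> real \<Rightarrow> real \<times> real \<Rightarrow> real" where
  "candidate l \<delta> x = kern l (sqrt (\<delta>\<^sup>2 + (fst x)\<^sup>2 - snd x)) / kern l \<delta> * exp (fst x)"

lemma B_plus_eq_candidate: "B_plus \<delta> = candidate 1 \<delta>"
proof
  fix x :: "real \<times> real"
  show "B_plus \<delta> x = candidate 1 \<delta> x"
    by (cases x) (simp add: candidate_def kern_def exp_add exp_diff)
qed

lemma B_minus_eq_candidate: "B_minus \<delta> = candidate (-1) \<delta>"
proof
  fix x :: "real \<times> real"
  show "B_minus \<delta> x = candidate (-1) \<delta> x"
    by (cases x) (simp add: candidate_def kern_def exp_add exp_diff exp_minus field_simps)
qed

lemma continuous_on_candidate: "l * \<delta> < 1 \<Longrightarrow> continuous_on UNIV (candidate l \<delta>)"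
  unfolding candidate_def [abs_def] using kern_pos [of l \<delta>]
  by (intro continuous_intros) auto

lemma candidate_parabola:
  assumes "l * \<delta> < 1" "0 \<le> \<delta>"
  shows "candidate l \<delta> (u, u\<^sup>2) = exp u"
  using kern_pos [OF assms(1)] assms(2) by (simp add: candidate_def)

lemma Omega_sqrt_bounds:
  assumes "x \<in> Omega \<epsilon>" "0 \<le> \<epsilon>" "\<epsilon> \<le> \<delta>"
  defines "s \<equiv> sqrt (\<delta>\<^sup>2 + (fst x)\<^sup>2 - snd x)"
  shows "sqrt (\<delta>\<^sup>2 - \<epsilon>\<^sup>2) \<le> s" "0 \<le> s" "s \<le> \<delta>" "s\<^sup>2 = \<delta>\<^sup>2 + (fst x)\<^sup>2 - snd x"
proof -
  have x: "(fst x)\<^sup>2 \<le> snd x" "snd x \<le> (fst x)\<^sup>2 + \<epsilon>\<^sup>2" using assms(1) by (auto simp: Omega_def)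
  have "\<epsilon>\<^sup>2 \<le> \<delta>\<^sup>2" using assms by (intro power_mono)
  then show "0 \<le> s" "s\<^sup>2 = \<delta>\<^sup>2 + (fst x)\<^sup>2 - snd x" using x by (auto simp: s_def)
  show "sqrt (\<delta>\<^sup>2 - \<epsilon>\<^sup>2) \<le> s" using x by (simp add: s_def)
  show "s \<le> \<delta>" unfolding s_def using x assms by (intro real_le_lsqrt) auto
qed

lemma sign_less_one:
  assumes l: "l = 1 \<or> l = -(1::real)" and "l * \<delta> < 1" "0 \<le> s" "s \<le> \<delta>"
  shows "l * s < 1"
  using assms by auto

lemma candidate_midpoint_concave:
  assumes l: "l = 1 \<or> l = -1" and \<epsilon>: "0 \<le> \<epsilon>" "\<epsilon> \<le> \<delta>" and \<delta>: "l * \<delta> < 1" and bal: "balance l \<epsilon> \<delta> = 0"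
  shows "midpoint_concave \<epsilon> (\<lambda>x. l * candidate l \<delta> x)"
  unfolding midpoint_concave_def
proof (intro ballI impI)
  fix x y z assume xyz: "x \<in> Omega \<epsilon>" "y \<in> Omega \<epsilon>" "z \<in> Omega \<epsilon>" and mid: "x + y = 2 *\<^sub>R z"
  define p where "p = sqrt (\<delta>\<^sup>2 + (fst x)\<^sup>2 - snd x)"
  define q where "q = sqrt (\<delta>\<^sup>2 + (fst y)\<^sup>2 - snd y)"
  define s where "s = sqrt (\<delta>\<^sup>2 + (fst z)\<^sup>2 - snd z)"
  \<comment> \<open>The factor \<open>l\<close> makes \<open>l * d\<close> the actual horizontal
    displacement, as the definition of \<open>defect\<close> expects.\<close>
  define d where "d = l * (fst x - fst z)"
  define s0 where "s0 = sqrt (\<delta>\<^sup>2 - \<epsilon>\<^sup>2)"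
  note p = Omega_sqrt_bounds [OF xyz(1) \<epsilon>, folded p_def s0_def]
  note q = Omega_sqrt_bounds [OF xyz(2) \<epsilon>, folded q_def s0_def]
  note s = Omega_sqrt_bounds [OF xyz(3) \<epsilon>, folded s_def s0_def]
  have ll: "l * l = 1" using l by auto
  have y: "fst y = 2 * fst z - fst x" "snd y = 2 * snd z - snd x"
    using arg_cong [OF mid, of fst] arg_cong [OF mid, of snd] by auto
  have "d\<^sup>2 = (fst x - fst z)\<^sup>2" using l by (auto simp: d_def power2_commute)
  then have eq: "2 * s\<^sup>2 + 2 * d\<^sup>2 = p\<^sup>2 + q\<^sup>2"
    unfolding p(4) q(4) s(4) y by (simp add: power2_eq_square algebra_simps)
  have "\<epsilon>\<^sup>2 \<le> \<delta>\<^sup>2" using \<epsilon> by (intro power_mono)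
  then have s0: "0 \<le> s0" "s0\<^sup>2 = \<delta>\<^sup>2 - \<epsilon>\<^sup>2" by (auto simp: s0_def)
  have "0 \<le> defect l d s p q"
  proof (rule defect_nonneg [OF l s0(1)])
    show "defect l (\<epsilon> / sqrt 2) s0 s0 \<delta> = 0"
      unfolding s0_def defect_balance bal by simp
  qed (use \<epsilon> p q s s0 eq in \<open>auto simp: power_divide\<close>)
  moreover have "l * d = fst x - fst z" "- l * d = fst y - fst z"
    using ll by (simp_all add: d_def y flip: mult.assoc)
  ultimately have "0 \<le> l * (2 * kern l s - exp (fst x - fst z) * kern l p - exp (fst y - fst z) * kern l q)"
    unfolding defect_def by (simp only:)
  then have "0 \<le> exp (fst z) / kern l \<delta> *
      (l * (2 * kern l s - exp (fst x - fst z) * kern l p - exp (fst y - fst z) * kern l q))"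
    by (rule mult_nonneg_nonneg [rotated]) (use kern_pos [OF \<delta>] in simp)
  also have "\<dots> = l * (2 * (kern l s / kern l \<delta> * exp (fst z)) - kern l p / kern l \<delta> * exp (fst x)
      - kern l q / kern l \<delta> * exp (fst y))"
    by (simp add: exp_diff divide_simps)
  finally show "l * candidate l \<delta> x + l * candidate l \<delta> y \<le> 2 * (l * candidate l \<delta> z)"
    by (simp add: candidate_def p_def q_def s_def algebra_simps)
qed

lemma candidate_nonneg:
  assumes l: "l = 1 \<or> l = -1" and "0 \<le> \<epsilon>" "\<epsilon> \<le> \<delta>" "l * \<delta> < 1" "x \<in> Omega \<epsilon>"
  shows "0 \<le> candidate l \<delta> x"
proof -
  note s = Omega_sqrt_bounds [OF assms(5,2,3)]
  show ?thesis
    using kern_pos [OF assms(4)] kern_pos [OF sign_less_one [OF l assms(4) s(2,3)]]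
    unfolding candidate_def by (intro mult_nonneg_nonneg divide_nonneg_pos) auto
qed

text \<open>Supplies the constant \<open>C = exp \<delta>\<close> for the minorant theorem:
  \<open>kern (-1)\<close> is at most 1 on nonnegative arguments, and
  \<open>kern (-1) \<delta> \<ge> exp (- \<delta>)\<close>.\<close>

lemma candidate_upper:
  assumes "0 \<le> \<epsilon>" "\<epsilon> \<le> \<delta>" "x \<in> Omega \<epsilon>"
  shows "candidate (-1) \<delta> x \<le> exp \<delta> * exp (fst x)"
proof -
  note s = Omega_sqrt_bounds [OF assms(3,1,2)]
  have "kern (-1) (sqrt (\<delta>\<^sup>2 + (fst x)\<^sup>2 - snd x)) \<le> kern (-1) 0"
    using s by (intro kern_decreasing) auto
  moreover have "1 \<le> kern (-1) \<delta> * exp \<delta>"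
    using assms by (simp add: kern_def mult.assoc flip: exp_add)
  ultimately have "kern (-1) (sqrt (\<delta>\<^sup>2 + (fst x)\<^sup>2 - snd x)) \<le> kern (-1) \<delta> * exp \<delta>"
    by (simp add: kern_def)
  moreover have "0 < kern (-1) \<delta>" using assms by (intro kern_pos) simp
  ultimately have "kern (-1) (sqrt (\<delta>\<^sup>2 + (fst x)\<^sup>2 - snd x)) / kern (-1) \<delta> \<le> exp \<delta>"
    by (simp add: divide_le_eq mult.commute)
  then show ?thesis unfolding candidate_def by (intro mult_right_mono) auto
qed

text \<open>A bound from below replaces continuity. Every \<open>r\<close> is the midpoint of an end
  point, where \<open>G\<close> is nonnegative, and a second point of the interval, so any lower
  bound \<open>- K\<close> improves to \<open>- K / 2\<close>, and this repeats.\<close>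

lemma midpoint_concave_nonneg:
  fixes G :: "real \<Rightarrow> real"
  assumes mid: "\<And>r t. \<lbrakk>p \<le> r; r \<le> q; p \<le> t; t \<le> q\<rbrakk> \<Longrightarrow> G r + G t \<le> 2 * G ((r + t) / 2)"
    and ends: "0 \<le> G p" "0 \<le> G q"
    and bound: "\<And>r. \<lbrakk>p \<le> r; r \<le> q\<rbrakk> \<Longrightarrow> - K \<le> G r"
    and r: "p \<le> r" "r \<le> q"
  shows "0 \<le> G r"
proof -
  have step: "- (K * (1 / 2) ^ n) \<le> G r" if "p \<le> r" "r \<le> q" for n r
    using that
  proof (induction n arbitrary: r)
    case 0
    then show ?case using bound by simp
  next
    case (Suc n)
    show ?case
    proof (cases "2 * r - p \<le> q")
      case True
      then have "G p + G (2 * r - p) \<le> 2 * G ((p + (2 * r - p)) / 2)"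
        using Suc.prems by (intro mid) auto
      moreover have "- (K * (1 / 2) ^ n) \<le> G (2 * r - p)" using True Suc.prems by (intro Suc.IH) auto
      ultimately show ?thesis using ends by simp
    next
      case False
      then have "G (2 * r - q) + G q \<le> 2 * G ((2 * r - q + q) / 2)"
        using Suc.prems by (intro mid) auto
      moreover have "- (K * (1 / 2) ^ n) \<le> G (2 * r - q)" using False Suc.prems by (intro Suc.IH) auto
      ultimately show ?thesis using ends by simp
    qed
  qed
  have "(\<lambda>n. - (K * (1 / 2) ^ n)) \<longlonglongrightarrow> - (K * 0)"
    by (intro tendsto_minus tendsto_mult tendsto_const LIMSEQ_realpow_zero) auto
  then have "- (K * 0) \<le> G r"
    using step [OF r] by (intro LIMSEQ_le_const2) auto
  then show ?thesis by simp
qed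

text \<open>The tangent to the upper boundary of \<open>Omega \<delta>\<close> at first coordinate \<open>a\<close>; \<open>r = \<delta>\<close> lies on the lower
  boundary and \<open>r = sqrt (\<delta>\<^sup>2 - \<epsilon>\<^sup>2)\<close> on the upper boundary of \<open>Omega \<epsilon>\<close>.\<close>

definition tangent_point :: "real \<Rightarrow> real \<Rightarrow> real \<Rightarrow> real \<Rightarrow> real \<times> real" where
  "tangent_point l \<delta> a r = (a - l * r, (a - l * r)\<^sup>2 + (\<delta>\<^sup>2 - r\<^sup>2))"

text \<open>As \<open>l\<^sup>2 = 1\<close>, the quadratic terms in \<open>r\<close> cancel, and
  both coordinates are affine in \<open>r\<close>.\<close>

lemma tangent_point_mid:
  assumes "l = 1 \<or> l = -1"
  shows "tangent_point l \<delta> a r + tangent_point l \<delta> a t = 2 *\<^sub>R tangent_point l \<delta> a ((r + t) / 2)"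
  using assms by (intro prod_eqI) (auto simp: tangent_point_def power2_eq_square field_simps)

lemma tangent_point_in_Omega:
  assumes "0 \<le> \<epsilon>" "\<epsilon> \<le> \<delta>" "sqrt (\<delta>\<^sup>2 - \<epsilon>\<^sup>2) \<le> r" "r \<le> \<delta>"
  shows "tangent_point l \<delta> a r \<in> Omega \<epsilon>"
proof -
  have "\<epsilon>\<^sup>2 \<le> \<delta>\<^sup>2" using assms by (intro power_mono)
  then have "0 \<le> sqrt (\<delta>\<^sup>2 - \<epsilon>\<^sup>2)" by simp
  then have "0 \<le> r" using assms(3) by linarith
  then have "r\<^sup>2 \<le> \<delta>\<^sup>2" "\<delta>\<^sup>2 - \<epsilon>\<^sup>2 \<le> r\<^sup>2"
    using assms by (auto intro!: power_mono dest: sqrt_le_D)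
  then show ?thesis by (auto simp: tangent_point_def Omega_def)
qed

lemma candidate_tangent_point:
  assumes "0 \<le> r"
  shows "candidate l \<delta> (tangent_point l \<delta> a r) = (1 - l * r) * exp a / kern l \<delta>"
proof -
  have "sqrt (\<delta>\<^sup>2 + (a - l * r)\<^sup>2 - ((a - l * r)\<^sup>2 + (\<delta>\<^sup>2 - r\<^sup>2))) = r" using assms by simp
  moreover have "exp (l * r) * exp (a - l * r) = exp a" by (simp flip: exp_add)
  ultimately show ?thesis
    by (simp add: candidate_def tangent_point_def kern_def) 
qed

lemma Omega_tangent_point:
  assumes "x \<in> Omega \<epsilon>" "0 \<le> \<epsilon>" "\<epsilon> \<le> \<delta>"
  defines "s \<equiv> sqrt (\<delta>\<^sup>2 + (fst x)\<^sup>2 - snd x)"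
  shows "tangent_point l \<delta> (fst x + l * s) s = x"
  using Omega_sqrt_bounds(4) [OF assms(1,2,3), folded s_def] by (simp add: tangent_point_def)

text \<open>The extremal split of an upper boundary point is into a point of the lower boundary and a
  translate of the same upper boundary point.\<close>

lemma upper_boundary_split:
  assumes "l = 1 \<or> l = -1"
  shows "(- l * (\<epsilon> / sqrt 2), (- l * (\<epsilon> / sqrt 2))\<^sup>2) + (l * (\<epsilon> / sqrt 2), (l * (\<epsilon> / sqrt 2))\<^sup>2 + \<epsilon>\<^sup>2) = 2 *\<^sub>R (0, \<epsilon>\<^sup>2)"
  using assms by (intro prod_eqI) (auto simp: power_divide)

text \<open>\<open>W\<close> stands for a Bellman function, known only through midpoint concavity of
  \<open>l * W\<close>, translation, its boundary values and a crude bound. The self-similar split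
  bounds \<open>W\<close> on the upper boundary; along a tangent the candidate is affine, and
  \<open>l * (W - candidate)\<close> is nonnegative at both ends.\<close>

lemma candidate_le_of_midpoint_concave:
  assumes l: "l = 1 \<or> l = -1" and \<epsilon>: "0 \<le> \<epsilon>" "\<epsilon> \<le> \<delta>" and \<delta>: "l * \<delta> < 1" and bal: "balance l \<epsilon> \<delta> = 0"
    and conc: "midpoint_concave \<epsilon> (\<lambda>x. l * W x)"
    and transl: "\<And>u. l * (exp u * W (0, \<epsilon>\<^sup>2)) \<le> l * W (u, u\<^sup>2 + \<epsilon>\<^sup>2)"
    and parab: "\<And>u. l * exp u \<le> l * W (u, u\<^sup>2)"
    and bound: "\<And>x. x \<in> Omega \<epsilon> \<Longrightarrow> - (K * exp (fst x)) \<le> l * W x" and K: "0 \<le> K"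
    and x: "x \<in> Omega \<epsilon>"
  shows "l * candidate l \<delta> x \<le> l * W x"
proof -
  define s0 where "s0 = sqrt (\<delta>\<^sup>2 - \<epsilon>\<^sup>2)"
  define c where "c = \<epsilon> / sqrt 2"
  define M where "M = W (0, \<epsilon>\<^sup>2)"
  have "\<epsilon>\<^sup>2 \<le> \<delta>\<^sup>2" using \<epsilon> by (intro power_mono)
  then have s0: "0 \<le> s0" "s0 \<le> \<delta>" "s0\<^sup>2 = \<delta>\<^sup>2 - \<epsilon>\<^sup>2" using \<epsilon> by (auto simp: s0_def intro!: real_le_lsqrt)
  have k\<delta>: "0 < kern l \<delta>" by (rule kern_pos [OF \<delta>])
  have k0: "0 < kern l s0" by (intro kern_pos sign_less_one [OF l \<delta>] s0)
  have bal': "kern l s0 * (2 - exp (l * c)) = kern l \<delta> * exp (- l * c)"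
    using bal by (simp add: balance_def s0_def c_def)
  then have "0 < 2 - exp (l * c)" using k0 k\<delta>
    by (metis exp_gt_zero mult_pos_pos zero_less_mult_pos)
  \<comment> \<open>The right end point is a translate of the midpoint, so the inequality bounds
    \<open>M\<close> in terms of itself; \<open>bal'\<close> then identifies the bound as the
    candidate at \<open>(0, \<epsilon>\<^sup>2)\<close>.\<close>
  have "l * W (- l * c, (- l * c)\<^sup>2) + l * W (l * c, (l * c)\<^sup>2 + \<epsilon>\<^sup>2) \<le> 2 * (l * W (0, \<epsilon>\<^sup>2))"
  proof (rule conc [unfolded midpoint_concave_def, rule_format])
    show "(- l * c, (- l * c)\<^sup>2) + (l * c, (l * c)\<^sup>2 + \<epsilon>\<^sup>2) = 2 *\<^sub>R (0, \<epsilon>\<^sup>2)"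
      unfolding c_def by (rule upper_boundary_split [OF l])
  qed (auto simp: Omega_def)
  then have "l * exp (- l * c) + l * (exp (l * c) * M) \<le> 2 * (l * M)"
    using parab [of "- l * c"] transl [of "l * c"] by (simp add: M_def)
  then have "l * exp (- l * c) \<le> (2 - exp (l * c)) * (l * M)" by (simp add: algebra_simps)
  then have "kern l s0 * (l * exp (- l * c)) \<le> kern l s0 * ((2 - exp (l * c)) * (l * M))"
    using k0 by (intro mult_left_mono) auto
  also have "\<dots> = (kern l s0 * (2 - exp (l * c))) * (l * M)" by simp
  also have "\<dots> = exp (- l * c) * (kern l \<delta> * (l * M))" unfolding bal' by simp
  finally have "exp (- l * c) * (l * kern l s0) \<le> exp (- l * c) * (kern l \<delta> * (l * M))"
    by (simp add: mult_ac)
  then have "l * kern l s0 \<le> kern l \<delta> * (l * M)" by simp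
  then have M: "l * (kern l s0 / kern l \<delta>) \<le> l * M"
    using k\<delta> by (simp add: divide_le_eq mult.commute)
  define s where "s = sqrt (\<delta>\<^sup>2 + (fst x)\<^sup>2 - snd x)"
  define a where "a = fst x + l * s"
  note s = Omega_sqrt_bounds [OF x \<epsilon>, folded s_def s0_def]
  have xs: "tangent_point l \<delta> a s = x"
    unfolding a_def s_def by (rule Omega_tangent_point [OF x \<epsilon>])
  define G where "G r = l * W (tangent_point l \<delta> a r) - l * ((1 - l * r) * exp a / kern l \<delta>)" for r
  have in_Omega: "tangent_point l \<delta> a r \<in> Omega \<epsilon>" if "s0 \<le> r" "r \<le> \<delta>" for r
    using tangent_point_in_Omega [OF \<epsilon>] that by (simp add: s0_def)
  have "0 \<le> G s"
  proof (rule midpoint_concave_nonneg [where G = G and p = s0 and q = \<delta>])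
    fix r t assume rt: "s0 \<le> r" "r \<le> \<delta>" "s0 \<le> t" "t \<le> \<delta>"
    have "l * W (tangent_point l \<delta> a r) + l * W (tangent_point l \<delta> a t)
        \<le> 2 * (l * W (tangent_point l \<delta> a ((r + t) / 2)))"
      using rt
      by (intro conc [unfolded midpoint_concave_def, rule_format, OF _ _ _ tangent_point_mid [OF l]] in_Omega) auto
    moreover have "l * ((1 - l * r) * exp a / kern l \<delta>) + l * ((1 - l * t) * exp a / kern l \<delta>) =
        2 * (l * ((1 - l * ((r + t) / 2)) * exp a / kern l \<delta>))"
      using k\<delta> by (simp add: field_simps)
    ultimately show "G r + G t \<le> 2 * G ((r + t) / 2)" by (simp add: G_def)
  next
    have "exp (a - l * s0) * (l * (kern l s0 / kern l \<delta>)) \<le> exp (a - l * s0) * (l * M)"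
      using M by (rule mult_left_mono) simp
    also have "\<dots> \<le> l * W (tangent_point l \<delta> a s0)"
      using transl [of "a - l * s0"] s0 by (simp add: M_def tangent_point_def mult_ac)
    also have "exp (a - l * s0) * (l * (kern l s0 / kern l \<delta>)) = l * ((1 - l * s0) * exp a / kern l \<delta>)"
      by (simp add: kern_def exp_diff)
    finally show "0 \<le> G s0" by (simp add: G_def)
    have "l * ((1 - l * \<delta>) * exp a / kern l \<delta>) = l * exp (a - l * \<delta>)"
      using \<delta> by (simp add: kern_def exp_diff)
    then show "0 \<le> G \<delta>"
      using parab [of "a - l * \<delta>"] by (simp add: G_def tangent_point_def)
  next
    \<comment> \<open>Any bound independent of \<open>r\<close> suffices here; it may depend on the
      tangent through \<open>a\<close>.\<close>
    fix r assume r: "s0 \<le> r" "r \<le> \<delta>"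
    have lr: "\<bar>l * r\<bar> \<le> \<delta>" using l s0 r by (auto simp: abs_mult)
    have "K * exp (a - l * r) \<le> K * exp (a + \<delta>)" using lr K by (intro mult_left_mono) auto
    moreover have "- (K * exp (a - l * r)) \<le> l * W (tangent_point l \<delta> a r)"
      using bound [OF in_Omega [OF r]] by (simp add: tangent_point_def)
    moreover have "l * ((1 - l * r) * exp a / kern l \<delta>) \<le> (1 + \<delta>) * exp a / kern l \<delta>"
    proof -
      have "l * (1 - l * r) \<le> 1 + \<delta>" using l s0 r by (auto simp: algebra_simps)
      then have "(l * (1 - l * r)) * exp a / kern l \<delta> \<le> (1 + \<delta>) * exp a / kern l \<delta>"
        using k\<delta> by (intro divide_right_mono mult_right_mono) auto
      then show ?thesis by (simp add: mult.assoc)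
    qed
    ultimately show "- (K * exp (a + \<delta>) + (1 + \<delta>) * exp a / kern l \<delta>) \<le> G r"
      by (simp add: G_def)
  qed (use s in auto)
  moreover have "candidate l \<delta> x = (1 - l * s) * exp a / kern l \<delta>"
    using candidate_tangent_point [OF s(2), of l \<delta> a] unfolding xs .
  ultimately show ?thesis by (simp add: G_def xs)
qed

section \<open>The Bellman functions\<close>

text \<open>Taking the infimum (supremum) over all intervals makes the midpoint inequalities below available
  without proving that the Bellman functions do not depend on the interval.\<close>

definition sup_all :: "real \<Rightarrow> real \<times> real \<Rightarrow> ennreal" where
  "sup_all \<epsilon> x = (INF (a, b)\<in>{(a, b). a < b}. bellman_sup \<epsilon> {a..b} x)"

definition inf_all :: "real \<Rightarrow> real \<times> real \<Rightarrow> ennreal" where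
  "inf_all \<epsilon> x = (SUP (a, b)\<in>{(a, b). a < b}. bellman_inf \<epsilon> {a..b} x)"

lemma sup_all_le: "a < b \<Longrightarrow> sup_all \<epsilon> x \<le> bellman_sup \<epsilon> {a..b} x"
  unfolding sup_all_def by (rule INF_lower2 [of "(a, b)"]) auto

lemma inf_all_ge: "a < b \<Longrightarrow> bellman_inf \<epsilon> {a..b} x \<le> inf_all \<epsilon> x"
  unfolding inf_all_def by (rule SUP_upper2 [of "(a, b)"]) auto

lemma le_sup_allI: "(\<And>a b. a < b \<Longrightarrow> k \<le> bellman_sup \<epsilon> {a..b} x) \<Longrightarrow> k \<le> sup_all \<epsilon> x"
  unfolding sup_all_def by (auto intro!: INF_greatest)

lemma inf_all_leI: "(\<And>a b. a < b \<Longrightarrow> bellman_inf \<epsilon> {a..b} x \<le> k) \<Longrightarrow> inf_all \<epsilon> x \<le> k"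
  unfolding inf_all_def by (auto intro!: SUP_least)

lemma sup_all_midpoint:
  assumes "0 \<le> \<epsilon>" "x \<in> Omega \<epsilon>" "y \<in> Omega \<epsilon>" "z \<in> Omega \<epsilon>" "x + y = 2 *\<^sub>R z"
  shows "sup_all \<epsilon> x + sup_all \<epsilon> y \<le> 2 * sup_all \<epsilon> z"
proof -
  have "(sup_all \<epsilon> x + sup_all \<epsilon> y) / 2 \<le> sup_all \<epsilon> z"
  proof (rule le_sup_allI)
    fix a b :: real assume "a < b"
    have "sup_all \<epsilon> x + sup_all \<epsilon> y \<le> bellman_sup \<epsilon> {a..(a + b) / 2} x + bellman_sup \<epsilon> {(a + b) / 2..b} y"
      using \<open>a < b\<close> by (intro add_mono sup_all_le) auto
    also have "\<dots> \<le> 2 * bellman_sup \<epsilon> {a..b} z"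
      using \<open>a < b\<close> assms by (intro bellman_sup_halves)
    finally show "(sup_all \<epsilon> x + sup_all \<epsilon> y) / 2 \<le> bellman_sup \<epsilon> {a..b} z"
      by (intro divide_le_posI_ennreal) auto
  qed
  then have "2 * ((sup_all \<epsilon> x + sup_all \<epsilon> y) / 2) \<le> 2 * sup_all \<epsilon> z" by (rule mult_left_mono) simp
  moreover have "2 * (k / 2) = k" for k :: ennreal
    by (simp add: ennreal_times_divide ennreal_mult_divide_eq mult.commute [of 2])
  ultimately show ?thesis by simp
qed

lemma inf_all_midpoint:
  assumes "0 \<le> \<epsilon>" "x \<in> Omega \<epsilon>" "y \<in> Omega \<epsilon>" "z \<in> Omega \<epsilon>" "x + y = 2 *\<^sub>R z"
  shows "2 * inf_all \<epsilon> z \<le> inf_all \<epsilon> x + inf_all \<epsilon> y"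
  unfolding inf_all_def [of \<epsilon> z] SUP_mult_left_ennreal
proof (rule SUP_least, clarsimp)
  fix a b :: real assume "a < b"
  have "2 * bellman_inf \<epsilon> {a..b} z \<le> bellman_inf \<epsilon> {a..(a + b) / 2} x + bellman_inf \<epsilon> {(a + b) / 2..b} y"
    using \<open>a < b\<close> assms by (intro bellman_inf_halves)
  also have "\<dots> \<le> inf_all \<epsilon> x + inf_all \<epsilon> y"
    using \<open>a < b\<close> by (intro add_mono inf_all_ge) auto
  finally show "2 * bellman_inf \<epsilon> {a..b} z \<le> inf_all \<epsilon> x + inf_all \<epsilon> y" .
qed

lemma sup_all_translate:
  assumes "0 \<le> \<epsilon>"
  shows "ennreal (exp h) * sup_all \<epsilon> x \<le> sup_all \<epsilon> (translate h x)"
proof (rule le_sup_allI)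
  fix a b :: real assume "a < b"
  have "ennreal (exp h) * sup_all \<epsilon> x \<le> ennreal (exp h) * bellman_sup \<epsilon> {a..b} x"
    using sup_all_le [OF \<open>a < b\<close>] by (rule mult_left_mono) simp
  also have "\<dots> \<le> bellman_sup \<epsilon> {a..b} (translate h x)"
    by (rule bellman_sup_translate [OF \<open>a < b\<close> assms])
  finally show "ennreal (exp h) * sup_all \<epsilon> x \<le> bellman_sup \<epsilon> {a..b} (translate h x)" .
qed

lemma inf_all_translate:
  assumes "0 \<le> \<epsilon>"
  shows "inf_all \<epsilon> (translate h x) \<le> ennreal (exp h) * inf_all \<epsilon> x"
proof (rule inf_all_leI)
  fix a b :: real assume "a < b"
  have "bellman_inf \<epsilon> {a..b} (translate h x) \<le> ennreal (exp h) * bellman_inf \<epsilon> {a..b} x"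
    by (rule bellman_inf_translate [OF \<open>a < b\<close> assms])
  also have "\<dots> \<le> ennreal (exp h) * inf_all \<epsilon> x"
    using inf_all_ge [OF \<open>a < b\<close>] by (rule mult_left_mono) simp
  finally show "bellman_inf \<epsilon> {a..b} (translate h x) \<le> ennreal (exp h) * inf_all \<epsilon> x" .
qed

lemma sup_all_parabola:
  assumes "0 \<le> \<epsilon>"
  shows "ennreal (exp u) \<le> sup_all \<epsilon> (u, u\<^sup>2)"
proof (rule le_sup_allI)
  fix a b :: real assume "a < b"
  have "avg_nn {a..b} (\<lambda>t. exp u) \<le> bellman_sup \<epsilon> {a..b} (u, u\<^sup>2)"
    unfolding bellman_sup_def using const_in_test_functions [OF \<open>a < b\<close> assms] by (rule SUP_upper)
  then show "ennreal (exp u) \<le> bellman_sup \<epsilon> {a..b} (u, u\<^sup>2)" using \<open>a < b\<close> by (simp add: avg_nn_const)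
qed

lemma inf_all_parabola:
  assumes "0 \<le> \<epsilon>"
  shows "inf_all \<epsilon> (u, u\<^sup>2) \<le> ennreal (exp u)"
proof (rule inf_all_leI)
  fix a b :: real assume "a < b"
  have "bellman_inf \<epsilon> {a..b} (u, u\<^sup>2) \<le> avg_nn {a..b} (\<lambda>t. exp u)"
    unfolding bellman_inf_def using const_in_test_functions [OF \<open>a < b\<close> assms] by (rule INF_lower)
  then show "bellman_inf \<epsilon> {a..b} (u, u\<^sup>2) \<le> ennreal (exp u)" using \<open>a < b\<close> by (simp add: avg_nn_const)
qed

text \<open>Gives finiteness of \<open>inf_all\<close> and the bound
  \<open>K = exp \<epsilon>\<close> needed on tangents.\<close>

lemma inf_all_bound:
  assumes "0 \<le> \<epsilon>" "x \<in> Omega \<epsilon>"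
  shows "inf_all \<epsilon> x \<le> ennreal (exp \<epsilon> * exp (fst x))"
proof -
  obtain d where d: "(fst x - d, (fst x - d)\<^sup>2) + (fst x + d, (fst x + d)\<^sup>2) = 2 *\<^sub>R x" "\<bar>d\<bar> \<le> \<bar>\<epsilon>\<bar>"
    using Omega_two_valued assms(2) by blast
  have "inf_all \<epsilon> (fst x + h, (fst x + h)\<^sup>2) \<le> ennreal (exp \<epsilon> * exp (fst x))" if "\<bar>h\<bar> \<le> \<epsilon>" for h
  proof -
    have "exp (fst x + h) \<le> exp \<epsilon> * exp (fst x)" using that by (simp flip: exp_add)
    then show ?thesis using inf_all_parabola [OF assms(1), of "fst x + h"] ennreal_leI order_trans by blast
  qed
  from this [of d] this [of "- d"]
  have le: "inf_all \<epsilon> (fst x - d, (fst x - d)\<^sup>2) + inf_all \<epsilon> (fst x + d, (fst x + d)\<^sup>2) \<le> 2 * ennreal (exp \<epsilon> * exp (fst x))"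
    using d(2) assms(1) unfolding mult_2 by (intro add_mono) auto
  have "2 * inf_all \<epsilon> x \<le> inf_all \<epsilon> (fst x - d, (fst x - d)\<^sup>2) + inf_all \<epsilon> (fst x + d, (fst x + d)\<^sup>2)"
    by (intro inf_all_midpoint [OF assms(1) _ _ assms(2) d(1)]) (auto simp: Omega_def)
  also note le
  finally show ?thesis by (simp add: ennreal_mult_le_mult_iff)
qed

section \<open>Agreement of the Bellman functions with the candidates\<close>

lemma bellman_sup_le_candidate:
  assumes "a < b" and \<epsilon>: "0 \<le> \<epsilon>" "\<epsilon> \<le> \<delta>" and \<delta>: "\<delta> < 1" and bal: "balance 1 \<epsilon> \<delta> = 0"
  shows "bellman_sup \<epsilon> {a..b} x \<le> ennreal (candidate 1 \<delta> x)"
  unfolding bellman_sup_def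
proof (rule SUP_least)
  fix \<phi> assume "\<phi> \<in> test_functions \<epsilon> {a..b} x"
  then show "avg_nn {a..b} (\<lambda>t. exp (\<phi> t)) \<le> ennreal (candidate 1 \<delta> x)"
    using candidate_midpoint_concave [of 1 \<epsilon> \<delta>] \<epsilon> \<delta> bal \<open>a < b\<close>
    by (intro avg_nn_exp_le_majorant [of \<phi> \<epsilon>] continuous_on_candidate candidate_nonneg [of 1 \<epsilon>] candidate_parabola) auto
qed

lemma candidate_le_bellman_inf:
  assumes "a < b" and \<epsilon>: "0 \<le> \<epsilon>" "\<epsilon> \<le> \<delta>" and bal: "balance (-1) \<epsilon> \<delta> = 0"
  shows "ennreal (candidate (-1) \<delta> x) \<le> bellman_inf \<epsilon> {a..b} x"
  unfolding bellman_inf_def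
proof (rule INF_greatest)
  fix \<phi> assume "\<phi> \<in> test_functions \<epsilon> {a..b} x"
  then show "ennreal (candidate (-1) \<delta> x) \<le> avg_nn {a..b} (\<lambda>t. exp (\<phi> t))"
    using candidate_midpoint_concave [of "-1" \<epsilon> \<delta>] \<epsilon> bal \<open>a < b\<close>
    by (intro avg_nn_exp_ge_minorant [of \<phi> \<epsilon> _ _ _ _ "exp \<delta>"] continuous_on_candidate candidate_upper candidate_parabola) auto
qed

lemma translate_upper_boundary: "translate u (0, \<epsilon>\<^sup>2) = (u, u\<^sup>2 + \<epsilon>\<^sup>2)"
  by (simp add: translate_def)

theorem bellman_sup_eq_candidate:
  assumes "a < b" and \<epsilon>: "0 \<le> \<epsilon>" "\<epsilon> \<le> \<delta>" and \<delta>: "\<delta> < 1" and bal: "balance 1 \<epsilon> \<delta> = 0" and x: "x \<in> Omega \<epsilon>"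
  shows "bellman_sup \<epsilon> {a..b} x = ennreal (candidate 1 \<delta> x)"
proof (rule antisym)
  show "bellman_sup \<epsilon> {a..b} x \<le> ennreal (candidate 1 \<delta> x)"
    by (rule bellman_sup_le_candidate) fact+
  \<comment> \<open>\<open>enn2real\<close> sends \<open>top\<close> to 0, so finiteness must be
    known before \<open>W\<close> can represent \<open>sup_all\<close>; it follows from the upper
    bound already proved.\<close>
  define W where "W y = enn2real (sup_all \<epsilon> y)" for y
  have "sup_all \<epsilon> y \<le> ennreal (candidate 1 \<delta> y)" for y
    using sup_all_le [OF \<open>a < b\<close>] bellman_sup_le_candidate [OF \<open>a < b\<close> \<epsilon> \<delta> bal] by (rule order_trans)
  then have fin: "sup_all \<epsilon> y < top" for y by (rule le_less_trans) simp
  have W: "sup_all \<epsilon> y = ennreal (W y)" "0 \<le> W y" for y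
    using fin [of y] by (auto simp: W_def)
  have "1 * candidate 1 \<delta> x \<le> 1 * W x"
  proof (rule candidate_le_of_midpoint_concave [where K = 0])
    show "midpoint_concave \<epsilon> (\<lambda>x. 1 * W x)"
      unfolding midpoint_concave_def
    proof (intro ballI impI)
      fix x y z assume "x \<in> Omega \<epsilon>" "y \<in> Omega \<epsilon>" "z \<in> Omega \<epsilon>" "x + y = 2 *\<^sub>R z"
      then have "ennreal (W x) + ennreal (W y) \<le> 2 * ennreal (W z)"
        using sup_all_midpoint [OF \<epsilon>(1)] unfolding W(1) by blast
      then have "ennreal (W x + W y) \<le> ennreal (2 * W z)" using W(2) by (simp add: ennreal_mult')
      then show "1 * W x + 1 * W y \<le> 2 * (1 * W z)" using W(2) by (simp add: ennreal_le_iff del: ennreal_plus)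
    qed
    fix u
    have "ennreal (exp u) * ennreal (W (0, \<epsilon>\<^sup>2)) \<le> ennreal (W (u, u\<^sup>2 + \<epsilon>\<^sup>2))"
      using sup_all_translate [OF \<epsilon>(1), of u "(0, \<epsilon>\<^sup>2)"] unfolding W(1) translate_upper_boundary .
    then show "1 * (exp u * W (0, \<epsilon>\<^sup>2)) \<le> 1 * W (u, u\<^sup>2 + \<epsilon>\<^sup>2)"
      using W(2) by (simp add: ennreal_le_iff flip: ennreal_mult)
    show "1 * exp u \<le> 1 * W (u, u\<^sup>2)"
      using sup_all_parabola [OF \<epsilon>(1), of u] W(2) unfolding W(1) by (simp add: ennreal_le_iff del: ennreal_plus)
  qed (use \<epsilon> \<delta> bal x W(2) in auto)
  then have "ennreal (candidate 1 \<delta> x) \<le> sup_all \<epsilon> x" unfolding W(1) by (simp add: ennreal_leI)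
  also have "\<dots> \<le> bellman_sup \<epsilon> {a..b} x" by (rule sup_all_le [OF \<open>a < b\<close>])
  finally show "ennreal (candidate 1 \<delta> x) \<le> bellman_sup \<epsilon> {a..b} x" .
qed

theorem bellman_inf_eq_candidate:
  assumes "a < b" and \<epsilon>: "0 \<le> \<epsilon>" "\<epsilon> \<le> \<delta>" and bal: "balance (-1) \<epsilon> \<delta> = 0" and x: "x \<in> Omega \<epsilon>"
  shows "bellman_inf \<epsilon> {a..b} x = ennreal (candidate (-1) \<delta> x)"
proof (rule antisym)
  show "ennreal (candidate (-1) \<delta> x) \<le> bellman_inf \<epsilon> {a..b} x"
    by (rule candidate_le_bellman_inf) fact+
  define W where "W y = enn2real (inf_all \<epsilon> y)" for y
  have W0: "0 \<le> W y" for y by (simp add: W_def)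
  \<comment> \<open>Restricted to \<open>Omega \<epsilon>\<close>: elsewhere the family of test
    functions is empty and the infimum is \<open>top\<close>.\<close>
  have W1: "inf_all \<epsilon> y = ennreal (W y)" if "y \<in> Omega \<epsilon>" for y
    using le_less_trans [OF inf_all_bound [OF \<epsilon>(1) that] ennreal_less_top] by (simp add: W_def)
  have "- 1 * candidate (-1) \<delta> x \<le> - 1 * W x"
  proof (rule candidate_le_of_midpoint_concave [where K = "exp \<epsilon>"])
    show "midpoint_concave \<epsilon> (\<lambda>x. - 1 * W x)"
      unfolding midpoint_concave_def
    proof (intro ballI impI)
      fix x y z assume xyz: "x \<in> Omega \<epsilon>" "y \<in> Omega \<epsilon>" "z \<in> Omega \<epsilon>" "x + y = 2 *\<^sub>R z"
      have "2 * ennreal (W z) \<le> ennreal (W x) + ennreal (W y)"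
        using inf_all_midpoint [OF \<epsilon>(1) xyz] W1 xyz by simp
      then have "ennreal (2 * W z) \<le> ennreal (W x + W y)" using W0 by (simp add: ennreal_mult')
      then show "- 1 * W x + - 1 * W y \<le> 2 * (- 1 * W z)" using W0 by (simp add: ennreal_le_iff del: ennreal_plus)
    qed
    fix u
    have "(0, \<epsilon>\<^sup>2) \<in> Omega \<epsilon>" "(u, u\<^sup>2 + \<epsilon>\<^sup>2) \<in> Omega \<epsilon>" "(u, u\<^sup>2) \<in> Omega \<epsilon>" by (auto simp: Omega_def)
    note W' = this [THEN W1]
    have "ennreal (W (u, u\<^sup>2 + \<epsilon>\<^sup>2)) \<le> ennreal (exp u) * ennreal (W (0, \<epsilon>\<^sup>2))"
      using inf_all_translate [OF \<epsilon>(1), of u "(0, \<epsilon>\<^sup>2)"] unfolding W' translate_upper_boundary .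
    then show "- 1 * (exp u * W (0, \<epsilon>\<^sup>2)) \<le> - 1 * W (u, u\<^sup>2 + \<epsilon>\<^sup>2)"
      using W0 by (simp add: ennreal_le_iff flip: ennreal_mult)
    show "- 1 * exp u \<le> - 1 * W (u, u\<^sup>2)"
      using inf_all_parabola [OF \<epsilon>(1), of u] unfolding W' by (simp add: ennreal_le_iff del: ennreal_plus)
  next
    fix y assume y: "y \<in> Omega \<epsilon>"
    then show "- (exp \<epsilon> * exp (fst y)) \<le> - 1 * W y"
      using inf_all_bound [OF \<epsilon>(1) y] W1 [OF y] by (simp add: ennreal_le_iff del: ennreal_plus)
  qed (use \<epsilon> bal x in auto)
  then have "inf_all \<epsilon> x \<le> ennreal (candidate (-1) \<delta> x)" unfolding W1 [OF x] by (simp add: ennreal_leI)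
  then show "bellman_inf \<epsilon> {a..b} x \<le> ennreal (candidate (-1) \<delta> x)"
    by (rule order_trans [OF inf_all_ge [OF \<open>a < b\<close>]])
qed

section \<open>The regime of infinite supremum, and the lower parabola\<close>

lemma sup_all_upper_boundary_infinite:
  assumes "sqrt 2 * ln 2 \<le> \<epsilon>"
  shows "sup_all \<epsilon> (u, u\<^sup>2 + \<epsilon>\<^sup>2) = \<infinity>"
proof -
  define c where "c = \<epsilon> / sqrt 2"
  have "0 < sqrt 2 * ln (2::real)" by simp
  then have \<epsilon>: "0 \<le> \<epsilon>" using assms by linarith
  have "ln 2 \<le> c" using assms by (simp add: c_def field_simps)
  then have c: "2 \<le> exp c" using exp_le_cancel_iff [of "ln 2" c] by simp
  have inf: "sup_all \<epsilon> (0, \<epsilon>\<^sup>2) = \<infinity>"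
  proof (rule ccontr)
    assume "\<not> ?thesis"
    then obtain M where M: "sup_all \<epsilon> (0, \<epsilon>\<^sup>2) = ennreal M" "0 \<le> M"
      by (metis ennreal_cases infinity_ennreal_def)
    \<comment> \<open>The self-similar split again: a finite \<open>M\<close> would satisfy
      \<open>exp (- c) + exp c * M \<le> 2 * M\<close>, impossible once
      \<open>exp c \<ge> 2\<close>.\<close>
    have "ennreal (exp (- c)) + ennreal (exp c) * ennreal M
        \<le> sup_all \<epsilon> (- c, (- c)\<^sup>2) + sup_all \<epsilon> (c, c\<^sup>2 + \<epsilon>\<^sup>2)"
      using sup_all_parabola [OF \<epsilon>, of "- c"] sup_all_translate [OF \<epsilon>, of c "(0, \<epsilon>\<^sup>2)"]
      unfolding translate_upper_boundary M by (rule add_mono)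
    also have "\<dots> \<le> 2 * sup_all \<epsilon> (0, \<epsilon>\<^sup>2)"
      using upper_boundary_split [of 1 \<epsilon>]
      by (intro sup_all_midpoint [OF \<epsilon>]) (auto simp: Omega_def c_def)
    finally have "ennreal (exp (- c) + exp c * M) \<le> ennreal (2 * M)"
      using M by (simp add: ennreal_mult')
    then have "exp (- c) + exp c * M \<le> 2 * M" using M by (simp add: ennreal_le_iff del: ennreal_plus)
    moreover have "2 * M \<le> exp c * M" using c M by (intro mult_right_mono)
    ultimately show False using exp_gt_zero [of "- c"] by linarith
  qed
  have "ennreal (exp u) * sup_all \<epsilon> (0, \<epsilon>\<^sup>2) \<le> sup_all \<epsilon> (u, u\<^sup>2 + \<epsilon>\<^sup>2)"
    using sup_all_translate [OF \<epsilon>, of u "(0, \<epsilon>\<^sup>2)"] unfolding translate_upper_boundary .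
  then show ?thesis by (simp add: inf ennreal_mult_top top_unique)
qed

text \<open>Infinity spreads along the tangents to the upper boundary of
  \<open>Omega \<epsilon>\<close> itself, from \<open>r = 0\<close> towards
  \<open>r = \<epsilon>\<close>: a midpoint is infinite as soon as one end is. Generation
  \<open>n\<close> reaches \<open>\<epsilon> * (1 - (1 / 2) ^ n)\<close>, by pairing
  \<open>2 * r - \<epsilon>\<close> with the lower boundary point \<open>\<epsilon>\<close>.\<close>

lemma sup_all_infinite:
  assumes \<epsilon>: "sqrt 2 * ln 2 \<le> \<epsilon>" and x: "x \<in> Omega \<epsilon>" "(fst x)\<^sup>2 < snd x"
  shows "sup_all \<epsilon> x = \<infinity>"
proof -
  have "0 < sqrt 2 * ln (2::real)" by simp
  then have \<epsilon>0: "0 < \<epsilon>" using \<epsilon> by linarith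
  have point: "tangent_point 1 \<epsilon> a r \<in> Omega \<epsilon>" if "0 \<le> r" "r \<le> \<epsilon>" for a r
    using tangent_point_in_Omega [of \<epsilon> \<epsilon> r] that \<epsilon>0 by simp
  have start: "sup_all \<epsilon> (tangent_point 1 \<epsilon> a 0) = \<infinity>" for a
    using sup_all_upper_boundary_infinite [OF \<epsilon>, of a] by (simp add: tangent_point_def)
  have inf: "sup_all \<epsilon> (tangent_point 1 \<epsilon> a r) = \<infinity>"
    if "0 \<le> r" "r \<le> \<epsilon> * (1 - (1 / 2) ^ n)" for a r n
    using that
  proof (induction n arbitrary: r)
    case 0
    then show ?case using start by simp
  next
    case (Suc n)
    have "\<epsilon> * (1 - (1 / 2) ^ Suc n) \<le> \<epsilon> * 1" using \<epsilon>0 by (intro mult_left_mono) auto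
    then have r: "0 \<le> r" "r \<le> \<epsilon>" using Suc.prems by linarith+
    obtain t where t: "0 \<le> t" "t \<le> \<epsilon>" "sup_all \<epsilon> (tangent_point 1 \<epsilon> a t) = \<infinity>" "0 \<le> 2 * r - t" "2 * r - t \<le> \<epsilon>"
    proof (cases "2 * r \<le> \<epsilon>")
      case True
      then show ?thesis using r \<epsilon>0 start by (intro that [of 0]) auto
    next
      case False
      have "2 * r - \<epsilon> \<le> \<epsilon> * (1 - (1 / 2) ^ n)" using Suc.prems by (simp add: algebra_simps)
      then show ?thesis using False r \<epsilon>0 by (intro that [of "2 * r - \<epsilon>"] Suc.IH) auto
    qed
    have "(t + (2 * r - t)) / 2 = r" by simp
    then have "tangent_point 1 \<epsilon> a t + tangent_point 1 \<epsilon> a (2 * r - t) = 2 *\<^sub>R tangent_point 1 \<epsilon> a r"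
      using tangent_point_mid [of 1 \<epsilon> a t "2 * r - t"] by simp
    then have "\<infinity> + sup_all \<epsilon> (tangent_point 1 \<epsilon> a (2 * r - t)) \<le> 2 * sup_all \<epsilon> (tangent_point 1 \<epsilon> a r)"
      using sup_all_midpoint [of \<epsilon> "tangent_point 1 \<epsilon> a t"] point t r \<epsilon>0 by (metis less_imp_le)
    then have "2 * sup_all \<epsilon> (tangent_point 1 \<epsilon> a r) = top" by (simp add: top_unique)
    then show ?case by (simp add: ennreal_mult_eq_top_iff)
  qed
  define s where "s = sqrt (\<epsilon>\<^sup>2 + (fst x)\<^sup>2 - snd x)"
  have s: "0 \<le> s" "s < \<epsilon>"
    using Omega_sqrt_bounds [OF x(1), of \<epsilon>] \<epsilon>0 x(2) by (auto simp: s_def intro!: real_less_lsqrt)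
  have "(\<lambda>n. \<epsilon> * (1 - (1 / 2) ^ n)) \<longlonglongrightarrow> \<epsilon> * (1 - 0)"
    by (intro tendsto_mult tendsto_diff tendsto_const LIMSEQ_realpow_zero) auto
  then have "eventually (\<lambda>n. s < \<epsilon> * (1 - (1 / 2) ^ n)) sequentially"
    using s by (intro order_tendstoD) auto
  then obtain n where "s < \<epsilon> * (1 - (1 / 2) ^ n)" by (auto simp: eventually_sequentially)
  then have "sup_all \<epsilon> (tangent_point 1 \<epsilon> (fst x + 1 * s) s) = \<infinity>"
    using s by (intro inf [of s n]) auto
  then show ?thesis
    using Omega_tangent_point [OF x(1), of \<epsilon> 1] \<epsilon>0 by (simp add: s_def)
qed

text \<open>Zero variance over \<open>{a..b}\<close> forces \<open>\<phi> = u\<close> almost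
  everywhere there.\<close>

lemma avg_nn_exp_parabola:
  assumes "a < b" and \<phi>: "\<phi> \<in> test_functions \<epsilon> {a..b} (u, u\<^sup>2)"
  shows "avg_nn {a..b} (\<lambda>t. exp (\<phi> t)) = ennreal (exp u)"
proof -
  note \<phi> = test_functionsD [OF \<phi>, simplified]
  have sq: "(\<phi> t)\<^sup>2 + (- 2 * u) * \<phi> t + u\<^sup>2 = (\<phi> t - u)\<^sup>2" for t
    by (simp add: power2_eq_square algebra_simps)
  have int: "set_integrable lebesgue {a..b} (\<lambda>t. (\<phi> t - u)\<^sup>2)"
    unfolding sq [symmetric] using \<phi>
    by (intro set_integral_add set_integrable_mult_right set_integrable_const_Icc) auto
  have "avg {a..b} (\<lambda>t. (\<phi> t - u)\<^sup>2) = 0"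
    unfolding sq [symmetric] using avg_affine [OF \<phi>(2,1) \<open>a < b\<close>, of "- 2 * u" "u\<^sup>2"] \<phi>(3,4)
    by (simp add: power2_eq_square)
  then have "(LINT t|lebesgue. indicator {a..b} t *\<^sub>R (\<phi> t - u)\<^sup>2) = 0"
    using \<open>a < b\<close> by (simp add: avg_def set_lebesgue_integral_def)
  then have "AE t in lebesgue. indicator {a..b} t *\<^sub>R (\<phi> t - u)\<^sup>2 = 0"
    using int unfolding set_integrable_def
    by (subst (asm) integral_nonneg_eq_0_iff_AE) auto
  then have "AE t in lebesgue. ennreal (exp (\<phi> t)) * indicator {a..b} t = ennreal (exp u) * indicator {a..b} t"
    by eventually_elim (auto simp: indicator_def split: if_splits)
  then have "avg_nn {a..b} (\<lambda>t. exp (\<phi> t)) = avg_nn {a..b} (\<lambda>t. exp u)"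
    unfolding avg_nn_def by (intro arg_cong2 [where f = "(/)"] nn_integral_cong_AE) auto
  then show ?thesis using \<open>a < b\<close> by (simp add: avg_nn_const)
qed

lemma bellman_sup_parabola:
  assumes "a < b" "0 \<le> \<epsilon>"
  shows "bellman_sup \<epsilon> {a..b} (u, u\<^sup>2) = ennreal (exp u)"
proof (rule antisym)
  show "bellman_sup \<epsilon> {a..b} (u, u\<^sup>2) \<le> ennreal (exp u)"
    unfolding bellman_sup_def using avg_nn_exp_parabola [OF \<open>a < b\<close>] by (intro SUP_least) auto
  show "ennreal (exp u) \<le> bellman_sup \<epsilon> {a..b} (u, u\<^sup>2)"
    using sup_all_parabola [OF assms(2)] sup_all_le [OF assms(1)] by (rule order_trans)
qed

lemma bellman_sup_infinite:
  assumes "a < b" "sqrt 2 * ln 2 \<le> \<epsilon>" "x \<in> Omega \<epsilon>"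
  shows "bellman_sup \<epsilon> {a..b} x = (if snd x = (fst x)\<^sup>2 then ennreal (exp (fst x)) else \<infinity>)"
proof (cases "snd x = (fst x)\<^sup>2")
  case True
  have "0 < sqrt 2 * ln (2::real)" by simp
  then have "0 \<le> \<epsilon>" using assms by linarith
  moreover have "x = (fst x, (fst x)\<^sup>2)" using True by (intro prod_eqI) auto
  ultimately have "bellman_sup \<epsilon> {a..b} x = ennreal (exp (fst x))"
    using bellman_sup_parabola [OF \<open>a < b\<close>, of \<epsilon> "fst x"] by simp
  then show ?thesis using True by simp
next
  case False
  then have "sup_all \<epsilon> x = \<infinity>"
    using assms by (intro sup_all_infinite) (auto simp: Omega_def)
  then have "bellman_sup \<epsilon> {a..b} x = \<infinity>"
    using sup_all_le [OF \<open>a < b\<close>, of \<epsilon> x] by (simp add: top_unique)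
  then show ?thesis using False by simp
qed

lemma balance_zero: "0 \<le> \<delta> \<Longrightarrow> balance l 0 \<delta> = 0"
  by (simp add: balance_def)

text \<open>At \<open>\<epsilon> = 0\<close> every \<open>\<delta> \<ge> 0\<close> solves both
  equations, so uniqueness is stated for \<open>0 < \<epsilon>\<close> and the formulas for every
  admissible root. The condition \<open>\<delta> < 1\<close> keeps the denominator in
  \<open>B_plus\<close> positive; for positive \<epsilon> below \<open>sqrt 2 * ln 2\<close> every
  root satisfies it.\<close>

theorem mainTheorem4:
  fixes a b \<epsilon> :: real and x :: "real \<times> real"
  assumes "a < b" and "0 \<le> \<epsilon>" and "x \<in> Omega \<epsilon>"
  shows "(\<epsilon> < sqrt 2 * ln 2 \<longrightarrow>
            (0 < \<epsilon> \<longrightarrow> (\<exists>!\<delta>. \<epsilon> \<le> \<delta> \<and> delta_plus_eq \<epsilon> \<delta>)) \<and>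
            (\<exists>\<delta>. \<epsilon> \<le> \<delta> \<and> \<delta> < 1 \<and> delta_plus_eq \<epsilon> \<delta>) \<and>
            (\<forall>\<delta>. \<epsilon> \<le> \<delta> \<and> \<delta> < 1 \<and> delta_plus_eq \<epsilon> \<delta> \<longrightarrow>
               bellman_sup \<epsilon> {a..b} x = ennreal (B_plus \<delta> x))) \<and>
         (sqrt 2 * ln 2 \<le> \<epsilon> \<longrightarrow>
            bellman_sup \<epsilon> {a..b} x =
              (if snd x = (fst x)\<^sup>2 then ennreal (exp (fst x)) else \<infinity>)) \<and>
         (0 < \<epsilon> \<longrightarrow> (\<exists>!\<delta>. \<epsilon> \<le> \<delta> \<and> delta_minus_eq \<epsilon> \<delta>)) \<and>
         (\<exists>\<delta>. \<epsilon> \<le> \<delta> \<and> delta_minus_eq \<epsilon> \<delta>) \<and>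
         (\<forall>\<delta>. \<epsilon> \<le> \<delta> \<and> delta_minus_eq \<epsilon> \<delta> \<longrightarrow>
            bellman_inf \<epsilon> {a..b} x = ennreal (B_minus \<delta> x))"
proof (intro conjI impI allI)
  assume less: "\<epsilon> < sqrt 2 * ln 2"
  show "\<exists>!\<delta>. \<epsilon> \<le> \<delta> \<and> delta_plus_eq \<epsilon> \<delta>" if "0 < \<epsilon>"
  proof (rule ex_ex1I)
    show "\<exists>\<delta>. \<epsilon> \<le> \<delta> \<and> delta_plus_eq \<epsilon> \<delta>"
      using plus_root_exists [OF that less] by (auto simp: delta_plus_eq_iff)
    fix \<delta> \<delta>' assume roots: "\<epsilon> \<le> \<delta> \<and> delta_plus_eq \<epsilon> \<delta>" "\<epsilon> \<le> \<delta>' \<and> delta_plus_eq \<epsilon> \<delta>'"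
    then have "\<delta> < 1" "\<delta>' < 1"
      using plus_root_less_one [OF that less] by (auto simp: delta_plus_eq_iff)
    then have "\<not> \<delta> < \<delta>'" "\<not> \<delta>' < \<delta>"
      using roots balance_unique [of 1 \<epsilon> \<delta> \<delta>'] balance_unique [of 1 \<epsilon> \<delta>' \<delta>] that
      by (auto simp: delta_plus_eq_iff)
    then show "\<delta> = \<delta>'" by simp
  qed
  show "\<exists>\<delta>. \<epsilon> \<le> \<delta> \<and> \<delta> < 1 \<and> delta_plus_eq \<epsilon> \<delta>"
  proof (cases "\<epsilon> = 0")
    case True
    then show ?thesis by (intro exI [of _ 0]) (auto simp: delta_plus_eq_iff balance_zero)
  next
    case False
    then show ?thesis using plus_root_exists [of \<epsilon>] \<open>0 \<le> \<epsilon>\<close> less by (auto simp: delta_plus_eq_iff)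
  qed
next
  fix \<delta> assume "\<epsilon> \<le> \<delta> \<and> \<delta> < 1 \<and> delta_plus_eq \<epsilon> \<delta>"
  then show "bellman_sup \<epsilon> {a..b} x = ennreal (B_plus \<delta> x)"
    using assms unfolding B_plus_eq_candidate
    by (intro bellman_sup_eq_candidate) (auto simp: delta_plus_eq_iff)
next
  assume "sqrt 2 * ln 2 \<le> \<epsilon>"
  then show "bellman_sup \<epsilon> {a..b} x = (if snd x = (fst x)\<^sup>2 then ennreal (exp (fst x)) else \<infinity>)"
    using assms by (intro bellman_sup_infinite)
next
  assume "0 < \<epsilon>"
  show "\<exists>!\<delta>. \<epsilon> \<le> \<delta> \<and> delta_minus_eq \<epsilon> \<delta>"
  proof (rule ex_ex1I)
    show "\<exists>\<delta>. \<epsilon> \<le> \<delta> \<and> delta_minus_eq \<epsilon> \<delta>"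
      using minus_root_exists [OF \<open>0 < \<epsilon>\<close>] by (auto simp: delta_minus_eq_iff)
    fix \<delta> \<delta>' assume "\<epsilon> \<le> \<delta> \<and> delta_minus_eq \<epsilon> \<delta>" "\<epsilon> \<le> \<delta>' \<and> delta_minus_eq \<epsilon> \<delta>'"
    then have "\<not> \<delta> < \<delta>'" "\<not> \<delta>' < \<delta>"
      using balance_unique [of "-1" \<epsilon> \<delta> \<delta>'] balance_unique [of "-1" \<epsilon> \<delta>' \<delta>] \<open>0 < \<epsilon>\<close>
      by (auto simp: delta_minus_eq_iff)
    then show "\<delta> = \<delta>'" by simp
  qed
next
  show "\<exists>\<delta>. \<epsilon> \<le> \<delta> \<and> delta_minus_eq \<epsilon> \<delta>"
  proof (cases "\<epsilon> = 0")
    case True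
    then show ?thesis by (intro exI [of _ 0]) (auto simp: delta_minus_eq_iff balance_zero)
  next
    case False
    then show ?thesis using minus_root_exists [of \<epsilon>] \<open>0 \<le> \<epsilon>\<close> by (auto simp: delta_minus_eq_iff)
  qed
next
  fix \<delta> assume "\<epsilon> \<le> \<delta> \<and> delta_minus_eq \<epsilon> \<delta>"
  then show "bellman_inf \<epsilon> {a..b} x = ennreal (B_minus \<delta> x)"
    using assms unfolding B_minus_eq_candidate
    by (intro bellman_inf_eq_candidate) (auto simp: delta_minus_eq_iff)
qed

end
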